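(* The general solution to Hitchin's case $\alpha=\beta=\gamma=\delta=\frac18$ of the sixth Painlevé equation (in the form displayed in the context) is $$y=\frac{\sqrt{x}}{\theta_1^2}\left\{\frac{\pi\,\vartheta_2^2\;\theta_2\,\theta_3\,\theta_4}{\theta_1'+2\pi A\,\theta_1}-\theta_2^2\right\},$$ where $A,B$ are free constants, the functions $\theta_1'$ and $\theta_k$ are understood as $\theta_1'$ and $\theta_k$ evaluated at $$\Big(A\tfrac{K(\sqrt{x})}{K'(\sqrt{x})}+B\,\Big|\,i\tfrac{K(\sqrt{x})}{K'(\sqrt{x})}\Big),$$ and $\vartheta_2=\vartheta_2\Big(i\frac{K(\sqrt{x})}{K'(\sqrt{x})}\Big)$.
   Context: The sixth Painlevé equation with parameters $(\alpha,\beta,\gamma,\delta)$ is taken in the form $$y_{xx}=\tfrac12\Big(\tfrac1y+\tfrac1{y-1}+\tfrac1{y-x}\Big)y_x^2-\Big(\tfrac1x+\tfrac1{x-1}+\tfrac1{y-x}\Big)y_x+\frac{y(y-1)(y-x)}{x^2(x-1)^2}\Big\{\alpha-\beta\frac{x}{y^2}+\gamma\frac{x-1}{(y-1)^2}-\big(\delta-\tfrac12\big)\frac{x(x-1)}{(y-x)^2}\Big\}.$$ Theta functions: for integers $a,b$, $\theta\big[{a\atop b}\big](z|\tau)=\sum_{k\in\mathbb Z}\exp\big(\pi i(k+\tfrac a2)^2\tau+2\pi i(k+\tfrac a2)(z+\tfrac b2)\big)$, and $\theta_1=-\theta\big[{1\atop1}\big]$, $\theta_2=\theta\big[{1\atop0}\big]$,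 $\theta_3=\theta\big[{0\atop0}\big]$, $\theta_4=\theta\big[{0\atop1}\big]$; $\vartheta_k(\tau)=\theta_k(0|\tau)$; $\theta_1'(z|\tau)=\partial_z\theta_1(z|\tau)$. Complete elliptic integrals: $K(\sqrt x)=\frac\pi2\,{}_2F_1(\frac12,\frac12;1|x)$, $K'(\sqrt x)=\frac\pi2\,{}_2F_1(\frac12,\frac12;1|1-x)$. *)

theory Defs
  imports "HOL-Complex_Analysis.Complex_Analysis"
begin

definition PVI_rhs ::
  "complex \<Rightarrow> complex \<Rightarrow> complex \<Rightarrow> complex \<Rightarrow> complex \<Rightarrow> complex \<Rightarrow> complex \<Rightarrow> complex" where
  "PVI_rhs \<alpha> \<beta> \<gamma> \<delta> x y p =
     1/2 * (1/y + 1/(y - 1) + 1/(y - x)) * p^2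
     - (1/x + 1/(x - 1) + 1/(y - x)) * p
     + y * (y - 1) * (y - x) / (x^2 * (x - 1)^2) *
       (\<alpha> - \<beta> * (x / y^2) + \<gamma> * ((x - 1) / (y - 1)^2)
        - (\<delta> - 1/2) * (x * (x - 1) / (y - x)^2))"

(* A solution may have poles, and may pass through the values 0, 1, x at which the right-hand side
   is singular; the equation is therefore required off a set without accumulation points in the
   domain.  The constraints on y x exclude the functions 0, 1, x, for which the right-hand side
   is meaningless. *)
definition PVI_solution ::
  "complex \<Rightarrow> complex \<Rightarrow> complex \<Rightarrow> complex \<Rightarrow> complex set \<Rightarrow> (complex \<Rightarrow> complex) \<Rightarrow> bool" where
  "PVI_solution \<alpha> \<beta> \<gamma> \<delta> D y \<longleftrightarrow>
     y meromorphic_on D \<and>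
     (\<forall>\<^sub>\<approx>x\<in>D. y x \<noteq> 0 \<and> y x \<noteq> 1 \<and> y x \<noteq> x \<and>
        deriv (deriv y) x = PVI_rhs \<alpha> \<beta> \<gamma> \<delta> x (y x) (deriv y x))"

definition theta_char :: "int \<Rightarrow> int \<Rightarrow> complex \<Rightarrow> complex \<Rightarrow> complex" where
  "theta_char a b z \<tau> =
     (\<Sum>\<^sub>\<infinity>k\<in>(UNIV :: int set).
        exp (of_real pi * \<i> * (of_int k + of_int a / 2)^2 * \<tau>
             + 2 * of_real pi * \<i> * (of_int k + of_int a / 2) * (z + of_int b / 2)))"

definition theta1 :: "complex \<Rightarrow> complex \<Rightarrow> complex" where
  "theta1 z \<tau> = - theta_char 1 1 z \<tau>"

definition theta2 :: "complex \<Rightarrow> complex \<Rightarrow> complex" where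
  "theta2 = theta_char 1 0"

definition theta3 :: "complex \<Rightarrow> complex \<Rightarrow> complex" where
  "theta3 = theta_char 0 0"

definition theta4 :: "complex \<Rightarrow> complex \<Rightarrow> complex" where
  "theta4 = theta_char 0 1"

definition theta1' :: "complex \<Rightarrow> complex \<Rightarrow> complex" where
  "theta1' z \<tau> = deriv (\<lambda>w. theta1 w \<tau>) z"

definition vartheta2 :: "complex \<Rightarrow> complex" where
  "vartheta2 \<tau> = theta2 0 \<tau>"

(* Principal branch: the analytic continuation of the Gauss series from the unit disc to the plane
   cut along the real half-line from 1 to infinity.  It is unique on the cut plane by the identity
   theorem, and exists whenever c is not a nonpositive integer. *)
definition hyp2F1 :: "complex \<Rightarrow> complex \<Rightarrow> complex \<Rightarrow> complex \<Rightarrow> complex" where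
  "hyp2F1 a b c = (SOME f.
     f holomorphic_on - complex_of_real ` {1..} \<and>
     (\<forall>z. norm z < 1 \<longrightarrow>
        (\<lambda>n. pochhammer a n * pochhammer b n / (pochhammer c n * fact n) * z^n) sums f z))"

(* The complete elliptic integrals are taken as functions of x, the square of the modulus:
   K_sqrt x stands for K(sqrt x), and K'_sqrt x for K'(sqrt x). *)
definition K_sqrt :: "complex \<Rightarrow> complex" where
  "K_sqrt x = of_real pi / 2 * hyp2F1 (1/2) (1/2) 1 x"

definition K'_sqrt :: "complex \<Rightarrow> complex" where
  "K'_sqrt x = of_real pi / 2 * hyp2F1 (1/2) (1/2) 1 (1 - x)"

(* The domain on which K_sqrt, K'_sqrt and the principal square root are all holomorphic. *)
definition cut_plane :: "complex set" where
  "cut_plane = - complex_of_real ` ({..0} \<union> {1..})"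

definition hitchin_y :: "complex \<Rightarrow> complex \<Rightarrow> complex \<Rightarrow> complex" where
  "hitchin_y A B x =
     (let r = K_sqrt x / K'_sqrt x; \<tau> = \<i> * r; z = A * r + B in
        csqrt x / (theta1 z \<tau>)^2 *
          (of_real pi * (vartheta2 \<tau>)^2 * theta2 z \<tau> * theta3 z \<tau> * theta4 z \<tau> /
             (theta1' z \<tau> + 2 * of_real pi * A * theta1 z \<tau>)
           - (theta2 z \<tau>)^2))"

(* With z = A r + B and \<tau> = i r as above, z = -i A \<tau> + B.  If this is identically a half period,
   i.e. if 2 i A and 2 B are both integers, then theta1 or theta1' + 2 pi A theta1 vanishes
   identically and the formula is nowhere defined. *)
definition admissible_constants :: "complex \<Rightarrow> complex \<Rightarrow> bool" where
  "admissible_constants A B \<longleftrightarrow> \<not> (2 * \<i> * A \<in> \<int> \<and> 2 * B \<in> \<int>)"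

(* The classical one-parameter (Riccati) solutions of the case 1/8, 1/8, 1/8, 1/8.  Each of the
   four equations arises as the limit of hitchin_y when (-i A, B) tends to one of the four
   half-integer points modulo integers: (0,0), (0,1/2), (1/2,0), (1/2,1/2), in this order. *)
definition singular_solution :: "complex set \<Rightarrow> (complex \<Rightarrow> complex) \<Rightarrow> bool" where
  "singular_solution D y \<longleftrightarrow>
     (\<forall>\<^sub>\<approx>x\<in>D. 2 * x * (x - 1) * deriv y x = - ((y x)^2 - 2 * x * y x + x)) \<or>
     (\<forall>\<^sub>\<approx>x\<in>D. 2 * x * (x - 1) * deriv y x = (y x)^2 - 2 * y x + x) \<or>
     (\<forall>\<^sub>\<approx>x\<in>D. 2 * x * (x - 1) * deriv y x = (y x)^2 - x) \<or>
     (\<forall>\<^sub>\<approx>x\<in>D. 2 * x * (x - 1) * deriv y x = (y x)^2 - 2 * (1 - x) * y x - x)"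

end

theory Submission
  imports Defs
begin

text \<open>Let \<open>U(z | \<tau>)\<close> be the even elliptic function of order two with periods 1 and \<open>\<tau>\<close> whose values at the half periods are
  \<open>\<infinity>\<close>, 0, 1 and \<open>x = (\<theta>\<^sub>4(0) / \<theta>\<^sub>3(0))\<^sup>4\<close>, and let \<open>V\<close> be its derivative in \<open>z\<close>. Along a line \<open>z = a \<tau> + b\<close> the function
  \<open>u = U(a \<tau> + b | \<tau>)\<close> is Picard's solution of the sixth Painleve equation with vanishing parameters. Hitchin's formula is
  an Okamoto transform of it: \<open>y = u + V / (2 \<zeta>)\<close> with \<open>\<zeta> = \<theta>\<^sub>1' / \<theta>\<^sub>1 + 2 \<pi> \<i> a\<close> and \<open>a = - \<i> A\<close>, \<open>b = B\<close>
  (\<open>hitchin_y_eq\<close>). The transformation turns the second order equation into a rational first order system for the pair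
  \<open>(u, y)\<close> (\<open>u_y_system\<close>); eliminating \<open>u\<close> from it gives the equation for \<open>y\<close> (\<open>painleve_VI_from_system\<close>).

  The system rests on the heat equation, which expresses derivatives of theta functions along a line in \<open>(z, \<tau>)\<close>-space
  by derivatives in \<open>z\<close> (\<open>theta_deriv_along_line\<close>). The logarithmic derivatives that arise are reduced to \<open>U\<close>, \<open>V\<close>, \<open>\<zeta>\<close> and
  theta constants by identities, all of which come from a single rearrangement of a double series, the
  duplication formula \<open>theta_char_mult\<close>: the reflected products \<open>\<theta>\<^sub>j(z + h) \<theta>\<^sub>j(z - h)\<close> at order 0 and 2 in \<open>h\<close> yield
  the quadratic relations and the second logarithmic derivatives, and invariance under \<open>\<tau> \<mapsto> 2 \<tau>\<close> yields
  \<open>jacobi_derivative_formula\<close>.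

  To pass from \<open>\<tau>\<close> to \<open>x\<close> one needs that \<open>\<tau> = \<i> K / K'\<close> lies in the upper half-plane (\<open>ell_K_Re_pos\<close>) and inverts
  \<open>x = (\<theta>\<^sub>4(0) / \<theta>\<^sub>3(0))\<^sup>4\<close> (\<open>theta_lambda_tau_of\<close>). For \<open>\<tau>\<close> on the imaginary axis the latter follows by substituting
  elliptic functions into the elliptic integral (\<open>theta_inversion_imaginary_axis\<close>), and in general by the identity theorem.
  For admissible constants the exceptional points, at which \<open>z\<close> is a half period or \<open>\<zeta> = 0\<close>, have no accumulation point in
  the cut plane (\<open>good_cosparse\<close>): the zeros of \<open>\<theta>\<^sub>1\<close> are exactly the lattice points (\<open>theta1_zero_imp_lattice\<close>), so \<open>z\<close> is not
  identically a half period.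

  For the converse, the first order equation for \<open>y\<close> determines \<open>u\<close> rationally from the values of \<open>x\<close>, \<open>y\<close> and \<open>y'\<close>. The four
  Riccati equations of the singular solutions say that this \<open>u\<close> is \<open>\<infinity>\<close>, 0, 1 or \<open>x\<close>, the values of \<open>U\<close> at the half periods.
  Any other value is \<open>U(z)\<close> for some \<open>z\<close> that is not a half period (\<open>theta_quotient_surjective\<close>), and then \<open>\<zeta>\<close>, and with it
  \<open>A\<close> and \<open>B\<close>, can be solved for (\<open>initial_values_attained\<close>). Uniqueness for the initial value problem (\<open>PVI_unique\<close>) and
  analytic continuation finish the argument.\<close>

section \<open>Theta series and their derivatives\<close>

text \<open>The power in front of the exponential is what \<open>n\<close> differentiations with respect to \<open>z\<close> produce, so
  that one estimate covers the theta series together with all its derivatives.\<close>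

definition theta_term :: "nat \<Rightarrow> int \<Rightarrow> int \<Rightarrow> complex \<Rightarrow> complex \<Rightarrow> int \<Rightarrow> complex" where
  "theta_term n a b z \<tau> k =
     (2 * of_real pi * \<i> * (of_int k + of_int a / 2))^n *
     exp (of_real pi * \<i> * (of_int k + of_int a / 2)^2 * \<tau>
          + 2 * of_real pi * \<i> * (of_int k + of_int a / 2) * (z + of_int b / 2))"

definition theta_deriv :: "nat \<Rightarrow> int \<Rightarrow> int \<Rightarrow> complex \<Rightarrow> complex \<Rightarrow> complex" where
  "theta_deriv n a b z \<tau> = (\<Sum>\<^sub>\<infinity>k. theta_term n a b z \<tau> k)"

lemma theta_deriv_0: "theta_deriv 0 a b z \<tau> = theta_char a b z \<tau>"
  by (simp add: theta_deriv_def theta_term_def theta_char_def)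

lemma summable_on_exp_abs_int: "(\<lambda>k::int. exp (- \<bar>real_of_int k\<bar>)) summable_on UNIV"
proof -
  have g: "(\<lambda>n::nat. exp (- real n)) summable_on UNIV"
  proof (rule norm_summable_imp_summable_on)
    have "summable (\<lambda>n. (exp (-1::real)) ^ n)" by (rule summable_geometric) simp
    thus "summable (\<lambda>n. norm (exp (- real n)))"
      by (simp add: exp_of_nat_mult[symmetric])
  qed
  have 1: "(\<lambda>k::int. exp (- \<bar>real_of_int k\<bar>)) summable_on (range int)"
    by (subst summable_on_reindex) (use g in \<open>auto simp: o_def inj_on_def\<close>)
  have 2: "(\<lambda>k::int. exp (- \<bar>real_of_int k\<bar>)) summable_on (range (\<lambda>n. - int n))"
    by (subst summable_on_reindex) (use g in \<open>auto simp: o_def inj_on_def\<close>)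
  have 3: "(UNIV::int set) = range int \<union> (range (\<lambda>n. - int n) - range int)"
    by (auto simp: image_iff) (metis int_cases2)
  show ?thesis
    by (subst 3, rule summable_on_Un_disjoint[OF 1 summable_on_subset_banach[OF 2]]) auto
qed

lemma norm_theta_term:
  fixes a b k :: int and z \<tau> :: complex
  defines "m \<equiv> real_of_int k + real_of_int a / 2"
  shows "norm (theta_term n a b z \<tau> k) = (2 * pi * \<bar>m\<bar>)^n * exp (- (pi * m^2 * Im \<tau>) - 2 * pi * m * Im z)"
proof -
  have m: "of_int k + of_int a / 2 = complex_of_real m" by (simp add: m_def)
  have "norm (2 * of_real pi * \<i> * complex_of_real m) = 2 * pi * \<bar>m\<bar>"
    by (simp add: norm_mult)
  moreover have "Re (of_real pi * \<i> * (complex_of_real m)^2 * \<tau>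
          + 2 * of_real pi * \<i> * (complex_of_real m) * (z + of_int b / 2))
     = - (pi * m^2 * Im \<tau>) - 2 * pi * m * Im z"
    by (simp add: power2_eq_square)
  ultimately show ?thesis
    unfolding theta_term_def m by (simp add: norm_mult norm_power)
qed

text \<open>The Gaussian factor beats the exponential growth in \<open>z\<close> and the polynomial factor, uniformly
  for \<open>z\<close> in a horizontal strip and \<open>\<tau>\<close> in a half-plane away from the real axis.\<close>

lemma theta_term_bound:
  assumes "\<delta> > 0"
  shows "\<exists>C\<ge>0. \<forall>b z \<tau> k. \<bar>Im z\<bar> \<le> R \<longrightarrow> \<delta> \<le> Im \<tau> \<longrightarrow>
            norm (theta_term n a b z \<tau> k) \<le> C * exp (- \<bar>real_of_int k\<bar>)"
proof -
  \<comment> \<open>In terms of \<open>m = k + a/2\<close>, the constant \<open>c\<close> collects the growth rates \<open>2 \<pi> R\<close> of the exponential in \<open>z\<close>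
     and \<open>2 \<pi>\<close> of the power of \<open>m\<close>, and the decay rate 1 that is aimed at; completing the square bounds
     \<open>c |m| - \<pi> \<delta> m\<^sup>2\<close> by \<open>c\<^sup>2 / (4 \<pi> \<delta>)\<close>.\<close>
  define c where "c = 2 * pi * (\<bar>R\<bar> + 1) + 1"
  define C where "C = fact n * exp (c^2 / (4 * pi * \<delta>) + \<bar>real_of_int a\<bar> / 2)"
  have "norm (theta_term n a b z \<tau> k) \<le> C * exp (- \<bar>real_of_int k\<bar>)"
    if Rz: "\<bar>Im z\<bar> \<le> R" and d: "\<delta> \<le> Im \<tau>" for b z \<tau> k
  proof -
    define m where "m = real_of_int k + real_of_int a / 2"
    have pw: "(2 * pi * \<bar>m\<bar>)^n \<le> fact n * exp (2 * pi * \<bar>m\<bar>)"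
    proof -
      have s: "(\<lambda>i. (2 * pi * \<bar>m\<bar>) ^ i / fact i) sums exp (2 * pi * \<bar>m\<bar>)"
        using exp_converges[of "2 * pi * \<bar>m\<bar>"] by (simp add: divide_inverse mult.commute)
      have "(\<Sum>i\<in>{n}. (2 * pi * \<bar>m\<bar>)^i / fact i) \<le> exp (2 * pi * \<bar>m\<bar>)"
        by (subst sums_unique[OF s], rule sum_le_suminf) (use s in \<open>auto simp: sums_iff\<close>)
      thus ?thesis by (simp add: field_simps)
    qed
    have 1: "- (2 * pi * m * Im z) \<le> 2 * pi * \<bar>R\<bar> * \<bar>m\<bar>"
    proof -
      have "- (m * Im z) \<le> \<bar>R\<bar> * \<bar>m\<bar>"
      proof -
        have "- (m * Im z) \<le> \<bar>Im z\<bar> * \<bar>m\<bar>"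
          by (metis abs_ge_minus_self abs_mult mult.commute)
        also have "\<dots> \<le> \<bar>R\<bar> * \<bar>m\<bar>" using Rz by (intro mult_right_mono) auto
        finally show ?thesis .
      qed
      hence "2 * pi * (- (m * Im z)) \<le> 2 * pi * (\<bar>R\<bar> * \<bar>m\<bar>)" by (intro mult_left_mono) auto
      thus ?thesis by (simp add: mult.assoc)
    qed
    have 2: "pi * m^2 * \<delta> \<le> pi * m^2 * Im \<tau>" using d by (intro mult_left_mono) auto
    have 3: "c * \<bar>m\<bar> - pi * m^2 * \<delta> \<le> c^2 / (4 * pi * \<delta>)"
    proof -
      have "0 \<le> (c - 2 * pi * \<delta> * \<bar>m\<bar>)^2" by simp
      also have "\<dots> = c^2 - 4 * pi * \<delta> * (c * \<bar>m\<bar> - pi * m^2 * \<delta>)"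
        by (simp add: power2_eq_square algebra_simps)
      finally show ?thesis using assms by (simp add: field_simps)
    qed
    have 4: "\<bar>real_of_int k\<bar> \<le> \<bar>m\<bar> + \<bar>real_of_int a\<bar> / 2" unfolding m_def by linarith
    have "norm (theta_term n a b z \<tau> k) = (2 * pi * \<bar>m\<bar>)^n * exp (- (pi * m^2 * Im \<tau>) - 2 * pi * m * Im z)"
      unfolding norm_theta_term m_def ..
    also have "\<dots> \<le> fact n * exp (2 * pi * \<bar>m\<bar>) * exp (- (pi * m^2 * Im \<tau>) - 2 * pi * m * Im z)"
      by (intro mult_right_mono pw) auto
    also have "\<dots> = fact n * exp (2 * pi * \<bar>m\<bar> - (pi * m^2 * Im \<tau>) - 2 * pi * m * Im z)"
      by (simp add: mult.assoc mult_exp_exp algebra_simps)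
    also have "\<dots> \<le> fact n * exp (c^2 / (4 * pi * \<delta>) + \<bar>real_of_int a\<bar> / 2 + - \<bar>real_of_int k\<bar>)"
    proof (intro mult_left_mono)
      have "c * \<bar>m\<bar> = 2 * pi * \<bar>R\<bar> * \<bar>m\<bar> + 2 * pi * \<bar>m\<bar> + \<bar>m\<bar>" by (simp add: c_def algebra_simps)
      thus "exp (2 * pi * \<bar>m\<bar> - (pi * m^2 * Im \<tau>) - 2 * pi * m * Im z)
          \<le> exp (c^2 / (4 * pi * \<delta>) + \<bar>real_of_int a\<bar> / 2 + - \<bar>real_of_int k\<bar>)"
        unfolding exp_le_cancel_iff using 1 2 3 4 by linarith
    qed auto
    also have "\<dots> = C * exp (- \<bar>real_of_int k\<bar>)" unfolding C_def exp_add by (simp only: mult.assoc)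
    finally show ?thesis .
  qed
  moreover have "C \<ge> 0" by (simp add: C_def)
  ultimately show ?thesis by blast
qed

lemma theta_term_abs_summable:
  assumes "Im \<tau> > 0"
  shows "(\<lambda>k. norm (theta_term n a b z \<tau> k)) summable_on UNIV"
proof -
  obtain C where C: "\<And>k. norm (theta_term n a b z \<tau> k) \<le> C * exp (- \<bar>real_of_int k\<bar>)"
    using theta_term_bound[OF assms, of "\<bar>Im z\<bar>" n a] by blast
  show ?thesis
    by (rule Infinite_Sum.abs_summable_on_comparison_test'[where g="\<lambda>k. C * exp (- \<bar>real_of_int k\<bar>)"])
       (use C summable_on_exp_abs_int in \<open>auto intro: summable_on_cmult_right\<close>)
qed

lemma theta_term_has_sum:
  assumes "Im \<tau> > 0"
  shows "(theta_term n a b z \<tau> has_sum theta_deriv n a b z \<tau>) UNIV"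
  unfolding theta_deriv_def
  by (rule has_sum_infsum, rule abs_summable_summable, rule theta_term_abs_summable[OF assms])

text \<open>Every term satisfies the heat equation \<open>4 \<pi> \<i> \<partial>\<^sub>\<tau> = \<partial>\<^sub>z\<^sup>2\<close>, so a derivative along any complex
  line in \<open>(z, \<tau>)\<close>-space can be written with \<open>z\<close>-derivatives only.\<close>

theorem theta_deriv_along_line:
  assumes "Im (\<tau>0 + \<gamma> * w) > 0"
  shows "((\<lambda>w. theta_deriv n a b (z0 + \<alpha> * w) (\<tau>0 + \<gamma> * w)) has_field_derivative
           (\<alpha> * theta_deriv (Suc n) a b (z0 + \<alpha> * w) (\<tau>0 + \<gamma> * w)
            + \<gamma> / (4 * of_real pi * \<i>) * theta_deriv (Suc (Suc n)) a b (z0 + \<alpha> * w) (\<tau>0 + \<gamma> * w))) (at w)"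
proof -
  define \<delta> where "\<delta> = Im (\<tau>0 + \<gamma> * w) / 2"
  define r where "r = \<delta> / (norm \<gamma> + 1)"
  have \<delta>: "\<delta> > 0" using assms by (simp add: \<delta>_def)
  have n0: "norm \<gamma> + 1 > 0" by (smt (verit) norm_ge_zero)
  have r: "r > 0" using \<delta> n0 by (simp add: r_def)
  have rg: "norm \<gamma> * r \<le> \<delta>" using \<delta> n0 by (simp add: r_def field_simps)
  define f where "f = (\<lambda>k v. theta_term n a b (z0 + \<alpha> * v) (\<tau>0 + \<gamma> * v) k)"
  define g where "g = (\<lambda>k v. \<alpha> * theta_term (Suc n) a b (z0 + \<alpha> * v) (\<tau>0 + \<gamma> * v) k
            + \<gamma> / (4 * of_real pi * \<i>) * theta_term (Suc (Suc n)) a b (z0 + \<alpha> * v) (\<tau>0 + \<gamma> * v) k)"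
  have Imb: "\<delta> \<le> Im (\<tau>0 + \<gamma> * v)" if "v \<in> cball w r" for v
  proof -
    have "\<bar>Im (\<gamma> * v - \<gamma> * w)\<bar> \<le> norm (\<gamma> * (v - w))"
      using abs_Im_le_cmod[of "\<gamma> * v - \<gamma> * w"] by (simp add: algebra_simps)
    also have "\<dots> \<le> norm \<gamma> * r"
      using that by (auto simp: norm_mult dist_norm norm_minus_commute intro!: mult_left_mono)
    also note rg
    finally have *: "\<bar>Im (\<gamma> * v) - Im (\<gamma> * w)\<bar> \<le> \<delta>" by (simp only: minus_complex.sel)
    have "d \<le> t + p" if "\<bar>p - q\<bar> \<le> d" "d = (t + q) / 2" for p q d t :: real
      using abs_le_D2[OF that(1)] that(2) by (simp add: field_simps)
    from this[OF *] show ?thesis by (simp only: \<delta>_def plus_complex.sel)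
  qed
  have Rb: "\<bar>Im (z0 + \<alpha> * v)\<bar> \<le> norm z0 + norm \<alpha> * (norm w + r)" if "v \<in> cball w r" for v
  proof -
    have "norm v \<le> norm w + r"
      using that norm_triangle_ineq[of w "v - w"] by (auto simp: dist_norm norm_minus_commute)
    hence "norm (z0 + \<alpha> * v) \<le> norm z0 + norm \<alpha> * (norm w + r)"
      by (metis norm_mult add_left_mono mult_left_mono norm_ge_zero norm_triangle_le)
    thus ?thesis using abs_Im_le_cmod order_trans by blast
  qed
  obtain C where C: "\<And>v k. v \<in> cball w r \<Longrightarrow> norm (f k v) \<le> C * exp (- \<bar>real_of_int k\<bar>)"
    using theta_term_bound[OF \<delta>, of "norm z0 + norm \<alpha> * (norm w + r)" n a] Imb Rb
    unfolding f_def by meson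
  have ul: "uniform_limit (cball w r) (\<lambda>X v. \<Sum>k\<in>X. f k v) (\<lambda>v. \<Sum>\<^sub>\<infinity>k. f k v) (finite_subsets_at_top UNIV)"
    by (rule Weierstrass_m_test_general[where M="\<lambda>k. C * exp (- \<bar>real_of_int k\<bar>)"])
       (use C summable_on_exp_abs_int in \<open>auto intro: summable_on_cmult_right\<close>)
  have der: "(f k has_field_derivative g k v) (at v)" for k v
    unfolding f_def g_def theta_term_def
    by (rule derivative_eq_intros refl | simp)+ (simp add: field_simps power2_eq_square)
  have ev: "\<forall>\<^sub>F X in finite_subsets_at_top UNIV. continuous_on (cball w r) (\<lambda>v. \<Sum>k\<in>X. f k v) \<and>
              (\<forall>v\<in>ball w r. ((\<lambda>v. \<Sum>k\<in>X. f k v) has_field_derivative (\<Sum>k\<in>X. g k v)) (at v))"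
  proof (intro always_eventually allI conjI ballI)
    fix X :: "int set"
    show "continuous_on (cball w r) (\<lambda>v. \<Sum>k\<in>X. f k v)"
      by (intro continuous_on_sum continuous_at_imp_continuous_on ballI DERIV_isCont[OF der])
    show "((\<lambda>v. \<Sum>k\<in>X. f k v) has_field_derivative (\<Sum>k\<in>X. g k v)) (at v)" for v
      by (intro DERIV_sum der)
  qed
  obtain g' where g': "\<And>v. v \<in> ball w r \<Longrightarrow> ((\<lambda>v. \<Sum>\<^sub>\<infinity>k. f k v) has_field_derivative g' v) (at v) \<and>
       ((\<lambda>X. \<Sum>k\<in>X. g k v) \<longlongrightarrow> g' v) (finite_subsets_at_top UNIV)"
    using has_complex_derivative_uniform_limit[OF ev ul _ r] by auto
  have w: "w \<in> ball w r" using r by simp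
  have "((\<lambda>k. g k w) has_sum g' w) UNIV" using g'[OF w] by (simp add: has_sum_def)
  moreover have "((\<lambda>k. g k w) has_sum (\<alpha> * theta_deriv (Suc n) a b (z0 + \<alpha> * w) (\<tau>0 + \<gamma> * w)
            + \<gamma> / (4 * of_real pi * \<i>) * theta_deriv (Suc (Suc n)) a b (z0 + \<alpha> * w) (\<tau>0 + \<gamma> * w))) UNIV"
    unfolding g_def by (intro has_sum_add has_sum_cmult_right theta_term_has_sum assms)
  ultimately have "g' w = (\<alpha> * theta_deriv (Suc n) a b (z0 + \<alpha> * w) (\<tau>0 + \<gamma> * w)
            + \<gamma> / (4 * of_real pi * \<i>) * theta_deriv (Suc (Suc n)) a b (z0 + \<alpha> * w) (\<tau>0 + \<gamma> * w))"
    using has_sum_unique by blast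
  with g'[OF w] show ?thesis by (simp add: f_def theta_deriv_def)
qed

corollary theta_deriv_has_field_derivative:
  assumes "Im \<tau> > 0"
  shows "((\<lambda>z. theta_deriv n a b z \<tau>) has_field_derivative theta_deriv (Suc n) a b z \<tau>) (at z)"
  using theta_deriv_along_line[of \<tau> 0 z n a b 0 1] assms by simp

lemma theta_deriv_chain [derivative_intros]:
  assumes "Im \<tau> > 0" "(g has_field_derivative g') (at x within s)"
  shows "((\<lambda>x. theta_deriv n a b (g x) \<tau>) has_field_derivative
           theta_deriv (Suc n) a b (g x) \<tau> * g') (at x within s)"
  by (rule DERIV_chain2[OF theta_deriv_has_field_derivative[OF assms(1)] assms(2)])

section \<open>Shifts by half periods, parity and conjugation\<close>

lemma theta_char_shift_half: "theta_char a b (z + 1/2) \<tau> = theta_char a (b + 1) z \<tau>"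
  by (simp add: theta_char_def add_divide_distrib algebra_simps)

lemma theta_char_add2: "theta_char (a + 2) b z \<tau> = theta_char a b z \<tau>"
  unfolding theta_char_def
  by (rule infsum_reindex_bij_witness[of _ "\<lambda>k. k - 1" "\<lambda>k. k + 1"])
     (auto simp: add_divide_distrib algebra_simps)

lemma theta_char_add2_right: "theta_char a (b + 2) z \<tau> = (if even a then 1 else -1) * theta_char a b z \<tau>"
proof -
  have e: "exp (2 * of_real pi * \<i> * (of_int k + of_int a / 2)) = (if even a then 1 else -1)" for k
  proof -
    have "exp (2 * of_real pi * \<i> * (of_int k + of_int a / 2)) =
          exp (2 * of_int k * of_real pi * \<i>) * exp (of_int a * (of_real pi * \<i>))"
      by (simp add: exp_add[symmetric] algebra_simps)
    also have "exp (2 * of_int k * of_real pi * \<i>) = 1"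
      using exp_integer_2pi[of "of_int k"] by (simp add: algebra_simps)
    also have "exp (of_int a * (of_real pi * \<i>)) = (if even a then 1 else -1)"
    proof (cases "even a")
      case True
      then obtain c where "a = 2 * c" by (elim evenE)
      thus ?thesis using exp_integer_2pi[of "of_int c"] by (simp add: algebra_simps)
    next
      case False
      then obtain c where "a = 2 * c + 1" by (elim oddE)
      thus ?thesis using exp_integer_2pi[of "of_int c"] by (simp add: algebra_simps exp_add)
    qed
    finally show ?thesis by simp
  qed
  have "theta_char a (b + 2) z \<tau> = (\<Sum>\<^sub>\<infinity>k. (if even a then 1 else -1) * 
        exp (of_real pi * \<i> * (of_int k + of_int a / 2)^2 * \<tau>
             + 2 * of_real pi * \<i> * (of_int k + of_int a / 2) * (z + of_int b / 2)))"
    unfolding theta_char_def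
  proof (intro infsum_cong)
    fix k :: int
    show "exp (of_real pi * \<i> * (of_int k + of_int a / 2)^2 * \<tau> + 2 * of_real pi * \<i> * (of_int k + of_int a / 2) * (z + of_int (b + 2) / 2))
       = (if even a then 1 else -1) * exp (of_real pi * \<i> * (of_int k + of_int a / 2)^2 * \<tau> + 2 * of_real pi * \<i> * (of_int k + of_int a / 2) * (z + of_int b / 2))"
      unfolding e[of k, symmetric] exp_add[symmetric]
      by (intro arg_cong[of _ _ exp]) (simp add: add_divide_distrib ring_distribs)
  qed
  also have "\<dots> = (if even a then 1 else -1) * theta_char a b z \<tau>"
    unfolding theta_char_def by (rule infsum_cmult_right')
  finally show ?thesis .
qed

lemma theta_char_shift_1: "theta_char a b (z + 1) \<tau> = (if even a then 1 else -1) * theta_char a b z \<tau>"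
  using theta_char_shift_half[of a b "z + 1/2" \<tau>] theta_char_shift_half[of a "b + 1" z \<tau>]
  by (simp add: theta_char_add2_right[symmetric] add.assoc)

lemma theta_char_shift_half_tau:
  "theta_char a b (z + \<tau> / 2) \<tau> =
     exp (- (of_real pi * \<i> * \<tau> / 4) - of_real pi * \<i> * (z + of_int b / 2)) * theta_char (a + 1) b z \<tau>"
  unfolding theta_char_def
proof (subst infsum_cmult_right'[symmetric], rule infsum_cong)
  fix k :: int
  have *: "of_int k + of_int (a + 1) / 2 = (of_int k + of_int a / 2) + (1/2 :: complex)"
    by (simp add: add_divide_distrib)
  show "exp (of_real pi * \<i> * (of_int k + of_int a / 2)^2 * \<tau> + 2 * of_real pi * \<i> * (of_int k + of_int a / 2) * (z + \<tau> / 2 + of_int b / 2))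
     = exp (- (of_real pi * \<i> * \<tau> / 4) - of_real pi * \<i> * (z + of_int b / 2)) *
       exp (of_real pi * \<i> * (of_int k + of_int (a + 1) / 2)^2 * \<tau> + 2 * of_real pi * \<i> * (of_int k + of_int (a + 1) / 2) * (z + of_int b / 2))"
    unfolding * exp_add[symmetric]
    by (intro arg_cong[of _ _ exp]) (simp add: field_simps power2_eq_square)
qed

lemma theta_char_shift_tau:
  "theta_char a b (z + \<tau>) \<tau> = exp (- (of_real pi * \<i> * \<tau>) - 2 * of_real pi * \<i> * (z + of_int b / 2)) * theta_char a b z \<tau>"
proof -
  have "z + \<tau> = (z + \<tau>/2) + \<tau> / 2" by simp
  hence "theta_char a b (z + \<tau>) \<tau> = theta_char a b ((z + \<tau>/2) + \<tau> / 2) \<tau>" by (rule arg_cong)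
  also have "\<dots> = exp (- (of_real pi * \<i> * \<tau> / 4) - of_real pi * \<i> * (z + \<tau>/2 + of_int b / 2)) *
       (exp (- (of_real pi * \<i> * \<tau> / 4) - of_real pi * \<i> * (z + of_int b / 2)) * theta_char (a + 1 + 1) b z \<tau>)"
    by (simp only: theta_char_shift_half_tau)
  also have "theta_char (a + 1 + 1) b z \<tau> = theta_char a b z \<tau>"
    using theta_char_add2[of a b z \<tau>] by (simp add: add.assoc)
  also have "exp (- (of_real pi * \<i> * \<tau> / 4) - of_real pi * \<i> * (z + \<tau>/2 + of_int b / 2)) *
      (exp (- (of_real pi * \<i> * \<tau> / 4) - of_real pi * \<i> * (z + of_int b / 2)) * theta_char a b z \<tau>)
     = exp (- (of_real pi * \<i> * \<tau>) - 2 * of_real pi * \<i> * (z + of_int b / 2)) * theta_char a b z \<tau>"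
    unfolding mult.assoc[symmetric] exp_add[symmetric]
    by (intro arg_cong[of _ _ "\<lambda>x. exp x * theta_char a b z \<tau>"]) (simp add: field_simps)
  finally show ?thesis .
qed

lemma theta_char_minus: "theta_char a b (-z) \<tau> = theta_char a (-b) z \<tau>"
  unfolding theta_char_def
  by (rule infsum_reindex_bij_witness[of _ "\<lambda>k. -k-a" "\<lambda>k. -k-a"])
     (auto simp: field_simps power2_eq_square)

lemma cnj_theta_char:
  assumes "cnj \<tau> = - \<tau>"
  shows "cnj (theta_char a b z \<tau>) = theta_char a b (cnj z) \<tau>"
proof -
  have "cnj (theta_char a b z \<tau>) = (\<Sum>\<^sub>\<infinity>k. cnj (exp (of_real pi * \<i> * (of_int k + of_int a / 2)^2 * \<tau>
             + 2 * of_real pi * \<i> * (of_int k + of_int a / 2) * (z + of_int b / 2))))"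
    unfolding theta_char_def by (rule infsum_cnj[symmetric])
  also have "\<dots> = (\<Sum>\<^sub>\<infinity>k. exp (of_real pi * \<i> * (of_int k + of_int a / 2)^2 * \<tau>
             - 2 * of_real pi * \<i> * (of_int k + of_int a / 2) * (cnj z + of_int b / 2)))"
    by (intro infsum_cong) (simp add: exp_cnj assms algebra_simps)
  also have "\<dots> = theta_char a (-b) (- cnj z) \<tau>"
    unfolding theta_char_def by (intro infsum_cong arg_cong[of _ _ exp]) (simp add: field_simps)
  also have "\<dots> = theta_char a b (cnj z) \<tau>" by (simp add: theta_char_minus)
  finally show ?thesis .
qed

section \<open>The duplication formula\<close>

lemma abs_summable_on_times:
  fixes f :: "'a \<Rightarrow> 'c :: {real_normed_algebra, banach}" and g :: "'b \<Rightarrow> 'c"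
  assumes f: "(\<lambda>x. norm (f x)) summable_on A" and g: "(\<lambda>x. norm (g x)) summable_on B"
  shows "(\<lambda>(x, y). f x * g y) summable_on A \<times> B"
    and "infsum (\<lambda>(x, y). f x * g y) (A \<times> B) = infsum f A * infsum g B"
proof -
  have "(\<lambda>z. norm (norm (f (fst z)) * norm (g (snd z)))) summable_on A \<times> B"
    by (subst Infinite_Sum.abs_summable_on_Sigma_iff)
       (use f g in \<open>auto simp: infsum_cmult_right' abs_mult abs_of_nonneg[OF infsum_nonneg]
          intro!: summable_on_cmult_right summable_on_cmult_left\<close>)
  hence "(\<lambda>z. norm (case z of (x, y) \<Rightarrow> f x * g y)) summable_on A \<times> B"
    by (rule Infinite_Sum.abs_summable_on_comparison_test) (auto simp: norm_mult_ineq)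
  thus s: "(\<lambda>(x, y). f x * g y) summable_on A \<times> B" by (rule abs_summable_summable)
  have "infsum (\<lambda>(x, y). f x * g y) (A \<times> B) = (\<Sum>\<^sub>\<infinity>x\<in>A. \<Sum>\<^sub>\<infinity>y\<in>B. f x * g y)"
    using infsum_Sigma'_banach[OF s] by simp
  also have "\<dots> = (\<Sum>\<^sub>\<infinity>x\<in>A. f x * infsum g B)"
    by (intro infsum_cong infsum_cmult_right) (rule abs_summable_summable[OF g])
  also have "\<dots> = infsum f A * infsum g B"
    by (rule infsum_cmult_left) (rule abs_summable_summable[OF f])
  finally show "infsum (\<lambda>(x, y). f x * g y) (A \<times> B) = infsum f A * infsum g B" .
qed

text \<open>In the double series for the product, the quadratic form satisfies
  \<open>m\<^sup>2 + n\<^sup>2 = 2 ((m + n) / 2)\<^sup>2 + 2 ((m - n) / 2)\<^sup>2\<close>. Passing to the summation indices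
  \<open>(m + n) / 2\<close> and \<open>(m - n) / 2\<close> separates the variables; the two terms correspond to the
  parity of \<open>m + n\<close>.\<close>

theorem theta_char_mult:
  assumes "Im \<tau> > 0"
  shows "theta_char a b z \<tau> * theta_char a d w \<tau> =
           theta_char a 0 (z + w + of_int (b + d) / 2) (2 * \<tau>) * theta_char 0 0 (z - w + of_int (b - d) / 2) (2 * \<tau>)
         + theta_char (a + 1) 0 (z + w + of_int (b + d) / 2) (2 * \<tau>) * theta_char 1 0 (z - w + of_int (b - d) / 2) (2 * \<tau>)"
proof -
  have s: "(\<lambda>k. norm (theta_term 0 a b z \<tau> k)) summable_on UNIV" for a b z
    by (rule theta_term_abs_summable[OF assms])
  have s2: "(\<lambda>k. norm (theta_term 0 a b z (2 * \<tau>) k)) summable_on UNIV" for a b z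
    by (rule theta_term_abs_summable) (use assms in simp)
  define u v where "u = z + w + of_int (b + d) / 2" and "v = z - w + of_int (b - d) / 2"
  define f where "f = (\<lambda>(k, l). theta_term 0 a b z \<tau> k * theta_term 0 a d w \<tau> l)"
  \<comment> \<open>The pairs \<open>(k, l)\<close> with \<open>k + l\<close> of a given parity \<open>\<epsilon>\<close> are parametrized by
     \<open>(j + i + \<epsilon>, j - i)\<close>.\<close>
  define E where "E = (\<lambda>\<epsilon>::int. {(k, l). (k + l) mod 2 = \<epsilon>})"
  have f: "(f has_sum theta_char a b z \<tau> * theta_char a d w \<tau>) UNIV"
    unfolding f_def
    using abs_summable_on_times[OF s s, of a b z a d w] 
    by (simp add: has_sum_iff theta_deriv_0[symmetric] theta_deriv_def)
  have E: "(f has_sum theta_char (a + \<epsilon>) 0 u (2 * \<tau>) * theta_char \<epsilon> 0 v (2 * \<tau>)) (E \<epsilon>)"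
    if \<epsilon>: "\<epsilon> = 0 \<or> \<epsilon> = 1" for \<epsilon>
  proof -
    have "((\<lambda>(j, i). theta_term 0 (a + \<epsilon>) 0 u (2 * \<tau>) j * theta_term 0 \<epsilon> 0 v (2 * \<tau>) i) has_sum
              theta_char (a + \<epsilon>) 0 u (2 * \<tau>) * theta_char \<epsilon> 0 v (2 * \<tau>)) UNIV"
      using abs_summable_on_times[OF s2 s2, of "a + \<epsilon>" 0 u \<epsilon> 0 v] 
      by (simp add: has_sum_iff theta_deriv_0[symmetric] theta_deriv_def)
    also have "?this \<longleftrightarrow> ?thesis"
    proof (rule has_sum_reindex_bij_witness[of _ "\<lambda>(k, l). ((k + l - \<epsilon>) div 2, (k - l - \<epsilon>) div 2)" "\<lambda>(j, i). (j + i + \<epsilon>, j - i)"])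
      fix p :: "int \<times> int"
      obtain j i where p: "p = (j, i)" by force
      show "f (case p of (j, i) \<Rightarrow> (j + i + \<epsilon>, j - i)) =
           (case p of (j, i) \<Rightarrow> theta_term 0 (a + \<epsilon>) 0 u (2 * \<tau>) j * theta_term 0 \<epsilon> 0 v (2 * \<tau>) i)"
        unfolding p f_def theta_term_def u_def v_def prod.case exp_add[symmetric] power_0 mult_1
        by (intro arg_cong[of _ _ exp]) (simp add: add_divide_distrib diff_divide_distrib power2_eq_square ring_distribs)
    next
      fix p :: "int \<times> int" assume "p \<in> E \<epsilon>"
      then obtain k l where p: "p = (k, l)" "(k + l) mod 2 = \<epsilon>" by (auto simp: E_def)
      define x where "x = (k + l) div 2"
      have "k + l - \<epsilon> = 2 * x" using p(2) unfolding x_def by (metis minus_mod_eq_mult_div)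
      hence "k + l - \<epsilon> = x * 2" "k - l - \<epsilon> = (x - l) * 2" "k = 2 * x + \<epsilon> - l" by simp_all
      thus "(\<lambda>(j, i). (j + i + \<epsilon>, j - i)) ((\<lambda>(k, l). ((k + l - \<epsilon>) div 2, (k - l - \<epsilon>) div 2)) p) = p"
        unfolding p prod.case by (simp only: nonzero_mult_div_cancel_right) simp
    qed (use \<epsilon> in \<open>auto simp: E_def\<close>)
    finally show ?thesis .
  qed
  have "(f has_sum (theta_char (a + 0) 0 u (2 * \<tau>) * theta_char 0 0 v (2 * \<tau>) +
                    theta_char (a + 1) 0 u (2 * \<tau>) * theta_char 1 0 v (2 * \<tau>))) (E 0 \<union> E 1)"
    by (intro has_sum_Un_disjoint E) (auto simp: E_def)
  also have "E 0 \<union> E 1 = UNIV" by (auto simp: E_def)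
  finally show ?thesis
    using has_sum_unique[OF f] unfolding u_def v_def by simp
qed

section \<open>Identities between the four theta functions\<close>

definition theta1_deriv :: "nat \<Rightarrow> complex \<Rightarrow> complex \<Rightarrow> complex" where
  "theta1_deriv n z \<tau> = - theta_deriv n 1 1 z \<tau>"

definition theta2_deriv :: "nat \<Rightarrow> complex \<Rightarrow> complex \<Rightarrow> complex" where
  "theta2_deriv n = theta_deriv n 1 0"

definition theta3_deriv :: "nat \<Rightarrow> complex \<Rightarrow> complex \<Rightarrow> complex" where
  "theta3_deriv n = theta_deriv n 0 0"

definition theta4_deriv :: "nat \<Rightarrow> complex \<Rightarrow> complex \<Rightarrow> complex" where
  "theta4_deriv n = theta_deriv n 0 1"

lemma theta_derivs_0 [simp]:
  "theta1_deriv 0 = theta1" "theta2_deriv 0 = theta2"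
  "theta3_deriv 0 = theta3" "theta4_deriv 0 = theta4"
  by (simp_all add: theta1_deriv_def theta2_deriv_def theta3_deriv_def theta4_deriv_def
        theta_deriv_0 theta1_def theta2_def theta3_def theta4_def fun_eq_iff)

lemma theta_derivs_DERIV [derivative_intros]:
  assumes "Im \<tau> > 0" "(g has_field_derivative g') (at x within s)"
  shows "((\<lambda>x. theta1_deriv n (g x) \<tau>) has_field_derivative theta1_deriv (Suc n) (g x) \<tau> * g') (at x within s)"
    and "((\<lambda>x. theta2_deriv n (g x) \<tau>) has_field_derivative theta2_deriv (Suc n) (g x) \<tau> * g') (at x within s)"
    and "((\<lambda>x. theta3_deriv n (g x) \<tau>) has_field_derivative theta3_deriv (Suc n) (g x) \<tau> * g') (at x within s)"
    and "((\<lambda>x. theta4_deriv n (g x) \<tau>) has_field_derivative theta4_deriv (Suc n) (g x) \<tau> * g') (at x within s)"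
  unfolding theta1_deriv_def theta2_deriv_def theta3_deriv_def theta4_deriv_def
  by (rule derivative_eq_intros assms refl | simp)+

lemmas theta_DERIV [derivative_intros] = theta_derivs_DERIV[where n=0, unfolded theta_derivs_0]

lemma theta1'_eq:
  assumes "Im \<tau> > 0" shows "theta1' z \<tau> = theta1_deriv 1 z \<tau>"
  unfolding theta1'_def
  by (rule DERIV_imp_deriv) (use theta_DERIV(1)[OF assms DERIV_ident, of z UNIV] in simp)

lemma theta_derivs_along_line:
  assumes "Im \<tau> > 0"
  shows "((\<lambda>t. theta1_deriv n (c * t + d) t) has_field_derivative
            c * theta1_deriv (Suc n) (c * \<tau> + d) \<tau> + theta1_deriv (Suc (Suc n)) (c * \<tau> + d) \<tau> / (4 * of_real pi * \<i>)) (at \<tau>)"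
    and "((\<lambda>t. theta2_deriv n (c * t + d) t) has_field_derivative
            c * theta2_deriv (Suc n) (c * \<tau> + d) \<tau> + theta2_deriv (Suc (Suc n)) (c * \<tau> + d) \<tau> / (4 * of_real pi * \<i>)) (at \<tau>)"
    and "((\<lambda>t. theta3_deriv n (c * t + d) t) has_field_derivative
            c * theta3_deriv (Suc n) (c * \<tau> + d) \<tau> + theta3_deriv (Suc (Suc n)) (c * \<tau> + d) \<tau> / (4 * of_real pi * \<i>)) (at \<tau>)"
    and "((\<lambda>t. theta4_deriv n (c * t + d) t) has_field_derivative
            c * theta4_deriv (Suc n) (c * \<tau> + d) \<tau> + theta4_deriv (Suc (Suc n)) (c * \<tau> + d) \<tau> / (4 * of_real pi * \<i>)) (at \<tau>)"
proof -
  have *: "((\<lambda>t. theta_deriv n a b (c * t + d) t) has_field_derivative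
            c * theta_deriv (Suc n) a b (c * \<tau> + d) \<tau> + theta_deriv (Suc (Suc n)) a b (c * \<tau> + d) \<tau> / (4 * of_real pi * \<i>)) (at \<tau>)" for a b
    using theta_deriv_along_line[of 0 1 \<tau> n a b d c] assms by (simp add: add.commute)
  note ** = DERIV_minus[OF *[of 1 1]]
  show "((\<lambda>t. theta1_deriv n (c * t + d) t) has_field_derivative
            c * theta1_deriv (Suc n) (c * \<tau> + d) \<tau> + theta1_deriv (Suc (Suc n)) (c * \<tau> + d) \<tau> / (4 * of_real pi * \<i>)) (at \<tau>)"
    using ** unfolding theta1_deriv_def by (simp add: algebra_simps)
  show "((\<lambda>t. theta2_deriv n (c * t + d) t) has_field_derivative
            c * theta2_deriv (Suc n) (c * \<tau> + d) \<tau> + theta2_deriv (Suc (Suc n)) (c * \<tau> + d) \<tau> / (4 * of_real pi * \<i>)) (at \<tau>)"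
    "((\<lambda>t. theta3_deriv n (c * t + d) t) has_field_derivative
            c * theta3_deriv (Suc n) (c * \<tau> + d) \<tau> + theta3_deriv (Suc (Suc n)) (c * \<tau> + d) \<tau> / (4 * of_real pi * \<i>)) (at \<tau>)"
    "((\<lambda>t. theta4_deriv n (c * t + d) t) has_field_derivative
            c * theta4_deriv (Suc n) (c * \<tau> + d) \<tau> + theta4_deriv (Suc (Suc n)) (c * \<tau> + d) \<tau> / (4 * of_real pi * \<i>)) (at \<tau>)"
    unfolding theta2_deriv_def theta3_deriv_def theta4_deriv_def by (rule *)+
qed

lemma theta1_minus: "theta1 (-z) \<tau> = - theta1 z \<tau>"
  using theta_char_add2_right[of 1 "-1" z \<tau>] by (simp add: theta1_def theta_char_minus)

lemma theta2_minus: "theta2 (-z) \<tau> = theta2 z \<tau>"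
  by (simp add: theta2_def theta_char_minus)

lemma theta3_minus: "theta3 (-z) \<tau> = theta3 z \<tau>"
  by (simp add: theta3_def theta_char_minus)

lemma theta4_minus: "theta4 (-z) \<tau> = theta4 z \<tau>"
  using theta_char_add2_right[of 0 "-1" z \<tau>] by (simp add: theta4_def theta_char_minus)

lemma theta1_at_0 [simp]: "theta1 0 \<tau> = 0"
  using theta1_minus[of 0 \<tau>] by simp

lemma theta4_deriv_at_0:
  assumes "Im \<tau> > 0" shows "theta4_deriv (Suc 0) 0 \<tau> = 0"
proof -
  have "((\<lambda>z. theta4 (-z) \<tau>) has_field_derivative - theta4_deriv (Suc 0) (-0) \<tau>) (at 0)"
    by (rule derivative_eq_intros refl assms | simp)+
  moreover have "((\<lambda>z. theta4 z \<tau>) has_field_derivative theta4_deriv (Suc 0) 0 \<tau>) (at 0)"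
    by (rule derivative_eq_intros refl assms | simp)+
  ultimately show ?thesis
    unfolding theta4_minus using DERIV_unique by fastforce
qed

lemma theta1_shift_half: "theta1 (z + 1/2) \<tau> = theta2 z \<tau>"
  using theta_char_shift_half[of 1 1 z \<tau>] theta_char_add2_right[of 1 0 z \<tau>]
  by (simp add: theta1_def theta2_def)

lemma theta1_shift_half_tau:
  "\<exists>c. c \<noteq> 0 \<and> theta1 (z + \<tau>/2) \<tau> = c * theta4 z \<tau>"
proof -
  have "theta_char 2 1 z \<tau> = theta_char 0 1 z \<tau>" using theta_char_add2[of 0 1 z \<tau>] by simp
  thus ?thesis
    using theta_char_shift_half_tau[of 1 1 z \<tau>] unfolding theta1_def theta4_def
    by (intro exI[of _ "- exp (- (of_real pi * \<i> * \<tau> / 4) - of_real pi * \<i> * (z + of_int 1 / 2))"]) simp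
qed

lemma theta2_shift_half_tau:
  "\<exists>c. c \<noteq> 0 \<and> theta2 (z + \<tau>/2) \<tau> = c * theta3 z \<tau>"
proof -
  have "theta_char 2 0 z \<tau> = theta_char 0 0 z \<tau>" using theta_char_add2[of 0 0 z \<tau>] by simp
  thus ?thesis
    using theta_char_shift_half_tau[of 1 0 z \<tau>] unfolding theta2_def theta3_def
    by (intro exI[of _ "exp (- (of_real pi * \<i> * \<tau> / 4) - of_real pi * \<i> * (z + of_int 0 / 2))"]) simp
qed

lemma theta1_shift_1: "theta1 (z + 1) \<tau> = - theta1 z \<tau>"
  and theta2_shift_1: "theta2 (z + 1) \<tau> = - theta2 z \<tau>"
  by (simp_all add: theta1_def theta2_def theta_char_shift_1)

lemma theta1_shift_tau: "theta1 (z + \<tau>) \<tau> = - exp (- (of_real pi * \<i> * \<tau>) - 2 * of_real pi * \<i> * z) * theta1 z \<tau>"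
  and theta2_shift_tau: "theta2 (z + \<tau>) \<tau> = exp (- (of_real pi * \<i> * \<tau>) - 2 * of_real pi * \<i> * z) * theta2 z \<tau>"
proof -
  have "exp (- (of_real pi * \<i> * \<tau>) - 2 * of_real pi * \<i> * (z + of_int 1 / 2)) =
        exp (- (of_real pi * \<i> * \<tau>) - 2 * of_real pi * \<i> * z) * exp (- (of_real pi * \<i>))"
    unfolding exp_add[symmetric] by (intro arg_cong[of _ _ exp]) (simp add: field_simps)
  thus "theta1 (z + \<tau>) \<tau> = - exp (- (of_real pi * \<i> * \<tau>) - 2 * of_real pi * \<i> * z) * theta1 z \<tau>"
    using theta_char_shift_tau[of 1 1 z \<tau>] by (simp add: theta1_def exp_minus)
  show "theta2 (z + \<tau>) \<tau> = exp (- (of_real pi * \<i> * \<tau>) - 2 * of_real pi * \<i> * z) * theta2 z \<tau>"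
    using theta_char_shift_tau[of 1 0 z \<tau>] by (simp add: theta2_def)
qed

lemma theta_conj:
  assumes "cnj \<tau> = - \<tau>"
  shows "cnj (theta1 z \<tau>) = theta1 (cnj z) \<tau>" "cnj (theta2 z \<tau>) = theta2 (cnj z) \<tau>"
    "cnj (theta3 z \<tau>) = theta3 (cnj z) \<tau>" "cnj (theta4 z \<tau>) = theta4 (cnj z) \<tau>"
  by (simp_all add: theta1_def theta2_def theta3_def theta4_def cnj_theta_char[OF assms])

text \<open>The two sides of the product formula are compared at second order in \<open>h\<close> at \<open>h = 0\<close>. For \<open>f = \<theta>\<^sub>j\<close> the left-hand
  side becomes the numerator of the second logarithmic derivative.\<close>

lemma second_derivative_of_reflected_product:
  fixes f P Q :: "nat \<Rightarrow> complex \<Rightarrow> complex"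
  assumes f: "\<And>n z. (f n has_field_derivative f (Suc n) z) (at z)"
    and P: "\<And>n z. (P n has_field_derivative P (Suc n) z) (at z)"
    and Q: "\<And>n z. (Q n has_field_derivative Q (Suc n) z) (at z)"
    and eq: "\<And>h. f 0 (z + h) * f 0 (z - h) = c * P 0 (2 * h) + d * Q 0 (2 * h)"
  shows "f 2 z * f 0 z - (f 1 z)^2 = 2 * (c * P 2 0 + d * Q 2 0)"
proof -
  note [derivative_intros] = DERIV_chain2[OF f] DERIV_chain2[OF P] DERIV_chain2[OF Q]
  have eq1: "f 1 (z + h) * f 0 (z - h) - f 0 (z + h) * f 1 (z - h) = 2 * c * P 1 (2 * h) + 2 * d * Q 1 (2 * h)" for h
  proof -
    have "((\<lambda>h. f 0 (z + h) * f 0 (z - h)) has_field_derivative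
             f 1 (z + h) * f 0 (z - h) - f 0 (z + h) * f 1 (z - h)) (at h)"
      by (rule derivative_eq_intros refl | simp)+
    moreover have "((\<lambda>h. c * P 0 (2 * h) + d * Q 0 (2 * h)) has_field_derivative
             2 * c * P 1 (2 * h) + 2 * d * Q 1 (2 * h)) (at h)"
      by (rule derivative_eq_intros refl | simp)+
    ultimately show ?thesis unfolding eq by (rule DERIV_unique)
  qed
  have "((\<lambda>h. f 1 (z + h) * f 0 (z - h) - f 0 (z + h) * f 1 (z - h)) has_field_derivative
             2 * (f 2 z * f 0 z - (f 1 z)^2)) (at 0)"
    by (rule derivative_eq_intros refl | simp add: numeral_2_eq_2)+
  moreover have "((\<lambda>h. 2 * c * P 1 (2 * h) + 2 * d * Q 1 (2 * h)) has_field_derivative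
             4 * (c * P 2 0 + d * Q 2 0)) (at 0)"
    by (rule derivative_eq_intros refl | simp add: numeral_2_eq_2)+
  ultimately have "2 * (f 2 z * f 0 z - (f 1 z)^2) = 4 * (c * P 2 0 + d * Q 2 0)"
    unfolding eq1 by (rule DERIV_unique)
  thus ?thesis by algebra
qed

context
  fixes \<tau> :: complex
  assumes \<tau>: "Im \<tau> > 0"
begin

text \<open>All four products lie in the span of \<open>\<theta>\<^sub>2(2 z | 2 \<tau>)\<close> and \<open>\<theta>\<^sub>3(2 z | 2 \<tau>)\<close>. This is why squares of theta
  functions, and their second logarithmic derivatives, are tied by linear relations.\<close>

lemma theta_reflected_products:
  "theta1 (z + h) \<tau> * theta1 (z - h) \<tau> = theta3 (2*z) (2*\<tau>) * theta2 (2*h) (2*\<tau>) - theta2 (2*z) (2*\<tau>) * theta3 (2*h) (2*\<tau>)"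
  "theta2 (z + h) \<tau> * theta2 (z - h) \<tau> = theta2 (2*z) (2*\<tau>) * theta3 (2*h) (2*\<tau>) + theta3 (2*z) (2*\<tau>) * theta2 (2*h) (2*\<tau>)"
  "theta3 (z + h) \<tau> * theta3 (z - h) \<tau> = theta3 (2*z) (2*\<tau>) * theta3 (2*h) (2*\<tau>) + theta2 (2*z) (2*\<tau>) * theta2 (2*h) (2*\<tau>)"
  "theta4 (z + h) \<tau> * theta4 (z - h) \<tau> = theta3 (2*z) (2*\<tau>) * theta3 (2*h) (2*\<tau>) - theta2 (2*z) (2*\<tau>) * theta2 (2*h) (2*\<tau>)"
proof -
  have c: "theta_char 2 0 w \<sigma> = theta_char 0 0 w \<sigma>" for w \<sigma> using theta_char_add2[of 0 0 w \<sigma>] by simp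
  have e: "z + h + (z - h) = 2 * z" "z + h - (z - h) = 2 * h" by simp_all
  note m = theta_char_mult[OF \<tau>, of _ _ "z + h" _ "z - h", unfolded e]
  show "theta1 (z + h) \<tau> * theta1 (z - h) \<tau> = theta3 (2*z) (2*\<tau>) * theta2 (2*h) (2*\<tau>) - theta2 (2*z) (2*\<tau>) * theta3 (2*h) (2*\<tau>)"
    using m[of 1 1 1] by (simp add: theta1_def theta2_def theta3_def theta_char_shift_1 c)
  show "theta2 (z + h) \<tau> * theta2 (z - h) \<tau> = theta2 (2*z) (2*\<tau>) * theta3 (2*h) (2*\<tau>) + theta3 (2*z) (2*\<tau>) * theta2 (2*h) (2*\<tau>)"
    using m[of 1 0 0] by (simp add: theta2_def theta3_def c)
  show "theta3 (z + h) \<tau> * theta3 (z - h) \<tau> = theta3 (2*z) (2*\<tau>) * theta3 (2*h) (2*\<tau>) + theta2 (2*z) (2*\<tau>) * theta2 (2*h) (2*\<tau>)"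
    using m[of 0 0 0] by (simp add: theta2_def theta3_def)
  show "theta4 (z + h) \<tau> * theta4 (z - h) \<tau> = theta3 (2*z) (2*\<tau>) * theta3 (2*h) (2*\<tau>) - theta2 (2*z) (2*\<tau>) * theta2 (2*h) (2*\<tau>)"
    using m[of 0 1 1] by (simp add: theta2_def theta3_def theta4_def theta_char_shift_1)
qed

lemma theta_squares:
  "(theta1 z \<tau>)^2 = theta2 0 (2*\<tau>) * theta3 (2*z) (2*\<tau>) - theta3 0 (2*\<tau>) * theta2 (2*z) (2*\<tau>)"
  "(theta2 z \<tau>)^2 = theta3 0 (2*\<tau>) * theta2 (2*z) (2*\<tau>) + theta2 0 (2*\<tau>) * theta3 (2*z) (2*\<tau>)"
  "(theta3 z \<tau>)^2 = theta3 0 (2*\<tau>) * theta3 (2*z) (2*\<tau>) + theta2 0 (2*\<tau>) * theta2 (2*z) (2*\<tau>)"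
  "(theta4 z \<tau>)^2 = theta3 0 (2*\<tau>) * theta3 (2*z) (2*\<tau>) - theta2 0 (2*\<tau>) * theta2 (2*z) (2*\<tau>)"
  using theta_reflected_products[of z 0] by (simp_all add: power2_eq_square mult.commute)

lemma theta_constants_squares:
  "(theta2 0 \<tau>)^2 = 2 * theta2 0 (2*\<tau>) * theta3 0 (2*\<tau>)"
  "(theta3 0 \<tau>)^2 = (theta3 0 (2*\<tau>))^2 + (theta2 0 (2*\<tau>))^2"
  "(theta4 0 \<tau>)^2 = (theta3 0 (2*\<tau>))^2 - (theta2 0 (2*\<tau>))^2"
  using theta_squares[of 0] by (simp_all add: power2_eq_square)

lemma theta_second_log_derivatives:
  "theta1_deriv 2 z \<tau> * theta1 z \<tau> - (theta1_deriv 1 z \<tau>)^2 =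
     2 * (theta3 (2*z) (2*\<tau>) * theta2_deriv 2 0 (2*\<tau>) - theta2 (2*z) (2*\<tau>) * theta3_deriv 2 0 (2*\<tau>))"
  "theta2_deriv 2 z \<tau> * theta2 z \<tau> - (theta2_deriv 1 z \<tau>)^2 =
     2 * (theta2 (2*z) (2*\<tau>) * theta3_deriv 2 0 (2*\<tau>) + theta3 (2*z) (2*\<tau>) * theta2_deriv 2 0 (2*\<tau>))"
  "theta3_deriv 2 z \<tau> * theta3 z \<tau> - (theta3_deriv 1 z \<tau>)^2 =
     2 * (theta3 (2*z) (2*\<tau>) * theta3_deriv 2 0 (2*\<tau>) + theta2 (2*z) (2*\<tau>) * theta2_deriv 2 0 (2*\<tau>))"
  "theta4_deriv 2 z \<tau> * theta4 z \<tau> - (theta4_deriv 1 z \<tau>)^2 =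
     2 * (theta3 (2*z) (2*\<tau>) * theta3_deriv 2 0 (2*\<tau>) - theta2 (2*z) (2*\<tau>) * theta2_deriv 2 0 (2*\<tau>))"
proof -
  have \<tau>2: "Im (2 * \<tau>) > 0" using \<tau> by simp
  have d: "((\<lambda>z. theta1_deriv n z \<tau>) has_field_derivative theta1_deriv (Suc n) z \<tau>) (at z)"
    "((\<lambda>z. theta2_deriv n z \<tau>) has_field_derivative theta2_deriv (Suc n) z \<tau>) (at z)"
    "((\<lambda>z. theta3_deriv n z \<tau>) has_field_derivative theta3_deriv (Suc n) z \<tau>) (at z)"
    "((\<lambda>z. theta4_deriv n z \<tau>) has_field_derivative theta4_deriv (Suc n) z \<tau>) (at z)"
    "((\<lambda>z. theta2_deriv n z (2*\<tau>)) has_field_derivative theta2_deriv (Suc n) z (2*\<tau>)) (at z)"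
    "((\<lambda>z. theta3_deriv n z (2*\<tau>)) has_field_derivative theta3_deriv (Suc n) z (2*\<tau>)) (at z)" for n z
    by (rule derivative_eq_intros refl \<tau> \<tau>2 | simp)+
  note r = second_derivative_of_reflected_product[where P = "\<lambda>n z. theta3_deriv n z (2*\<tau>)"
        and Q = "\<lambda>n z. theta2_deriv n z (2*\<tau>)", OF _ d(6) d(5)]
  show "theta1_deriv 2 z \<tau> * theta1 z \<tau> - (theta1_deriv 1 z \<tau>)^2 =
     2 * (theta3 (2*z) (2*\<tau>) * theta2_deriv 2 0 (2*\<tau>) - theta2 (2*z) (2*\<tau>) * theta3_deriv 2 0 (2*\<tau>))"
    using r[where f = "\<lambda>n z. theta1_deriv n z \<tau>", OF d(1), of z "- theta2 (2*z) (2*\<tau>)" "theta3 (2*z) (2*\<tau>)"]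
      theta_reflected_products(1)[of z] by simp
  show "theta2_deriv 2 z \<tau> * theta2 z \<tau> - (theta2_deriv 1 z \<tau>)^2 =
     2 * (theta2 (2*z) (2*\<tau>) * theta3_deriv 2 0 (2*\<tau>) + theta3 (2*z) (2*\<tau>) * theta2_deriv 2 0 (2*\<tau>))"
    using r[where f = "\<lambda>n z. theta2_deriv n z \<tau>", OF d(2), of z "theta2 (2*z) (2*\<tau>)" "theta3 (2*z) (2*\<tau>)"]
      theta_reflected_products(2)[of z] by simp
  show "theta3_deriv 2 z \<tau> * theta3 z \<tau> - (theta3_deriv 1 z \<tau>)^2 =
     2 * (theta3 (2*z) (2*\<tau>) * theta3_deriv 2 0 (2*\<tau>) + theta2 (2*z) (2*\<tau>) * theta2_deriv 2 0 (2*\<tau>))"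
    using r[where f = "\<lambda>n z. theta3_deriv n z \<tau>", OF d(3), of z "theta3 (2*z) (2*\<tau>)" "theta2 (2*z) (2*\<tau>)"]
      theta_reflected_products(3)[of z] by simp
  show "theta4_deriv 2 z \<tau> * theta4 z \<tau> - (theta4_deriv 1 z \<tau>)^2 =
     2 * (theta3 (2*z) (2*\<tau>) * theta3_deriv 2 0 (2*\<tau>) - theta2 (2*z) (2*\<tau>) * theta2_deriv 2 0 (2*\<tau>))"
    using r[where f = "\<lambda>n z. theta4_deriv n z \<tau>", OF d(4), of z "theta3 (2*z) (2*\<tau>)" "- theta2 (2*z) (2*\<tau>)"]
      theta_reflected_products(4)[of z] by simp
qed

lemma theta3_theta4_duplication:
  "theta3 z \<tau> * theta4 z \<tau> = theta4 (2*z) (2*\<tau>) * theta4 0 (2*\<tau>)"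
proof -
  have "theta_char 1 0 (- 1 / 2) (2*\<tau>) = 0"
    using theta_char_shift_half[of 1 "-1" 0 "2*\<tau>"] theta_char_shift_half[of 1 "-1" "-1/2" "2*\<tau>"]
      theta_char_add2_right[of 1 "-1" "0" "2*\<tau>"] theta_char_minus[of 1 0 "1/2" "2*\<tau>"]
      theta_char_shift_half[of 1 0 0 "2*\<tau>"] theta1_at_0[of "2*\<tau>"]
    by (simp add: theta1_def)
  moreover have "theta_char 0 0 (- 1 / 2) (2*\<tau>) = theta_char 0 1 0 (2*\<tau>)"
    using theta_char_minus[of 0 0 "1/2" "2*\<tau>"] theta_char_shift_half[of 0 0 0 "2*\<tau>"] by simp
  ultimately show ?thesis
    using theta_char_mult[OF \<tau>, of 0 0 z 1 z] theta_char_shift_half[of 0 0 "2*z" "2*\<tau>"]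
    by (simp add: theta3_def theta4_def)
qed

text \<open>The derivative at \<open>h = 0\<close> of the duplication formula for \<open>\<theta>\<^sub>1(z + h) \<theta>\<^sub>2(z - h)\<close>.\<close>

lemma theta1_theta2_wronskian_duplication:
  "theta1_deriv 1 z \<tau> * theta2 z \<tau> - theta1 z \<tau> * theta2_deriv 1 z \<tau> =
     2 * theta4 (2*z) (2*\<tau>) * theta1_deriv 1 0 (2*\<tau>)"
proof -
  have \<tau>2: "Im (2 * \<tau>) > 0" using \<tau> by simp
  have eq: "theta1 (z + h) \<tau> * theta2 (z - h) \<tau> =
      theta1 (2*z) (2*\<tau>) * theta4 (2*h) (2*\<tau>) + theta4 (2*z) (2*\<tau>) * theta1 (2*h) (2*\<tau>)" for h
    using theta_char_mult[OF \<tau>, of 1 1 "z + h" 0 "z - h"] theta_char_add2[of 0 1 "2*z" "2*\<tau>"]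
      theta_char_add2[of 0 0 "2*z+1/2" "2*\<tau>"]
      theta_char_shift_half[of _ 0 "2*z" "2*\<tau>"] theta_char_shift_half[of _ 0 "2*h" "2*\<tau>"]
    by (simp add: theta1_def theta2_def theta4_def)
  have "((\<lambda>h. theta1 (z + h) \<tau> * theta2 (z - h) \<tau>) has_field_derivative
          theta1_deriv 1 z \<tau> * theta2 z \<tau> - theta1 z \<tau> * theta2_deriv 1 z \<tau>) (at 0)"
    by (rule derivative_eq_intros refl \<tau> | simp)+
  moreover have "((\<lambda>h. theta1 (2*z) (2*\<tau>) * theta4 (2*h) (2*\<tau>) + theta4 (2*z) (2*\<tau>) * theta1 (2*h) (2*\<tau>)) has_field_derivative
          2 * theta4 (2*z) (2*\<tau>) * theta1_deriv 1 0 (2*\<tau>)) (at 0)"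
    by (rule derivative_eq_intros refl \<tau>2 | simp add: theta4_deriv_at_0[OF \<tau>2])+
  ultimately show ?thesis unfolding eq by (rule DERIV_unique)
qed

end

section \<open>Theta constants and the Jacobi derivative formula\<close>

text \<open>The exponents \<open>(k + a/2)\<^sup>2\<close> have their minimum \<open>a\<^sup>2/4\<close> at \<open>k = 0\<close> and \<open>k = - a\<close>, one index if \<open>a = 0\<close> and two
  if \<open>a = 1\<close>; every other exponent exceeds it by at least 1.\<close>

lemma theta_deriv_at_0_asymptotics:
  assumes a: "a = 0 \<or> a = 1"
  shows "\<exists>S. \<forall>\<tau>. Im \<tau> \<ge> 1 \<longrightarrow>
     norm (exp (- (of_real pi * \<i> * of_int a^2 / 4 * \<tau>)) * theta_deriv n a b 0 \<tau>
           - (\<Sum>k\<in>{0,-a}. theta_term n a b 0 0 k)) \<le> S * exp (- (pi * Im \<tau>))"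
proof -
  define A where "A = UNIV - {0, -a}"
  \<comment> \<open>The terms at \<open>\<tau> = \<i>\<close> serve as a summable majorant for all \<open>\<tau>\<close> with imaginary part at least 1.\<close>
  define g where "g = (\<lambda>k. norm (theta_term n a b 0 \<i> k) * exp (pi * of_int a^2 / 4 + pi))"
  have gs: "g summable_on A"
    unfolding g_def by (intro summable_on_cmult_left summable_on_subset_banach[OF theta_term_abs_summable]) auto
  have "norm (exp (- (of_real pi * \<i> * of_int a^2 / 4 * \<tau>)) * theta_deriv n a b 0 \<tau>
           - (\<Sum>k\<in>{0,-a}. theta_term n a b 0 0 k)) \<le> infsum g A * exp (- (pi * Im \<tau>))"
    if y: "Im \<tau> \<ge> 1" for \<tau>
  proof -
    define T where "T = (\<lambda>k. exp (- (of_real pi * \<i> * of_int a^2 / 4 * \<tau>)) * theta_term n a b 0 \<tau> k)"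
    have T: "(T has_sum (exp (- (of_real pi * \<i> * of_int a^2 / 4 * \<tau>)) * theta_deriv n a b 0 \<tau>)) UNIV"
      unfolding T_def by (intro has_sum_cmult_right theta_term_has_sum) (use y in linarith)
    have Tk: "T k = theta_term n a b 0 0 k" if "k \<in> {0, -a}" for k
    proof -
      have eq: "(of_int k + of_int a / 2)^2 = (of_int a^2 / 4 :: complex)"
        using that by (auto simp: power2_eq_square field_simps)
      show ?thesis
        unfolding T_def theta_term_def eq using mult_exp_exp[of "- (of_real pi * \<i> * of_int a^2 / 4 * \<tau>)" "of_real pi * \<i> * (of_int a^2 / 4) * \<tau>"]
        by (simp add: exp_add)
    qed
    have "(T has_sum (\<Sum>k\<in>{0,-a}. T k)) {0,-a}" by (rule has_sum_finite) auto
    hence 1: "(T has_sum (exp (- (of_real pi * \<i> * of_int a^2 / 4 * \<tau>)) * theta_deriv n a b 0 \<tau>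
           - (\<Sum>k\<in>{0,-a}. T k))) A"
      unfolding A_def by (intro has_sum_Diff T) auto
    have 2: "((\<lambda>k. g k * exp (- (pi * Im \<tau>))) has_sum (infsum g A * exp (- (pi * Im \<tau>)))) A"
      by (intro has_sum_cmult_left has_sum_infsum gs)
    have "norm (T k) \<le> g k * exp (- (pi * Im \<tau>))" if k: "k \<in> A" for k
    proof -
      define m where "m = real_of_int k + real_of_int a / 2"
      define e where "e = real_of_int (k^2 + k * a)"
      have m2: "m^2 = e + of_int a^2 / 4" by (simp add: m_def e_def power2_eq_square field_simps)
      have "k^2 + k * a \<ge> 1"
      proof (cases "a = 0")
        case True
        hence "k^2 > 0" using k by (simp add: A_def)
        hence "1 \<le> k^2" by linarith
        thus ?thesis using True by (simp only: mult_zero_right add_0_right)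
      next
        case False
        hence "a = 1" using a by simp
        hence "k \<ge> 1 \<or> k + 1 \<le> -1" using k by (auto simp: A_def)
        hence "k * (k + 1) > 0" by (simp add: zero_less_mult_iff) linarith
        thus ?thesis using \<open>a = 1\<close> by (simp add: power2_eq_square algebra_simps)
      qed
      hence "e \<ge> 1" unfolding e_def by linarith
      hence "0 \<le> (e - 1) * (Im \<tau> - 1)" using y by simp
      hence "pi * (e + Im \<tau> - 1) \<le> pi * (e * Im \<tau>)" by (intro mult_left_mono) (auto simp: algebra_simps)
      hence le: "pi * of_int a^2 / 4 * Im \<tau> + - (pi * m^2 * Im \<tau>) \<le>
             - (pi * m^2) + (pi * of_int a^2 / 4 + pi) + - (pi * Im \<tau>)"
        unfolding m2 by (simp add: algebra_simps)
      have "norm (T k) = (2 * pi * \<bar>m\<bar>)^n * exp (pi * of_int a^2 / 4 * Im \<tau> + - (pi * m^2 * Im \<tau>))"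
        unfolding T_def norm_mult norm_theta_term exp_add m_def by (simp add: power2_eq_square)
      also have "\<dots> \<le> (2 * pi * \<bar>m\<bar>)^n * exp (- (pi * m^2) + (pi * of_int a^2 / 4 + pi) + - (pi * Im \<tau>))"
        using le by (intro mult_left_mono) auto
      also have "\<dots> = g k * exp (- (pi * Im \<tau>))"
        unfolding g_def norm_theta_term exp_add m_def by simp
      finally show ?thesis .
    qed
    from norm_infsum_le[OF 1 2 this] show ?thesis using Tk by simp
  qed
  thus ?thesis by blast
qed

lemma Im_2_power_mult: "Im (2^N * \<tau>) = 2^N * Im \<tau>"
proof -
  have "2^N * \<tau> = of_real (2^N) * \<tau>" by simp
  thus ?thesis by (metis Im_complex_of_real Re_complex_of_real add_0_right mult_zero_left times_complex.sel(2))
qed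

lemma theta_deriv_at_0_tendsto:
  assumes a: "a = 0 \<or> a = 1" and \<tau>: "Im \<tau> > 0"
  shows "(\<lambda>N. exp (- (of_real pi * \<i> * of_int a^2 / 4 * (2^N * \<tau>))) * theta_deriv n a b 0 (2^N * \<tau>))
           \<longlonglongrightarrow> (\<Sum>k\<in>{0,-a}. theta_term n a b 0 0 k)"
proof -
  obtain S where S: "\<And>\<tau>. Im \<tau> \<ge> 1 \<Longrightarrow>
     norm (exp (- (of_real pi * \<i> * of_int a^2 / 4 * \<tau>)) * theta_deriv n a b 0 \<tau>
           - (\<Sum>k\<in>{0,-a}. theta_term n a b 0 0 k)) \<le> S * exp (- (pi * Im \<tau>))"
    using theta_deriv_at_0_asymptotics[OF a, of n b] by blast
  have "filterlim (\<lambda>N. (2::real)^N) at_infinity sequentially"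
    by (rule filterlim_realpow_sequentially_gt1) simp
  hence "filterlim (\<lambda>N. (2::real)^N) at_top sequentially"
    by (rule filterlim_at_infinity_imp_filterlim_at_top) simp
  hence inf: "filterlim (\<lambda>N. Im (2^N * \<tau>)) at_top sequentially"
    unfolding Im_2_power_mult by (rule filterlim_at_top_mult_tendsto_pos[OF tendsto_const \<tau>])
  have "\<forall>\<^sub>F N in sequentially. Im (2^N * \<tau>) \<ge> 1"
    using inf by (simp add: filterlim_at_top)
  hence ev: "\<forall>\<^sub>F N in sequentially. norm (exp (- (of_real pi * \<i> * of_int a^2 / 4 * (2^N * \<tau>))) * theta_deriv n a b 0 (2^N * \<tau>)
           - (\<Sum>k\<in>{0,-a}. theta_term n a b 0 0 k)) \<le> S * exp (- (pi * Im (2^N * \<tau>)))"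
    by eventually_elim (rule S)
  have "filterlim (\<lambda>N. pi * Im (2^N * \<tau>)) at_top sequentially"
    by (rule filterlim_tendsto_pos_mult_at_top[OF tendsto_const pi_gt_zero inf])
  hence "((\<lambda>N. exp (- (pi * Im (2^N * \<tau>)))) \<longlongrightarrow> 0) sequentially"
    by (intro filterlim_compose[OF exp_at_bot] filterlim_compose[OF filterlim_uminus_at_bot_at_top])
  hence "((\<lambda>N. S * exp (- (pi * Im (2^N * \<tau>)))) \<longlongrightarrow> 0) sequentially"
    by (rule tendsto_mult_right_zero)
  from Lim_null_comparison[OF ev this] show ?thesis by (simp add: LIM_zero_iff)
qed

lemma theta_constants_tendsto:
  assumes \<tau>: "Im \<tau> > 0"
  defines "e \<equiv> (\<lambda>N. exp (- (of_real pi * \<i> / 4 * (2^N * \<tau>))))"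
  shows "(\<lambda>N. theta3 0 (2^N * \<tau>)) \<longlonglongrightarrow> 1" "(\<lambda>N. theta4 0 (2^N * \<tau>)) \<longlonglongrightarrow> 1"
    "(\<lambda>N. e N * theta2 0 (2^N * \<tau>)) \<longlonglongrightarrow> 2"
    "(\<lambda>N. e N * theta1_deriv 1 0 (2^N * \<tau>)) \<longlonglongrightarrow> 2 * of_real pi"
proof -
  note l = theta_deriv_at_0_tendsto[OF _ \<tau>]
  show "(\<lambda>N. theta3 0 (2^N * \<tau>)) \<longlonglongrightarrow> 1"
    using l[of 0 0 0] by (simp add: theta_deriv_0 theta3_def theta_term_def)
  show "(\<lambda>N. theta4 0 (2^N * \<tau>)) \<longlonglongrightarrow> 1"
    using l[of 0 0 1] by (simp add: theta_deriv_0 theta4_def theta_term_def)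
  show "(\<lambda>N. e N * theta2 0 (2^N * \<tau>)) \<longlonglongrightarrow> 2"
    using l[of 1 0 0] by (simp add: theta_deriv_0 theta2_def theta_term_def e_def)
  have 1: "exp (complex_of_real pi * \<i> / 2) = \<i>" "exp (- (complex_of_real pi * \<i> / 2)) = - \<i>"
    using cis_pi_half by (simp_all add: cis_conv_exp exp_minus field_simps)
  have s: "(\<Sum>k\<in>{0,-1::int}. theta_term 1 1 1 0 0 k) = - (2 * of_real pi)"
    using 1 by (simp add: theta_term_def)
  have "(\<lambda>N. - (e N * theta_deriv 1 1 1 0 (2^N * \<tau>))) \<longlonglongrightarrow> - (\<Sum>k\<in>{0,-1::int}. theta_term 1 1 1 0 0 k)"
    using l[of 1 1 1] unfolding e_def by (intro tendsto_minus) simp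
  thus "(\<lambda>N. e N * theta1_deriv 1 0 (2^N * \<tau>)) \<longlonglongrightarrow> 2 * of_real pi"
    unfolding s by (simp add: theta1_deriv_def)
qed

lemma theta3_theta4_constants_duplication:
  assumes "Im \<tau> > 0" shows "theta3 0 \<tau> * theta4 0 \<tau> = (theta4 0 (2*\<tau>))^2"
  using theta3_theta4_duplication[OF assms, of 0] by (simp add: power2_eq_square)

text \<open>Far up in the half-plane the theta constants do not vanish by their leading terms, and the
  duplication formulas carry this down from \<open>2 \<tau>\<close> to \<open>\<tau>\<close>.\<close>

lemma theta_constants_nonzero:
  assumes \<tau>: "Im \<tau> > 0"
  shows "theta2 0 \<tau> \<noteq> 0" "theta3 0 \<tau> \<noteq> 0" "theta4 0 \<tau> \<noteq> 0"
proof -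
  define Q where "Q = (\<lambda>\<tau>. theta2 0 \<tau> \<noteq> 0 \<and> theta3 0 \<tau> \<noteq> 0 \<and> theta4 0 \<tau> \<noteq> 0)"
  have "\<forall>\<^sub>F N in sequentially. theta3 0 (2^N * \<tau>) \<noteq> 0 \<and> theta4 0 (2^N * \<tau>) \<noteq> 0 \<and>
          exp (- (of_real pi * \<i> / 4 * (2^N * \<tau>))) * theta2 0 (2^N * \<tau>) \<noteq> 0"
    by (intro eventually_conj tendsto_imp_eventually_ne[OF theta_constants_tendsto(1)[OF \<tau>]]
          tendsto_imp_eventually_ne[OF theta_constants_tendsto(2)[OF \<tau>]]
          tendsto_imp_eventually_ne[OF theta_constants_tendsto(3)[OF \<tau>]]) auto
  then obtain N where N: "Q (2^N * \<tau>)"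
    unfolding Q_def by (auto simp: eventually_sequentially)
  have down: "Q t" if "Q (2 * t)" "Im t > 0" for t
  proof -
    have "(theta2 0 t)^2 \<noteq> 0" "theta3 0 t * theta4 0 t \<noteq> 0"
      using that(1) unfolding theta_constants_squares(1)[OF that(2)] theta3_theta4_constants_duplication[OF that(2)]
      by (simp_all add: Q_def)
    thus ?thesis by (simp add: Q_def)
  qed
  have "Q (2^(N - k) * \<tau>)" if "k \<le> N" for k
    using that
  proof (induction k)
    case (Suc k)
    have e: "2^(N - k) = 2 * (2::complex)^(N - Suc k)"
      using Suc.prems by (metis Suc_diff_Suc Suc_le_lessD power_Suc)
    show ?case
      by (rule down) (use Suc \<tau> in \<open>auto simp: e Im_2_power_mult mult.assoc\<close>)
  qed (use N in simp)
  from this[of N] have "Q \<tau>" by simp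
  thus "theta2 0 \<tau> \<noteq> 0" "theta3 0 \<tau> \<noteq> 0" "theta4 0 \<tau> \<noteq> 0" by (auto simp: Q_def)
qed

text \<open>The quotient of the two sides is invariant under \<open>\<tau> \<mapsto> 2 \<tau>\<close> and tends to 1 along
  \<open>2\<^sup>N \<tau>\<close>.\<close>

theorem jacobi_derivative_formula:
  assumes \<tau>: "Im \<tau> > 0"
  shows "theta1_deriv 1 0 \<tau> = of_real pi * theta2 0 \<tau> * theta3 0 \<tau> * theta4 0 \<tau>"
proof -
  define J where "J = (\<lambda>\<tau>. theta1_deriv 1 0 \<tau> / (of_real pi * theta2 0 \<tau> * theta3 0 \<tau> * theta4 0 \<tau>))"
  have J2: "J (2 * t) = J t" if t: "Im t > 0" for t
  proof -
    have t2: "Im (2 * t) > 0" using t by simp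
    note nz = theta_constants_nonzero[OF t] theta_constants_nonzero[OF t2]
    have 1: "theta1_deriv 1 0 t * theta2 0 t = 2 * theta4 0 (2*t) * theta1_deriv 1 0 (2*t)"
      using theta1_theta2_wronskian_duplication[OF t, of 0] by simp
    have "theta1_deriv 1 0 t * (of_real pi * theta2 0 (2*t) * theta3 0 (2*t) * theta4 0 (2*t)) * theta2 0 t
        = theta1_deriv 1 0 (2*t) * (of_real pi * theta2 0 t * theta3 0 t * theta4 0 t) * theta2 0 t"
      (is "?l = ?r")
    proof -
      have "?l = (theta1_deriv 1 0 t * theta2 0 t) * (of_real pi * theta2 0 (2*t) * theta3 0 (2*t) * theta4 0 (2*t))"
        by (simp only: mult_ac)
      also have "\<dots> = of_real pi * theta1_deriv 1 0 (2*t) * (2 * theta2 0 (2*t) * theta3 0 (2*t)) * (theta4 0 (2*t))^2"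
        unfolding 1 by (simp add: power2_eq_square mult_ac)
      also have "\<dots> = of_real pi * theta1_deriv 1 0 (2*t) * (theta2 0 t)^2 * (theta3 0 t * theta4 0 t)"
        unfolding theta_constants_squares(1)[OF t] theta3_theta4_constants_duplication[OF t] ..
      also have "\<dots> = ?r" by (simp add: power2_eq_square mult_ac)
      finally show ?thesis .
    qed
    thus ?thesis unfolding J_def using nz by (simp add: frac_eq_eq)
  qed
  have J2N: "J (2^N * \<tau>) = J \<tau>" for N
  proof (induction N)
    case (Suc N)
    have "J (2 * (2^N * \<tau>)) = J (2^N * \<tau>)" by (rule J2) (use \<tau> in \<open>simp add: Im_2_power_mult\<close>)
    with Suc show ?case by (simp add: mult.assoc)
  qed simp
  note l = theta_constants_tendsto[OF \<tau>]
  define e where "e = (\<lambda>N. exp (- (of_real pi * \<i> / 4 * (2^N * \<tau>))))"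
  have "(\<lambda>N. (e N * theta1_deriv 1 0 (2^N * \<tau>)) / (of_real pi * (e N * theta2 0 (2^N * \<tau>)) * theta3 0 (2^N * \<tau>) * theta4 0 (2^N * \<tau>)))
      \<longlonglongrightarrow> 2 * of_real pi / (of_real pi * 2 * 1 * 1)"
    unfolding e_def by (intro tendsto_intros l) simp
  moreover have "(e N * theta1_deriv 1 0 (2^N * \<tau>)) / (of_real pi * (e N * theta2 0 (2^N * \<tau>)) * theta3 0 (2^N * \<tau>) * theta4 0 (2^N * \<tau>)) = J \<tau>" for N
    unfolding J2N[of N, symmetric] unfolding J_def e_def by simp
  ultimately have "(\<lambda>N. J \<tau>) \<longlonglongrightarrow> 1" by simp
  hence "J \<tau> = 1" by (simp add: LIMSEQ_const_iff)
  thus ?thesis unfolding J_def using theta_constants_nonzero[OF \<tau>] by (simp add: field_simps)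
qed

context
  fixes \<tau> :: complex
  assumes \<tau>: "Im \<tau> > 0"
begin

lemma theta1_deriv_0_nonzero: "theta1_deriv 1 0 \<tau> \<noteq> 0"
  using jacobi_derivative_formula[OF \<tau>] theta_constants_nonzero[OF \<tau>] by simp

text \<open>In the duplicated form of the Wronskian the Jacobi formula at \<open>2 \<tau>\<close> turns the constant into theta
  constants, and \<open>\<theta>\<^sub>4(2 z | 2 \<tau>)\<close> is proportional to \<open>\<theta>\<^sub>3(z) \<theta>\<^sub>4(z)\<close>.\<close>

theorem theta1_theta2_wronskian:
  "theta1_deriv 1 z \<tau> * theta2 z \<tau> - theta1 z \<tau> * theta2_deriv 1 z \<tau> =
     of_real pi * (theta2 0 \<tau>)^2 * theta3 z \<tau> * theta4 z \<tau>"
proof -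
  have \<tau>2: "Im (2*\<tau>) > 0" using \<tau> by simp
  show ?thesis
    unfolding theta1_theta2_wronskian_duplication[OF \<tau>] jacobi_derivative_formula[OF \<tau>2]
      theta_constants_squares(1)[OF \<tau>] mult.assoc theta3_theta4_duplication[OF \<tau>] by (simp add: mult_ac)
qed

lemma theta_square_relations:
  "(theta4 0 \<tau>)^2 * (theta2 z \<tau>)^2 + (theta3 0 \<tau>)^2 * (theta1 z \<tau>)^2 = (theta2 0 \<tau>)^2 * (theta4 z \<tau>)^2"
  "(theta3 0 \<tau>)^2 * (theta2 z \<tau>)^2 + (theta4 0 \<tau>)^2 * (theta1 z \<tau>)^2 = (theta2 0 \<tau>)^2 * (theta3 z \<tau>)^2"
  "(theta2 0 \<tau>)^4 + (theta4 0 \<tau>)^4 = (theta3 0 \<tau>)^4"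
proof -
  show "(theta4 0 \<tau>)^2 * (theta2 z \<tau>)^2 + (theta3 0 \<tau>)^2 * (theta1 z \<tau>)^2 = (theta2 0 \<tau>)^2 * (theta4 z \<tau>)^2"
    "(theta3 0 \<tau>)^2 * (theta2 z \<tau>)^2 + (theta4 0 \<tau>)^2 * (theta1 z \<tau>)^2 = (theta2 0 \<tau>)^2 * (theta3 z \<tau>)^2"
    unfolding theta_squares[OF \<tau>, of z] theta_constants_squares[OF \<tau>]
    by (simp_all add: power2_eq_square algebra_simps)
  have 4: "x^4 = (x^2)^2" for x :: complex by simp
  show "(theta2 0 \<tau>)^4 + (theta4 0 \<tau>)^4 = (theta3 0 \<tau>)^4"
    unfolding 4 theta_constants_squares[OF \<tau>]
    by (simp add: power2_eq_square algebra_simps)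
qed

end

section \<open>The zeros of theta functions\<close>

context
  fixes \<tau> :: complex
  assumes \<tau>: "Im \<tau> > 0"
begin

text \<open>At a zero \<open>z\<^sub>0\<close> of \<open>\<theta>\<^sub>1\<close> the two theta functions of \<open>2 z\<^sub>0\<close> and \<open>2 \<tau>\<close> are proportional to their
  values at 0, so all four products \<open>\<theta>\<^sub>j(z\<^sub>0 + h) \<theta>\<^sub>j(z\<^sub>0 - h)\<close> are, up to sign, the same multiple of
  \<open>\<theta>\<^sub>j(h)\<^sup>2\<close>.\<close>

lemma theta_reflected_products_at_zero:
  assumes "theta1 z0 \<tau> = 0"
  obtains \<kappa> where
    "\<And>h. theta1 (z0 + h) \<tau> * theta1 (z0 - h) \<tau> = - \<kappa> * (theta1 h \<tau>)^2"
    "\<And>h. theta2 (z0 + h) \<tau> * theta2 (z0 - h) \<tau> = \<kappa> * (theta2 h \<tau>)^2"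
    "\<And>h. theta4 (z0 + h) \<tau> * theta4 (z0 - h) \<tau> = \<kappa> * (theta4 h \<tau>)^2"
proof -
  have \<tau>2: "Im (2*\<tau>) > 0" using \<tau> by simp
  define \<kappa> where "\<kappa> = theta3 (2*z0) (2*\<tau>) / theta3 0 (2*\<tau>)"
  note nz = theta_constants_nonzero[OF \<tau>2]
  have P: "theta3 (2*z0) (2*\<tau>) = \<kappa> * theta3 0 (2*\<tau>)" using nz by (simp add: \<kappa>_def)
  have Q: "theta2 (2*z0) (2*\<tau>) = \<kappa> * theta2 0 (2*\<tau>)"
    using theta_squares(1)[OF \<tau>, of z0] nz assms by (simp add: \<kappa>_def field_simps)
  show ?thesis
    by (rule that[of \<kappa>]; unfold theta_reflected_products[OF \<tau>] theta_squares[OF \<tau>] P Q; simp add: algebra_simps)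
qed

lemma theta_derivs_DERIV_at:
  "((\<lambda>z. theta1_deriv n z \<tau>) has_field_derivative theta1_deriv (Suc n) z \<tau>) (at z within A)"
  "((\<lambda>z. theta2_deriv n z \<tau>) has_field_derivative theta2_deriv (Suc n) z \<tau>) (at z within A)"
  "((\<lambda>z. theta3_deriv n z \<tau>) has_field_derivative theta3_deriv (Suc n) z \<tau>) (at z within A)"
  "((\<lambda>z. theta4_deriv n z \<tau>) has_field_derivative theta4_deriv (Suc n) z \<tau>) (at z within A)"
  by (rule derivative_eq_intros refl \<tau> | simp)+

lemma theta1_log_derivative_DERIV:
  assumes "theta1 z \<tau> \<noteq> 0"
  shows "((\<lambda>z. theta1_deriv 1 z \<tau> / theta1 z \<tau>) has_field_derivative
     (theta1_deriv 2 z \<tau> / theta1 z \<tau> - (theta1_deriv 1 z \<tau> / theta1 z \<tau>)^2)) (at z)"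
proof -
  have "((\<lambda>z. theta1_deriv 1 z \<tau> / theta1_deriv 0 z \<tau>) has_field_derivative
     ((theta1_deriv (Suc 1) z \<tau> * theta1_deriv 0 z \<tau> - theta1_deriv 1 z \<tau> * theta1_deriv (Suc 0) z \<tau>)
       / (theta1_deriv 0 z \<tau> * theta1_deriv 0 z \<tau>))) (at z)"
    by (rule DERIV_divide[OF theta_derivs_DERIV_at(1) theta_derivs_DERIV_at(1)]) (use assms in simp)
  also have "(theta1_deriv (Suc 1) z \<tau> * theta1_deriv 0 z \<tau> - theta1_deriv 1 z \<tau> * theta1_deriv (Suc 0) z \<tau>)
       / (theta1_deriv 0 z \<tau> * theta1_deriv 0 z \<tau>) = theta1_deriv 2 z \<tau> / theta1 z \<tau> - (theta1_deriv 1 z \<tau> / theta1 z \<tau>)^2"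
    using assms by (simp add: diff_divide_distrib power2_eq_square numeral_2_eq_2)
  finally show ?thesis by simp
qed

lemma theta_holomorphic:
  "(\<lambda>z. theta1 z \<tau>) holomorphic_on A" "(\<lambda>z. theta2 z \<tau>) holomorphic_on A"
  "(\<lambda>z. theta3 z \<tau>) holomorphic_on A" "(\<lambda>z. theta4 z \<tau>) holomorphic_on A"
  "(\<lambda>z. theta1_deriv n z \<tau>) holomorphic_on A" "(\<lambda>z. theta2_deriv n z \<tau>) holomorphic_on A"
proof -
  note d = theta_derivs_DERIV_at
  show "(\<lambda>z. theta1_deriv n z \<tau>) holomorphic_on A" "(\<lambda>z. theta2_deriv n z \<tau>) holomorphic_on A"
    unfolding holomorphic_on_def field_differentiable_def using d by blast+
  show "(\<lambda>z. theta1 z \<tau>) holomorphic_on A" "(\<lambda>z. theta2 z \<tau>) holomorphic_on A"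
    "(\<lambda>z. theta3 z \<tau>) holomorphic_on A" "(\<lambda>z. theta4 z \<tau>) holomorphic_on A"
    unfolding holomorphic_on_def field_differentiable_def using d[where n=0, unfolded theta_derivs_0] by blast+
qed

lemma theta1_nonzero_somewhere: "\<exists>z. theta1 z \<tau> \<noteq> 0"
proof (rule ccontr)
  assume "\<not> (\<exists>z. theta1 z \<tau> \<noteq> 0)"
  hence "(\<lambda>z. theta1 z \<tau>) = (\<lambda>z. 0)" by auto
  moreover have "((\<lambda>z. theta1 z \<tau>) has_field_derivative theta1_deriv 1 0 \<tau>) (at 0)"
    by (rule derivative_eq_intros refl \<tau> | simp)+
  ultimately have "theta1_deriv 1 0 \<tau> = 0" using DERIV_unique DERIV_const by metis
  thus False using theta1_deriv_0_nonzero[OF \<tau>] by simp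
qed

lemma countable_theta1_zeros: "countable {z. theta1 z \<tau> = 0}"
proof -
  have "\<not> (\<lambda>z. theta1 z \<tau>) constant_on UNIV"
    using theta1_nonzero_somewhere theta1_at_0[of \<tau>] unfolding constant_on_def by (metis UNIV_I)
  from holomorphic_countable_zeros[OF theta_holomorphic(1) open_UNIV connected_UNIV _ this]
  show ?thesis by (simp add: open_imp_fsigma_in)
qed

text \<open>The factor \<open>\<kappa>\<close> cannot vanish, because the countably many zeros of \<open>\<theta>\<^sub>1\<close> leave an \<open>h\<close> for which
  \<open>\<theta>\<^sub>1(z\<^sub>0 + h) \<theta>\<^sub>1(z\<^sub>0 - h) \<noteq> 0\<close>.\<close>

lemma theta_reflected_products_at_zero_nonzero:
  assumes "theta1 z0 \<tau> = 0"
  obtains \<kappa> where "\<kappa> \<noteq> 0"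
    "\<And>h. theta1 (z0 + h) \<tau> * theta1 (z0 - h) \<tau> = - \<kappa> * (theta1 h \<tau>)^2"
    "\<And>h. theta2 (z0 + h) \<tau> * theta2 (z0 - h) \<tau> = \<kappa> * (theta2 h \<tau>)^2"
    "\<And>h. theta4 (z0 + h) \<tau> * theta4 (z0 - h) \<tau> = \<kappa> * (theta4 h \<tau>)^2"
proof -
  obtain \<kappa> where \<kappa>: 
    "\<And>h. theta1 (z0 + h) \<tau> * theta1 (z0 - h) \<tau> = - \<kappa> * (theta1 h \<tau>)^2"
    "\<And>h. theta2 (z0 + h) \<tau> * theta2 (z0 - h) \<tau> = \<kappa> * (theta2 h \<tau>)^2"
    "\<And>h. theta4 (z0 + h) \<tau> * theta4 (z0 - h) \<tau> = \<kappa> * (theta4 h \<tau>)^2"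
    using theta_reflected_products_at_zero[OF assms] by metis
  have "countable ((\<lambda>z. z - z0) ` {z. theta1 z \<tau> = 0} \<union> (\<lambda>z. z0 - z) ` {z. theta1 z \<tau> = 0})"
    using countable_theta1_zeros by auto
  then obtain h where h: "h \<notin> (\<lambda>z. z - z0) ` {z. theta1 z \<tau> = 0} \<union> (\<lambda>z. z0 - z) ` {z. theta1 z \<tau> = 0}"
    using uncountable_UNIV_complex by (metis UNIV_eq_I)
  have "theta1 (z0 + h) \<tau> \<noteq> 0" "theta1 (z0 - h) \<tau> \<noteq> 0"
    using h by (force simp: image_iff)+
  hence "\<kappa> \<noteq> 0" using \<kappa>(1)[of h] by auto
  with \<kappa> that show ?thesis by blast
qed

lemma theta1_theta2_no_common_zero:
  assumes "theta1 z \<tau> = 0" shows "theta2 z \<tau> \<noteq> 0"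
proof
  assume "theta2 z \<tau> = 0"
  obtain \<kappa> where \<kappa>: "\<kappa> \<noteq> 0" "\<And>h. theta2 (z + h) \<tau> * theta2 (z - h) \<tau> = \<kappa> * (theta2 h \<tau>)^2"
    using theta_reflected_products_at_zero_nonzero[OF assms] by metis
  from \<kappa>(2)[of 0] \<open>theta2 z \<tau> = 0\<close> \<kappa>(1) theta_constants_nonzero[OF \<tau>] show False by simp
qed

text \<open>The square quotient \<open>\<theta>\<^sub>2\<^sup>2 / \<theta>\<^sub>1\<^sup>2\<close> is invariant under translation by a zero \<open>z\<^sub>0\<close> of \<open>\<theta>\<^sub>1\<close>. With
  \<open>a\<close>, \<open>b\<close>, \<open>c\<close> the values at \<open>z\<^sub>0 + h\<close>, \<open>z\<^sub>0 - h\<close> and \<open>h\<close>, the product relations give \<open>a b = c\<^sup>2\<close> and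
  \<open>a + b = 2 c\<close>.\<close>

lemma theta_quotient_translation:
  assumes z0: "theta1 z0 \<tau> = 0" and h: "theta1 h \<tau> \<noteq> 0"
  shows "theta1 (h + z0) \<tau> \<noteq> 0"
    and "(theta2 (h + z0) \<tau> / theta1 (h + z0) \<tau>)^2 = (theta2 h \<tau> / theta1 h \<tau>)^2"
proof -
  obtain \<kappa> where \<kappa>: "\<kappa> \<noteq> 0"
    "\<And>h. theta1 (z0 + h) \<tau> * theta1 (z0 - h) \<tau> = - \<kappa> * (theta1 h \<tau>)^2"
    "\<And>h. theta2 (z0 + h) \<tau> * theta2 (z0 - h) \<tau> = \<kappa> * (theta2 h \<tau>)^2"
    "\<And>h. theta4 (z0 + h) \<tau> * theta4 (z0 - h) \<tau> = \<kappa> * (theta4 h \<tau>)^2"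
    using theta_reflected_products_at_zero_nonzero[OF z0] by metis
  have nz: "theta1 (z0 + h) \<tau> \<noteq> 0" "theta1 (z0 - h) \<tau> \<noteq> 0"
    using \<kappa>(1) \<kappa>(2)[of h] h by auto
  thus "theta1 (h + z0) \<tau> \<noteq> 0" by (simp add: add.commute)
  define f where "f = (\<lambda>z. (theta2 z \<tau> / theta1 z \<tau>)^2)"
  define k where "k = (theta3 0 \<tau> / theta4 0 \<tau>)^2"
  define l where "l = (theta2 0 \<tau> / theta4 0 \<tau>)^2"
  note c = theta_constants_nonzero[OF \<tau>]
  have 4: "f z + k = l * (theta4 z \<tau> / theta1 z \<tau>)^2" if "theta1 z \<tau> \<noteq> 0" for z
    unfolding f_def k_def l_def using theta_square_relations(1)[OF \<tau>] that c
    by (simp add: field_simps)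
  have p: "f (z0 + h) * f (z0 - h) = (f h)^2"
  proof -
    have "f (z0 + h) * f (z0 - h) = ((theta2 (z0 + h) \<tau> * theta2 (z0 - h) \<tau>) / (theta1 (z0 + h) \<tau> * theta1 (z0 - h) \<tau>))^2"
      by (simp add: f_def power_mult_distrib power_divide)
    also have "\<dots> = (f h)^2" unfolding \<kappa> using \<kappa>(1) h by (simp add: f_def field_simps)
    finally show ?thesis .
  qed
  have "(f (z0 + h) + k) * (f (z0 - h) + k) =
      l^2 * ((theta4 (z0 + h) \<tau> * theta4 (z0 - h) \<tau>) / (theta1 (z0 + h) \<tau> * theta1 (z0 - h) \<tau>))^2"
    unfolding 4[OF nz(1)] 4[OF nz(2)] by (simp add: power_mult_distrib power_divide power2_eq_square mult_ac)
  also have "\<dots> = (f h + k)^2" unfolding 4[OF h] \<kappa> using \<kappa>(1) h by (simp add: field_simps)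
  finally have "k * (f (z0 + h) + f (z0 - h)) = k * (2 * f h)" using p by algebra
  hence "f (z0 + h) + f (z0 - h) = 2 * f h" using c by (simp add: k_def)
  hence "(f (z0 + h) - f h)^2 = 0" using p by algebra
  hence "f (z0 + h) = f h" by simp
  thus "(theta2 (h + z0) \<tau> / theta1 (h + z0) \<tau>)^2 = (theta2 h \<tau> / theta1 h \<tau>)^2"
    by (simp add: f_def add.commute)
qed

text \<open>The second logarithmic derivative of \<open>\<theta>\<^sub>1\<close> depends on \<open>z\<close> only through \<open>\<theta>\<^sub>2\<^sup>2 / \<theta>\<^sub>1\<^sup>2\<close>: the functions
  \<open>\<theta>\<^sub>2(2 z | 2 \<tau>)\<close> and \<open>\<theta>\<^sub>3(2 z | 2 \<tau>)\<close> are linear combinations of \<open>\<theta>\<^sub>1\<^sup>2\<close> and \<open>\<theta>\<^sub>2\<^sup>2\<close>.\<close>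

lemma theta1_second_log_derivative_quotient:
  assumes "theta1 z \<tau> \<noteq> 0"
  shows "theta1_deriv 2 z \<tau> / theta1 z \<tau> - (theta1_deriv 1 z \<tau> / theta1 z \<tau>)^2 =
     theta2_deriv 2 0 (2*\<tau>) / theta2 0 (2*\<tau>) * (1 + (theta2 z \<tau> / theta1 z \<tau>)^2)
     + theta3_deriv 2 0 (2*\<tau>) / theta3 0 (2*\<tau>) * (1 - (theta2 z \<tau> / theta1 z \<tau>)^2)"
proof -
  have \<tau>2: "Im (2*\<tau>) > 0" using \<tau> by simp
  note nz = theta_constants_nonzero[OF \<tau>2]
  have P: "theta3 (2*z) (2*\<tau>) = ((theta1 z \<tau>)^2 + (theta2 z \<tau>)^2) / (2 * theta2 0 (2*\<tau>))"
    and Q: "theta2 (2*z) (2*\<tau>) = ((theta2 z \<tau>)^2 - (theta1 z \<tau>)^2) / (2 * theta3 0 (2*\<tau>))"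
    using theta_squares[OF \<tau>, of z] nz by (simp_all add: field_simps)
  have "theta1_deriv 2 z \<tau> / theta1 z \<tau> - (theta1_deriv 1 z \<tau> / theta1 z \<tau>)^2 =
     (theta1_deriv 2 z \<tau> * theta1 z \<tau> - (theta1_deriv 1 z \<tau>)^2) / (theta1 z \<tau>)^2"
    using assms by (simp add: field_simps power2_eq_square)
  also have "\<dots> = theta2_deriv 2 0 (2*\<tau>) / theta2 0 (2*\<tau>) * (1 + (theta2 z \<tau> / theta1 z \<tau>)^2)
     + theta3_deriv 2 0 (2*\<tau>) / theta3 0 (2*\<tau>) * (1 - (theta2 z \<tau> / theta1 z \<tau>)^2)"
  proof -
    have alg: "2 * ((x + x * r) / (2 * a) * A - (x * r - x) / (2 * b) * B) / x = A / a * (1 + r) + B / b * (1 - r)"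
      if "x \<noteq> 0" "a \<noteq> 0" "b \<noteq> 0" for x r a b A B :: complex
      using that by (simp add: field_simps)
    have r: "(theta2 z \<tau>)^2 = (theta1 z \<tau>)^2 * (theta2 z \<tau> / theta1 z \<tau>)^2"
      using assms by (simp add: power_divide)
    show ?thesis
      unfolding theta_second_log_derivatives(1)[OF \<tau>] P Q
      by (subst (1 2) r, rule alg) (use assms nz in simp_all)
  qed
  finally show ?thesis .
qed

lemma connected_theta1_nonzero: "connected {z. theta1 z \<tau> \<noteq> 0}"
proof -
  have "{z. theta1 z \<tau> \<noteq> 0} = UNIV - {z. theta1 z \<tau> = 0}" by auto
  thus ?thesis
    using connected_open_diff_countable[OF _ open_UNIV connected_UNIV countable_theta1_zeros] by simp
qed

lemma open_theta1_nonzero: "open {z. theta1 z \<tau> \<noteq> 0}"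
  by (rule open_Collect_neq[OF holomorphic_on_imp_continuous_on[OF theta_holomorphic(1)] continuous_on_const])

text \<open>Translation by a zero \<open>z\<^sub>0\<close> therefore preserves the second logarithmic derivative of \<open>\<theta>\<^sub>1\<close>, so
  \<open>\<theta>\<^sub>1(z + z\<^sub>0) = C exp(c z) \<theta>\<^sub>1(z)\<close>. Comparing the factors of automorphy for the shifts by 1 and by
  \<open>\<tau>\<close> gives \<open>z\<^sub>0 \<in> \<int> + \<int> \<tau>\<close>.\<close>

theorem theta1_zero_imp_lattice:
  assumes z0: "theta1 z0 \<tau> = 0"
  shows "\<exists>m n::int. z0 = of_int m + of_int n * \<tau>"
proof -
  define S where "S = {z. theta1 z \<tau> \<noteq> 0}"
  have exp1: "\<exists>n::int. w = of_int (2 * n) * of_real pi * \<i>" if "exp w = 1" for w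
    using that unfolding exp_eq_1 by (simp add: complex_eq_iff)
  have S: "open S" "connected S"
    unfolding S_def by (rule open_theta1_nonzero connected_theta1_nonzero)+
  have tr: "h + z0 \<in> S" if "h \<in> S" for h using theta_quotient_translation(1)[OF z0] that by (simp add: S_def)
  define L where "L = (\<lambda>z. theta1_deriv 1 z \<tau> / theta1 z \<tau>)"
  have dL: "(L has_field_derivative (theta1_deriv 2 z \<tau> / theta1 z \<tau> - (theta1_deriv 1 z \<tau> / theta1 z \<tau>)^2)) (at z)"
    if "z \<in> S" for z
    unfolding L_def by (rule theta1_log_derivative_DERIV) (use that in \<open>simp add: S_def\<close>)
  have 0: "((\<lambda>h. L (h + z0) - L h) has_field_derivative 0) (at h)" if h: "h \<in> S" for h
  proof -
    have "((\<lambda>h. L (h + z0)) has_field_derivative 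
       (theta1_deriv 2 (h + z0) \<tau> / theta1 (h + z0) \<tau> - (theta1_deriv 1 (h + z0) \<tau> / theta1 (h + z0) \<tau>)^2)) (at h)"
      using dL[OF tr[OF h]] by (simp add: DERIV_shift)
    from DERIV_diff[OF this dL[OF h]] show ?thesis
      using theta_quotient_translation[OF z0, of h] h
      by (simp add: S_def theta1_second_log_derivative_quotient del: One_nat_def)
  qed
  obtain c where c: "\<And>h. h \<in> S \<Longrightarrow> L (h + z0) - L h = c"
    by (rule DERIV_zero_connected_constant[OF S(2,1) finite.emptyI continuous_at_imp_continuous_on, of "\<lambda>h. L (h + z0) - L h"])
       (use 0 in \<open>auto intro: DERIV_isCont\<close>)
  \<comment> \<open>The logarithmic derivative of \<open>g\<close> is \<open>L(h + z\<^sub>0) - L(h) - c = 0\<close>, so \<open>g\<close> is the constant \<open>C\<close>.\<close>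
  define g where "g = (\<lambda>h. theta1 (h + z0) \<tau> / theta1 h \<tau> * exp (- c * h))"
  have 0: "(g has_field_derivative 0) (at h)" if h: "h \<in> S" for h
  proof -
    have "(g has_field_derivative g h * (L (h + z0) - L h - c)) (at h)"
    proof -
      have nz: "theta1 h \<tau> \<noteq> 0" "theta1 (h + z0) \<tau> \<noteq> 0" using h tr[OF h] by (simp_all add: S_def)
      have "((\<lambda>h. theta1_deriv 0 (h + z0) \<tau>) has_field_derivative theta1_deriv (Suc 0) (h + z0) \<tau>) (at h)"
        using theta_derivs_DERIV_at(1)[of 0 "h + z0" UNIV] by (simp add: DERIV_shift)
      from DERIV_mult[OF DERIV_divide[OF this theta_derivs_DERIV_at(1)[of 0 h UNIV]] DERIV_fun_exp[OF DERIV_cmult_Id[of "- c"]]] nz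
      have "(g has_field_derivative
         ((theta1_deriv 1 (h + z0) \<tau> * theta1 h \<tau> - theta1 (h + z0) \<tau> * theta1_deriv 1 h \<tau>) / (theta1 h \<tau> * theta1 h \<tau>) * exp (- c * h)
          + exp (- c * h) * - c * (theta1 (h + z0) \<tau> / theta1 h \<tau>))) (at h)"
        unfolding g_def by simp
      also have "(theta1_deriv 1 (h + z0) \<tau> * theta1 h \<tau> - theta1 (h + z0) \<tau> * theta1_deriv 1 h \<tau>) / (theta1 h \<tau> * theta1 h \<tau>) * exp (- c * h)
          + exp (- c * h) * - c * (theta1 (h + z0) \<tau> / theta1 h \<tau>) = g h * (L (h + z0) - L h - c)"
        unfolding g_def L_def using nz by (simp add: field_simps)
      finally show ?thesis .
    qed
    thus ?thesis using c[OF h] by simp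
  qed
  obtain C where C: "\<And>h. h \<in> S \<Longrightarrow> g h = C"
    using DERIV_zero_connected_constant[OF S(2,1) finite.emptyI, of g] 0
    by (metis Diff_iff continuous_at_imp_continuous_on DERIV_isCont)
  obtain h where h: "h \<in> S" using theta1_nonzero_somewhere by (auto simp: S_def)
  have "g h \<noteq> 0" using h tr[OF h] by (auto simp: g_def S_def)
  have h1: "h + 1 \<in> S" "h + \<tau> \<in> S" using h by (auto simp: S_def theta1_shift_1 theta1_shift_tau)
  have "g (h + 1) = g h * exp (- c)"
    unfolding g_def using theta1_shift_1[of h \<tau>] theta1_shift_1[of "h + z0" \<tau>] h
    by (simp add: S_def ring_distribs exp_add exp_diff exp_minus field_simps add_ac)
  hence "exp (- c) = 1" using C[OF h] C[OF h1(1)] \<open>g h \<noteq> 0\<close> by simp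
  then obtain n :: int where n: "- c = of_int (2 * n) * of_real pi * \<i>"
    using exp1 by blast
  have e: "exp (- (of_real pi * \<i> * \<tau>) - 2 * of_real pi * \<i> * (h + z0)) =
      exp (- (of_real pi * \<i> * \<tau>) - 2 * of_real pi * \<i> * h) * exp (- 2 * of_real pi * \<i> * z0)"
    unfolding exp_add[symmetric] by (simp add: algebra_simps)
  have "theta1 (h + \<tau> + z0) \<tau> = theta1 ((h + z0) + \<tau>) \<tau>" by (simp add: add_ac)
  hence "g (h + \<tau>) = g h * (exp (- c * \<tau>) * exp (- 2 * of_real pi * \<i> * z0))"
    unfolding g_def using h unfolding theta1_shift_tau e
    by (simp add: S_def distrib_left exp_add[symmetric] exp_diff) (simp add: exp_add exp_diff exp_minus field_simps)
  hence "exp (- c * \<tau>) * exp (- 2 * of_real pi * \<i> * z0) = 1"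
    using C[OF h] C[OF h1(2)] \<open>g h \<noteq> 0\<close> by simp
  hence "exp (2 * of_real pi * \<i> * (of_int n * \<tau> - z0)) = 1"
    unfolding n by (simp add: exp_add[symmetric] algebra_simps)
  then obtain m :: int where "2 * of_real pi * \<i> * (of_int n * \<tau> - z0) = of_int (2 * m) * of_real pi * \<i>"
    using exp1 by blast
  hence "2 * of_real pi * \<i> * (of_int n * \<tau> - z0) = 2 * of_real pi * \<i> * of_int m" by simp
  hence "of_int n * \<tau> - z0 = of_int m" by (subst (asm) mult_cancel_left) simp
  hence "z0 = of_int (- m) + of_int n * \<tau>" by (simp add: algebra_simps)
  thus ?thesis by blast
qed

lemma theta2_zero_imp_lattice:
  assumes "theta2 z \<tau> = 0" shows "\<exists>m n::int. z + 1/2 = of_int m + of_int n * \<tau>"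
  using theta1_zero_imp_lattice[of "z + 1/2"] assms by (simp add: theta1_shift_half)

lemma theta4_zero_imp_lattice:
  assumes "theta4 z \<tau> = 0" shows "\<exists>m n::int. z + \<tau>/2 = of_int m + of_int n * \<tau>"
  using theta1_zero_imp_lattice[of "z + \<tau>/2"] assms theta1_shift_half_tau[of z \<tau>] by auto

lemma theta3_zero_imp_lattice:
  assumes "theta3 z \<tau> = 0" shows "\<exists>m n::int. z + \<tau>/2 + 1/2 = of_int m + of_int n * \<tau>"
  using theta2_zero_imp_lattice[of "z + \<tau>/2"] assms theta2_shift_half_tau[of z \<tau>] by auto

text \<open>Reduction of \<open>z = s + u \<tau>\<close> to the period parallelogram by the fractional parts of \<open>s\<close> and \<open>u\<close>.\<close>

lemma bounded_of_doubly_periodic: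
  fixes f :: "complex \<Rightarrow> complex"
  assumes cont: "continuous_on UNIV f" and 1: "\<And>z. f (z + 1) = f z" and t: "\<And>z. f (z + \<tau>) = f z"
  shows "bounded (range f)"
proof -
  have i: "f (z + of_int m * w) = f z" if p: "\<And>z. f (z + w) = f z" for z w m
  proof (induction m rule: int_induct[where k=0])
    case (step1 i)
    thus ?case using p[of "z + of_int i * w"] by (simp add: algebra_simps)
  next
    case (step2 i)
    thus ?case using p[of "z + of_int (i - 1) * w"] by (simp add: algebra_simps)
  qed simp
  define K where "K = (\<lambda>(s::real, u::real). of_real s + of_real u * \<tau>) ` ({0..1} \<times> {0..1})"
  have "compact K" unfolding K_def
    by (intro compact_continuous_image compact_Times compact_Icc)
       (auto simp: case_prod_unfold intro!: continuous_intros)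
  hence "bounded (f ` K)" 
    by (intro compact_imp_bounded compact_continuous_image continuous_on_subset[OF cont]) auto
  moreover have "range f \<subseteq> f ` K"
  proof safe
    fix z
    define u where "u = Im z / Im \<tau>"
    define s where "s = Re z - u * Re \<tau>"
    have z: "z = of_real s + of_real u * \<tau>" using \<tau> by (simp add: complex_eq_iff s_def u_def)
    have "f z = f (of_real (frac s) + of_real (frac u) * \<tau> + of_int \<lfloor>u\<rfloor> * \<tau> + of_int \<lfloor>s\<rfloor> * 1)"
      by (subst z) (simp add: frac_def algebra_simps)
    also have "\<dots> = f (of_real (frac s) + of_real (frac u) * \<tau>)"
      by (simp only: i[OF 1] i[OF t])
    also have "\<dots> \<in> f ` K"
      unfolding K_def by (intro imageI image_eqI[of _ _ "(frac s, frac u)"]) (auto simp: frac_lt_1 less_imp_le)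
    finally show "f z \<in> f ` K" .
  qed
  ultimately show ?thesis by (rule bounded_subset)
qed

text \<open>If \<open>\<theta>\<^sub>2\<^sup>2 - c \<theta>\<^sub>1\<^sup>2\<close> had no zero, then \<open>\<theta>\<^sub>1\<^sup>2\<close> divided by it would be entire and doubly periodic, hence
  constant, and \<open>\<theta>\<^sub>1\<close> would vanish identically because it vanishes at 0.\<close>

theorem theta_quotient_surjective: "\<exists>z. theta1 z \<tau> \<noteq> 0 \<and> (theta2 z \<tau> / theta1 z \<tau>)^2 = c"
proof (rule ccontr)
  assume neg: "\<not> ?thesis"
  define F where "F = (\<lambda>z. (theta2 z \<tau>)^2 - c * (theta1 z \<tau>)^2)"
  have F: "F z \<noteq> 0" for z
  proof
    assume "F z = 0"
    hence eq: "(theta2 z \<tau>)^2 = c * (theta1 z \<tau>)^2" by (simp add: F_def)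
    hence "theta1 z \<tau> \<noteq> 0" using theta1_theta2_no_common_zero[of z] by auto
    moreover from this eq have "(theta2 z \<tau> / theta1 z \<tau>)^2 = c" by (simp add: power_divide)
    ultimately show False using neg by blast
  qed
  define G where "G = (\<lambda>z. (theta1 z \<tau>)^2 / F z)"
  have hol: "G holomorphic_on UNIV"
    unfolding G_def using F unfolding F_def by (intro holomorphic_intros theta_holomorphic) auto
  have sq: "(- exp w * t)^2 = (exp w)^2 * t^2" for w t :: complex by (simp add: power_mult_distrib)
  have "bounded (range G)"
  proof (rule bounded_of_doubly_periodic)
    show "continuous_on UNIV G" using hol by (rule holomorphic_on_imp_continuous_on)
    show "G (z + 1) = G z" for z by (simp add: G_def F_def theta1_shift_1 theta2_shift_1)
    show "G (z + \<tau>) = G z" for z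
    proof -
      have "F (z + \<tau>) = (exp (- (of_real pi * \<i> * \<tau>) - 2 * of_real pi * \<i> * z))^2 * F z"
        unfolding F_def theta1_shift_tau theta2_shift_tau sq power_mult_distrib by (simp add: algebra_simps)
      thus ?thesis unfolding G_def theta1_shift_tau sq by simp
    qed
  qed
  from Liouville_theorem[OF hol this] obtain k where "\<And>z. G z = k"
    unfolding constant_on_def by blast
  hence G0: "G z = 0" for z by (metis G_def theta1_at_0 divide_eq_0_iff power_zero_numeral)
  obtain z where "theta1 z \<tau> \<noteq> 0" using theta1_nonzero_somewhere by blast
  thus False using G0[of z] F[of z] by (simp add: G_def)
qed

end

section \<open>The heat flow of an elliptic function\<close>

text \<open>The square of the complementary modulus. It equals \<open>x\<close> at \<open>\<tau> = \<i> K / K'\<close>, where the quotient of the two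
  integrals is the reciprocal of the one in Jacobi's convention.\<close>

definition theta_lambda :: "complex \<Rightarrow> complex" where
  "theta_lambda \<tau> = (theta4 0 \<tau> / theta3 0 \<tau>)^4"

text \<open>In Jacobi's notation \<open>U = - cs\<^sup>2\<close>: the even elliptic function of order 2 with periods 1 and \<open>\<tau>\<close> that takes the
  values \<open>\<infinity>\<close>, 0, 1 and \<open>theta_lambda \<tau>\<close> at the half periods 0, \<open>1/2\<close>, \<open>\<tau>/2\<close> and \<open>(1 + \<tau>)/2\<close>.\<close>

definition ell_U :: "complex \<Rightarrow> complex \<Rightarrow> complex" where
  "ell_U z \<tau> = - ((theta4 0 \<tau> / theta3 0 \<tau>)^2 * (theta2 z \<tau> / theta1 z \<tau>)^2)"

text \<open>The derivative of \<open>U\<close> with respect to \<open>z\<close>, see \<open>ell_U_DERIV\<close> below.\<close>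

definition ell_V :: "complex \<Rightarrow> complex \<Rightarrow> complex" where
  "ell_V z \<tau> = 2 * of_real pi * (theta4 0 \<tau> / theta3 0 \<tau>)^2 * (theta2 0 \<tau>)^2 *
                 (theta2 z \<tau> * theta3 z \<tau> * theta4 z \<tau>) / (theta1 z \<tau>)^3"

lemma theta3_deriv_at_0:
  assumes "Im \<tau> > 0" shows "theta3_deriv 1 0 \<tau> = 0"
proof -
  have "((\<lambda>z. theta3 (-z) \<tau>) has_field_derivative - theta3_deriv (Suc 0) (-0) \<tau>) (at 0)"
    by (rule derivative_eq_intros refl assms | simp)+
  moreover have "((\<lambda>z. theta3 z \<tau>) has_field_derivative theta3_deriv (Suc 0) 0 \<tau>) (at 0)"
    by (rule derivative_eq_intros refl assms | simp)+
  ultimately show ?thesis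
    unfolding theta3_minus using DERIV_unique by fastforce
qed

context
  fixes \<tau> :: complex
  assumes \<tau>: "Im \<tau> > 0"
begin

lemma theta_lambda_not_0_1: "theta_lambda \<tau> \<noteq> 0" "theta_lambda \<tau> \<noteq> 1"
  and one_minus_theta_lambda: "(theta3 0 \<tau>)^4 * (1 - theta_lambda \<tau>) = (theta2 0 \<tau>)^4"
proof -
  note nz = theta_constants_nonzero[OF \<tau>]
  show "theta_lambda \<tau> \<noteq> 0" using nz by (simp add: theta_lambda_def)
  show eq: "(theta3 0 \<tau>)^4 * (1 - theta_lambda \<tau>) = (theta2 0 \<tau>)^4"
  proof -
    have "(theta3 0 \<tau>)^4 * (1 - theta_lambda \<tau>) = (theta3 0 \<tau>)^4 - (theta4 0 \<tau>)^4"
      using nz by (simp add: theta_lambda_def power_divide right_diff_distrib)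
    thus ?thesis unfolding theta_square_relations(3)[OF \<tau>, symmetric] by simp
  qed
  show "theta_lambda \<tau> \<noteq> 1" using eq nz by auto
qed

lemma ell_U_minus:
  assumes "theta1 z \<tau> \<noteq> 0"
  shows "ell_U z \<tau> - 1 = - ((theta2 0 \<tau> / theta3 0 \<tau>)^2 * (theta4 z \<tau> / theta1 z \<tau>)^2)"
    and "ell_U z \<tau> - theta_lambda \<tau> =
           - ((theta4 0 \<tau> * theta2 0 \<tau> / (theta3 0 \<tau>)^2)^2 * (theta3 z \<tau> / theta1 z \<tau>)^2)"
proof -
  note nz = theta_constants_nonzero[OF \<tau>]
  have alg1: "- ((b / a) * (y / x)) - 1 = - ((c / a) * (v / x))" if "b * y + a * x = c * v" "a \<noteq> 0" "x \<noteq> 0"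
    for a b c x y v :: complex
  proof -
    have "- ((b / a) * (y / x)) - 1 = - ((b * y + a * x) / (a * x))"
      using that(2,3) by (simp add: field_simps)
    thus ?thesis unfolding that(1) by simp
  qed
  have alg2: "- ((b / a) * (y / x)) - (b / a)^2 = - ((b * c / a^2) * (v / x))" if "a * y + b * x = c * v" "a \<noteq> 0" "x \<noteq> 0"
    for a b c x y v :: complex
  proof -
    have "- ((b / a) * (y / x)) - (b / a)^2 = - (b * (a * y + b * x) / (a^2 * x))"
      using that(2,3) by (simp add: field_simps power2_eq_square)
    thus ?thesis unfolding that(1) by simp
  qed
  show "ell_U z \<tau> - 1 = - ((theta2 0 \<tau> / theta3 0 \<tau>)^2 * (theta4 z \<tau> / theta1 z \<tau>)^2)"
    unfolding ell_U_def power_divide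
    by (rule alg1[OF theta_square_relations(1)[OF \<tau>]]) (use nz assms in auto)
  have 4: "w^4 = (w^2)^2" for w :: complex by simp
  show "ell_U z \<tau> - theta_lambda \<tau> =
           - ((theta4 0 \<tau> * theta2 0 \<tau> / (theta3 0 \<tau>)^2)^2 * (theta3 z \<tau> / theta1 z \<tau>)^2)"
    unfolding ell_U_def theta_lambda_def 4 power_divide power_mult_distrib
    by (rule alg2[unfolded power_divide, OF theta_square_relations(2)[OF \<tau>]]) (use nz assms in auto)
qed

text \<open>Each of \<open>U\<close>, \<open>U - 1\<close> and \<open>U - theta_lambda \<tau>\<close> is a constant times a square of a quotient of theta
  functions, and \<open>V\<close> contains the product of the three quotients.\<close>

lemma ell_V_squared:
  assumes "theta1 z \<tau> \<noteq> 0"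
  shows "(ell_V z \<tau>)^2 = - 4 * of_real pi ^ 2 * (theta3 0 \<tau>)^4 *
           (ell_U z \<tau> * (ell_U z \<tau> - 1) * (ell_U z \<tau> - theta_lambda \<tau>))"
proof -
  have alg: "(2 * p * (d / c)^2 * b^2 * (x2 * x3 * x4) / x1^3)^2 =
     - 4 * p^2 * c^4 * (- ((d/c)^2 * (x2/x1)^2) * (- ((b/c)^2 * (x4/x1)^2)) * (- ((d * b / c^2)^2 * (x3/x1)^2)))"
    if "c \<noteq> 0" "x1 \<noteq> 0" for p b c d x1 x2 x3 x4 :: complex
    using that by (simp add: field_simps power2_eq_square power3_eq_cube power4_eq_xxxx)
  show ?thesis
    unfolding ell_U_minus[OF assms] unfolding ell_V_def ell_U_def
    by (rule alg) (use theta_constants_nonzero[OF \<tau>] assms in auto)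
qed

lemma theta_log_derivatives_difference:
  assumes "theta1 z \<tau> \<noteq> 0" "theta2 z \<tau> \<noteq> 0"
  shows "theta2_deriv 1 z \<tau> / theta2 z \<tau> - theta1_deriv 1 z \<tau> / theta1 z \<tau> = ell_V z \<tau> / (2 * ell_U z \<tau>)"
proof -
  have "theta2_deriv 1 z \<tau> / theta2 z \<tau> - theta1_deriv 1 z \<tau> / theta1 z \<tau> =
     - (theta1_deriv 1 z \<tau> * theta2 z \<tau> - theta1 z \<tau> * theta2_deriv 1 z \<tau>) / (theta1 z \<tau> * theta2 z \<tau>)"
    using assms by (simp add: field_simps)
  also have "\<dots> = ell_V z \<tau> / (2 * ell_U z \<tau>)"
  proof -
    have alg: "- (p * b^2 * x3 * x4) / (x1 * x2) = (2 * p * m^2 * b^2 * (x2 * x3 * x4) / x1^3) / (2 * (- (m^2 * (x2 / x1)^2)))"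
      if "m \<noteq> 0" "x1 \<noteq> 0" "x2 \<noteq> 0" for p b m x1 x2 x3 x4 :: complex
      using that by (simp add: field_simps power2_eq_square power3_eq_cube)
    show ?thesis
      unfolding theta1_theta2_wronskian[OF \<tau>] ell_V_def ell_U_def
      by (rule alg) (use theta_constants_nonzero[OF \<tau>] assms in auto)
  qed
  finally show ?thesis .
qed

lemma ell_U_DERIV:
  assumes "theta1 z \<tau> \<noteq> 0"
  shows "((\<lambda>z. ell_U z \<tau>) has_field_derivative ell_V z \<tau>) (at z)"
proof -
  have r: "((\<lambda>z. theta2 z \<tau> / theta1 z \<tau>) has_field_derivative
     (theta2_deriv 1 z \<tau> * theta1 z \<tau> - theta2 z \<tau> * theta1_deriv 1 z \<tau>) / (theta1 z \<tau> * theta1 z \<tau>)) (at z)"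
    using DERIV_divide[OF theta_derivs_DERIV_at(2)[OF \<tau>, of 0 z UNIV] theta_derivs_DERIV_at(1)[OF \<tau>, of 0 z UNIV]] assms
    by simp
  also have "(theta2_deriv 1 z \<tau> * theta1 z \<tau> - theta2 z \<tau> * theta1_deriv 1 z \<tau>) =
     - (of_real pi * (theta2 0 \<tau>)^2 * theta3 z \<tau> * theta4 z \<tau>)"
    using theta1_theta2_wronskian[OF \<tau>, of z] by (simp add: algebra_simps)
  finally have r: "((\<lambda>z. theta2 z \<tau> / theta1 z \<tau>) has_field_derivative
     (- (of_real pi * (theta2 0 \<tau>)^2 * theta3 z \<tau> * theta4 z \<tau>)) / (theta1 z \<tau> * theta1 z \<tau>)) (at z)" .
  have alg: "- (m * (of_nat 2 * (- (p * b * x3 * x4) / (x1 * x1) * (x2 / x1) ^ (2 - Suc 0)))) = 2 * p * m * b * (x2 * x3 * x4) / x1^3"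
    if "x1 \<noteq> 0" for p b m x1 x2 x3 x4 :: complex
    using that by (simp add: field_simps power3_eq_cube)
  have "((\<lambda>z. ell_U z \<tau>) has_field_derivative - ((theta4 0 \<tau> / theta3 0 \<tau>)^2 * (of_nat 2 * ((- (of_real pi * (theta2 0 \<tau>)^2 * theta3 z \<tau> * theta4 z \<tau>)) / (theta1 z \<tau> * theta1 z \<tau>)
         * (theta2 z \<tau> / theta1 z \<tau>) ^ (2 - Suc 0))))) (at z)"
    unfolding ell_U_def by (intro DERIV_minus DERIV_cmult DERIV_power r)
  thus ?thesis unfolding alg[OF assms] ell_V_def .
qed

text \<open>The following relations express differences of second logarithmic derivatives through \<open>U\<close>; they
  eliminate every quantity that is not an algebraic function of \<open>U\<close> and the modulus.\<close>

text \<open>At \<open>z = 0\<close> the second logarithmic derivative of \<open>\<theta>\<^sub>1\<close> has the numerator \<open>- \<theta>\<^sub>1'(0)\<^sup>2\<close>, to which the Jacobi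
  formula applies. This determinant of doubled constants is the only one that occurs in the relations below.\<close>

lemma jacobi_derivative_in_doubled_constants:
  "theta2 0 (2*\<tau>) * theta3_deriv 2 0 (2*\<tau>) - theta3 0 (2*\<tau>) * theta2_deriv 2 0 (2*\<tau>)
     = of_real pi ^ 2 * (theta2 0 \<tau>)^2 * (theta3 0 \<tau>)^2 * (theta4 0 \<tau>)^2 / 2"
proof -
  have "(theta1_deriv 1 0 \<tau>)^2 = 2 * (theta2 0 (2*\<tau>) * theta3_deriv 2 0 (2*\<tau>) - theta3 0 (2*\<tau>) * theta2_deriv 2 0 (2*\<tau>))"
    using theta_second_log_derivatives(1)[OF \<tau>, of 0] by (simp add: algebra_simps)
  thus ?thesis unfolding jacobi_derivative_formula[OF \<tau>] by (simp add: power_mult_distrib)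
qed

lemma theta_constants_second_derivatives:
  "theta3_deriv 2 0 \<tau> / theta3 0 \<tau> = 2 * (theta3 0 (2*\<tau>) * theta3_deriv 2 0 (2*\<tau>) + theta2 0 (2*\<tau>) * theta2_deriv 2 0 (2*\<tau>)) / (theta3 0 \<tau>)^2"
  "theta4_deriv 2 0 \<tau> / theta4 0 \<tau> = 2 * (theta3 0 (2*\<tau>) * theta3_deriv 2 0 (2*\<tau>) - theta2 0 (2*\<tau>) * theta2_deriv 2 0 (2*\<tau>)) / (theta4 0 \<tau>)^2"
  using theta_second_log_derivatives(3,4)[OF \<tau>, of 0] theta3_deriv_at_0[OF \<tau>] theta4_deriv_at_0[OF \<tau>]
    theta_constants_nonzero[OF \<tau>]
  by (simp_all add: field_simps power2_eq_square)

lemma theta4_theta3_second_derivatives: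
  "theta4_deriv 2 0 \<tau> / theta4 0 \<tau> - theta3_deriv 2 0 \<tau> / theta3 0 \<tau> = of_real pi ^ 2 * (theta2 0 \<tau>)^4"
proof -
  define p q p2 q2 where "p = theta3 0 (2*\<tau>)" "q = theta2 0 (2*\<tau>)" "p2 = theta3_deriv 2 0 (2*\<tau>)" "q2 = theta2_deriv 2 0 (2*\<tau>)"
  note d = this
  define b c e where "b = (theta2 0 \<tau>)^2" "c = (theta3 0 \<tau>)^2" "e = (theta4 0 \<tau>)^2"
  note d2 = this
  have nz: "c \<noteq> 0" "e \<noteq> 0" using theta_constants_nonzero[OF \<tau>] by (simp_all add: d2)
  have b: "b = 2 * q * p" and c: "c = p^2 + q^2" and e: "e = p^2 - q^2"
    using theta_constants_squares[OF \<tau>] by (simp_all add: d d2)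
  have J: "q * p2 - p * q2 = of_real pi ^ 2 * b * c * e / 2"
    using jacobi_derivative_in_doubled_constants by (simp add: d d2)
  have "2 * (p * p2 - q * q2) / e - 2 * (p * p2 + q * q2) / c =
        2 * ((p * p2 - q * q2) * c - (p * p2 + q * q2) * e) / (c * e)"
    using nz by (simp add: field_simps)
  also have "(p * p2 - q * q2) * c - (p * p2 + q * q2) * e = (2 * q * p) * (q * p2 - p * q2)"
    unfolding c e by (simp add: algebra_simps power2_eq_square)
  also have "\<dots> = b * (of_real pi ^ 2 * b * c * e / 2)" unfolding J b ..
  also have "2 * (b * (of_real pi ^ 2 * b * c * e / 2)) / (c * e) = of_real pi ^ 2 * b^2"
    using nz by (simp add: power2_eq_square)
  finally show ?thesis
    unfolding theta_constants_second_derivatives by (simp add: d d2)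
qed

lemma theta1_theta3_second_derivatives:
  assumes "theta1 z \<tau> \<noteq> 0"
  shows "theta1_deriv 2 z \<tau> / theta1 z \<tau> - (theta1_deriv 1 z \<tau> / theta1 z \<tau>)^2 - theta3_deriv 2 0 \<tau> / theta3 0 \<tau> =
     of_real pi ^ 2 * (theta3 0 \<tau>)^4 * (ell_U z \<tau> - theta_lambda \<tau>)"
proof -
  define p q p2 q2 where "p = theta3 0 (2*\<tau>)" "q = theta2 0 (2*\<tau>)" "p2 = theta3_deriv 2 0 (2*\<tau>)" "q2 = theta2_deriv 2 0 (2*\<tau>)"
  note d = this
  define P Q where "P = theta3 (2*z) (2*\<tau>)" "Q = theta2 (2*z) (2*\<tau>)"
  note d3 = this
  define b c e where "b = (theta2 0 \<tau>)^2" "c = (theta3 0 \<tau>)^2" "e = (theta4 0 \<tau>)^2"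
  note d2 = this
  define s1 s3 where "s1 = (theta1 z \<tau>)^2" "s3 = (theta3 z \<tau>)^2"
  note d4 = this
  have nz: "c \<noteq> 0" "s1 \<noteq> 0" using theta_constants_nonzero[OF \<tau>] assms by (simp_all add: d2 d4)
  have c: "c = p^2 + q^2" and s1: "s1 = q * P - p * Q" and s3: "s3 = p * P + q * Q"
    using theta_constants_squares[OF \<tau>] theta_squares[OF \<tau>, of z] by (simp_all add: d d2 d3 d4)
  have J: "q * p2 - p * q2 = of_real pi ^ 2 * b * c * e / 2"
    using jacobi_derivative_in_doubled_constants by (simp add: d d2)
  have "theta1_deriv 2 z \<tau> / theta1 z \<tau> - (theta1_deriv 1 z \<tau> / theta1 z \<tau>)^2 =
     (theta1_deriv 2 z \<tau> * theta1 z \<tau> - (theta1_deriv 1 z \<tau>)^2) / s1"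
    using assms by (simp add: d4 field_simps power2_eq_square)
  also have "\<dots> = 2 * (P * q2 - Q * p2) / s1"
    unfolding theta_second_log_derivatives(1)[OF \<tau>] d d3 ..
  finally have 1: "theta1_deriv 2 z \<tau> / theta1 z \<tau> - (theta1_deriv 1 z \<tau> / theta1 z \<tau>)^2 = 2 * (P * q2 - Q * p2) / s1" .
  have "2 * (P * q2 - Q * p2) / s1 - 2 * (p * p2 + q * q2) / c = 2 * ((P * q2 - Q * p2) * c - (p * p2 + q * q2) * s1) / (s1 * c)"
    using nz by (simp add: field_simps)
  also have "(P * q2 - Q * p2) * c - (p * p2 + q * q2) * s1 = - (s3 * (q * p2 - p * q2))"
    unfolding c s1 s3 by (simp add: algebra_simps power2_eq_square)
  also have "2 * - (s3 * (q * p2 - p * q2)) / (s1 * c) = - (of_real pi ^ 2 * b * e * s3 / s1)"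
    unfolding J using nz by simp
  finally have 2: "theta1_deriv 2 z \<tau> / theta1 z \<tau> - (theta1_deriv 1 z \<tau> / theta1 z \<tau>)^2 - theta3_deriv 2 0 \<tau> / theta3 0 \<tau> =
     - (of_real pi ^ 2 * b * e * s3 / s1)"
    unfolding 1 theta_constants_second_derivatives(1) by (simp add: d d2)
  have "of_real pi ^ 2 * (theta3 0 \<tau>)^4 * (- ((e * b / c^2) * (s3 / s1))) = - (of_real pi ^ 2 * b * e * s3 / s1)"
    using nz by (simp add: d2 field_simps power2_eq_square power4_eq_xxxx)
  thus ?thesis unfolding 2 ell_U_minus(2)[OF assms] d2 d4 by (simp add: power_divide power_mult_distrib)
qed

lemma theta2_theta1_second_derivatives:
  assumes "theta1 z \<tau> \<noteq> 0" "theta2 z \<tau> \<noteq> 0"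
  shows "theta2_deriv 2 z \<tau> / theta2 z \<tau> - (theta2_deriv 1 z \<tau> / theta2 z \<tau>)^2
       - (theta1_deriv 2 z \<tau> / theta1 z \<tau> - (theta1_deriv 1 z \<tau> / theta1 z \<tau>)^2) =
     of_real pi ^ 2 * (theta3 0 \<tau>)^4 * (theta_lambda \<tau> / ell_U z \<tau> - ell_U z \<tau>)"
proof -
  define p q p2 q2 where "p = theta3 0 (2*\<tau>)" "q = theta2 0 (2*\<tau>)" "p2 = theta3_deriv 2 0 (2*\<tau>)" "q2 = theta2_deriv 2 0 (2*\<tau>)"
  note d = this
  define P Q where "P = theta3 (2*z) (2*\<tau>)" "Q = theta2 (2*z) (2*\<tau>)"
  note d3 = this
  define b c e where "b = (theta2 0 \<tau>)^2" "c = (theta3 0 \<tau>)^2" "e = (theta4 0 \<tau>)^2"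
  note d2 = this
  define s1 s2 where "s1 = (theta1 z \<tau>)^2" "s2 = (theta2 z \<tau>)^2"
  note d4 = this
  have nz: "b \<noteq> 0" "c \<noteq> 0" "e \<noteq> 0" "s1 \<noteq> 0" "s2 \<noteq> 0"
    using theta_constants_nonzero[OF \<tau>] assms by (simp_all add: d2 d4)
  have b: "b = 2 * q * p" and s1: "s1 = q * P - p * Q" and s2: "s2 = p * Q + q * P"
    using theta_constants_squares[OF \<tau>] theta_squares[OF \<tau>, of z] by (simp_all add: d d2 d3 d4)
  have J: "q * p2 - p * q2 = of_real pi ^ 2 * b * c * e / 2"
    using jacobi_derivative_in_doubled_constants by (simp add: d d2)
  have 1: "theta1_deriv 2 z \<tau> / theta1 z \<tau> - (theta1_deriv 1 z \<tau> / theta1 z \<tau>)^2 = 2 * (P * q2 - Q * p2) / s1"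
    using theta_second_log_derivatives(1)[OF \<tau>, of z] assms nz
    by (simp add: d d3 d4 field_simps power2_eq_square)
  have 2: "theta2_deriv 2 z \<tau> / theta2 z \<tau> - (theta2_deriv 1 z \<tau> / theta2 z \<tau>)^2 = 2 * (Q * p2 + P * q2) / s2"
    using theta_second_log_derivatives(2)[OF \<tau>, of z] assms nz
    by (simp add: d d3 d4 field_simps power2_eq_square)
  have "2 * (Q * p2 + P * q2) / s2 - 2 * (P * q2 - Q * p2) / s1 =
     2 * ((Q * p2 + P * q2) * s1 - (P * q2 - Q * p2) * s2) / (s1 * s2)"
    using nz by (simp add: field_simps)
  also have "(Q * p2 + P * q2) * s1 - (P * q2 - Q * p2) * s2 = 2 * P * Q * (q * p2 - p * q2)"
    unfolding s1 s2 by (simp add: algebra_simps)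
  also have "\<dots> = (4 * (q * p) * (P * Q)) * (of_real pi ^ 2 * c * e / 2)"
    unfolding J b by simp
  also have "4 * (q * p) * (P * Q) = s2^2 - s1^2"
    unfolding s1 s2 by (simp add: algebra_simps power2_eq_square)
  also have "2 * ((s2^2 - s1^2) * (of_real pi ^ 2 * c * e / 2)) / (s1 * s2) = of_real pi ^ 2 * c * e * (s2 / s1 - s1 / s2)"
    using nz by (simp add: field_simps power2_eq_square)
  also have "\<dots> = of_real pi ^ 2 * c^2 * ((e / c)^2 / (- ((e / c) * (s2 / s1))) - (- ((e / c) * (s2 / s1))))"
    using nz by (simp add: field_simps power2_eq_square)
  finally show ?thesis unfolding 1 2 ell_U_def theta_lambda_def d2 d4
    by (simp add: power_divide)
qed

text \<open>The derivative with respect to \<open>z\<close> of the relation between the second logarithmic derivative of \<open>\<theta>\<^sub>1\<close> and \<open>U\<close>.\<close>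

lemma theta1_third_log_derivative:
  assumes "theta1 z \<tau> \<noteq> 0"
  shows "theta1_deriv 3 z \<tau> / theta1 z \<tau> - 3 * theta1_deriv 2 z \<tau> * theta1_deriv 1 z \<tau> / (theta1 z \<tau>)^2
           + 2 * (theta1_deriv 1 z \<tau> / theta1 z \<tau>)^3 = of_real pi ^ 2 * (theta3 0 \<tau>)^4 * ell_V z \<tau>"
proof -
  let ?L = "\<lambda>z. theta1_deriv 2 z \<tau> / theta1 z \<tau> - (theta1_deriv 1 z \<tau> / theta1 z \<tau>)^2"
  have "((\<lambda>z. theta1_deriv 2 z \<tau> / theta1_deriv 0 z \<tau>) has_field_derivative
     ((theta1_deriv (Suc 2) z \<tau> * theta1_deriv 0 z \<tau> - theta1_deriv 2 z \<tau> * theta1_deriv (Suc 0) z \<tau>)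
       / (theta1_deriv 0 z \<tau> * theta1_deriv 0 z \<tau>))) (at z)"
    by (rule DERIV_divide[OF theta_derivs_DERIV_at(1)[OF \<tau>] theta_derivs_DERIV_at(1)[OF \<tau>]]) (use assms in simp)
  from DERIV_diff[OF this DERIV_power[OF theta1_log_derivative_DERIV[OF \<tau> assms], of 2]]
  have "(?L has_field_derivative
     ((theta1_deriv 3 z \<tau> * theta1 z \<tau> - theta1_deriv 2 z \<tau> * theta1_deriv 1 z \<tau>) / (theta1 z \<tau> * theta1 z \<tau>)
       - of_nat 2 * (?L z * (theta1_deriv 1 z \<tau> / theta1 z \<tau>) ^ (2 - Suc 0)))) (at z)"
    by (simp add: numeral_3_eq_3 numeral_2_eq_2)
  also have "(theta1_deriv 3 z \<tau> * theta1 z \<tau> - theta1_deriv 2 z \<tau> * theta1_deriv 1 z \<tau>) / (theta1 z \<tau> * theta1 z \<tau>)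
       - of_nat 2 * (?L z * (theta1_deriv 1 z \<tau> / theta1 z \<tau>) ^ (2 - Suc 0))
     = theta1_deriv 3 z \<tau> / theta1 z \<tau> - 3 * theta1_deriv 2 z \<tau> * theta1_deriv 1 z \<tau> / (theta1 z \<tau>)^2
           + 2 * (theta1_deriv 1 z \<tau> / theta1 z \<tau>)^3"
  proof -
    have "(t3 * t0 - t2 * t1) / (t0 * t0) - of_nat 2 * ((t2 / t0 - (t1 / t0)^2) * (t1 / t0) ^ (2 - Suc 0))
       = t3 / t0 - 3 * t2 * t1 / t0^2 + 2 * (t1 / t0)^3" if "t0 \<noteq> 0" for t0 t1 t2 t3 :: complex
      using that by (simp add: field_simps power2_eq_square power3_eq_cube)
    thus ?thesis using assms by blast
  qed
  finally have 1: "(?L has_field_derivative theta1_deriv 3 z \<tau> / theta1 z \<tau> - 3 * theta1_deriv 2 z \<tau> * theta1_deriv 1 z \<tau> / (theta1 z \<tau>)^2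
           + 2 * (theta1_deriv 1 z \<tau> / theta1 z \<tau>)^3) (at z)" .
  have "((\<lambda>z. theta3_deriv 2 0 \<tau> / theta3 0 \<tau> + of_real pi ^ 2 * (theta3 0 \<tau>)^4 * (ell_U z \<tau> - theta_lambda \<tau>))
     has_field_derivative (0 + of_real pi ^ 2 * (theta3 0 \<tau>)^4 * (ell_V z \<tau> - 0))) (at z)"
    by (intro DERIV_add DERIV_const DERIV_cmult DERIV_diff ell_U_DERIV assms)
  moreover have "\<forall>\<^sub>F z in nhds z. ?L z = theta3_deriv 2 0 \<tau> / theta3 0 \<tau> + of_real pi ^ 2 * (theta3 0 \<tau>)^4 * (ell_U z \<tau> - theta_lambda \<tau>)"
  proof -
    have "\<forall>\<^sub>F z in nhds z. z \<in> {z. theta1 z \<tau> \<noteq> 0}"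
      by (rule eventually_nhds_in_open[OF open_theta1_nonzero[OF \<tau>]]) (use assms in simp)
    thus ?thesis
    proof eventually_elim
      case (elim z)
      hence "theta1 z \<tau> \<noteq> 0" by simp
      from theta1_theta3_second_derivatives[OF this] show ?case by (simp add: algebra_simps)
    qed
  qed
  ultimately have "(?L has_field_derivative of_real pi ^ 2 * (theta3 0 \<tau>)^4 * ell_V z \<tau>) (at z)"
    by (subst DERIV_cong_ev[OF refl _ refl]) auto
  from DERIV_unique[OF 1 this] show ?thesis .
qed

end

text \<open>The computation behind \<open>theta_ratio_DERIV\<close>: \<open>g\<close> and \<open>D\<close> stand for the differences of the first and of the second
  logarithmic derivatives of \<open>\<theta>\<^sub>2\<close> and \<open>\<theta>\<^sub>1\<close>, \<open>l1\<close> for the logarithmic derivative of \<open>\<theta>\<^sub>1\<close>, and \<open>z\<close> for \<open>\<zeta>\<close>.\<close>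

lemma theta_log_ratio_flow_algebra:
  fixes p E U V l0 l1 g D a z x :: complex
  assumes p: "p \<noteq> 0" and U: "U \<noteq> 0"
    and V2: "V^2 = - 4 * p^2 * E * (U * (U - 1) * (U - x))"
    and g: "g = V / (2 * U)" and D: "D = p^2 * E * (x / U - U)"
    and z: "z = l1 + 2 * p * \<i> * a"
  shows "a * g + (D + g * (g + 2 * l1)) / (4 * p * \<i>) =
           (p^2 * E * (1 + x - 2 * U) + z * V / U) / (4 * p * \<i>)"
proof -
  have g2: "g^2 = - (p^2 * E * ((U - 1) * (U - x)) / U)"
    unfolding g power_divide V2 using U by (simp add: power2_eq_square)
  have "a * g = 4 * p * \<i> * a * g / (4 * p * \<i>)" using p by simp
  hence "a * g + (D + g * (g + 2 * l1)) / (4 * p * \<i>) = (D + g^2 + 2 * g * (l1 + 2 * p * \<i> * a)) / (4 * p * \<i>)"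
    by (simp add: add_divide_distrib power2_eq_square algebra_simps)
  also have "D + g^2 = p^2 * E * (1 + x - 2 * U)"
    unfolding D g2 using U by (simp add: field_simps power2_eq_square)
  also have "2 * g * (l1 + 2 * p * \<i> * a) = z * V / U" unfolding g z using U by simp
  finally show ?thesis .
qed

text \<open>Along the line \<open>z = a \<tau> + b\<close> the logarithmic derivative \<open>\<theta>\<^sub>1' / \<theta>\<^sub>1\<close> enters the flow of \<open>U\<close> only through
  \<open>\<zeta> = \<theta>\<^sub>1' / \<theta>\<^sub>1 + 2 \<pi> \<i> a\<close>, because the heat equation contributes \<open>\<theta>\<^sub>1' / (2 \<pi> \<i> \<theta>\<^sub>1)\<close> and the slope contributes \<open>a\<close>.
  The function \<open>u\<close> is Picard's solution of the sixth Painleve equation with \<open>\<alpha> = \<beta> = \<gamma> = \<delta> = 0\<close>, and \<open>y\<close> is its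
  image under an Okamoto transformation. A value of \<open>\<tau>\<close> is regular if \<open>z\<close> is not a half period.\<close>

locale theta_line =
  fixes a b :: complex
begin

definition u :: "complex \<Rightarrow> complex" where "u \<tau> = ell_U (a * \<tau> + b) \<tau>"
definition v :: "complex \<Rightarrow> complex" where "v \<tau> = ell_V (a * \<tau> + b) \<tau>"
definition zet :: "complex \<Rightarrow> complex" where
  "zet \<tau> = theta1_deriv 1 (a * \<tau> + b) \<tau> / theta1 (a * \<tau> + b) \<tau> + 2 * of_real pi * \<i> * a"
definition y :: "complex \<Rightarrow> complex" where "y \<tau> = u \<tau> + v \<tau> / (2 * zet \<tau>)"

definition regular :: "complex \<Rightarrow> bool" where
  "regular \<tau> \<longleftrightarrow> Im \<tau> > 0 \<and> theta1 (a * \<tau> + b) \<tau> \<noteq> 0 \<and> theta2 (a * \<tau> + b) \<tau> \<noteq> 0 \<and>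
     theta3 (a * \<tau> + b) \<tau> \<noteq> 0 \<and> theta4 (a * \<tau> + b) \<tau> \<noteq> 0"

lemma theta_constants_DERIV:
  assumes \<tau>: "Im \<tau> > 0"
  shows "((\<lambda>t. theta3 0 t) has_field_derivative theta3_deriv 2 0 \<tau> / (4 * of_real pi * \<i>)) (at \<tau>)"
    and "((\<lambda>t. theta4 0 t) has_field_derivative theta4_deriv 2 0 \<tau> / (4 * of_real pi * \<i>)) (at \<tau>)"
    and "((\<lambda>t. theta2 0 t) has_field_derivative theta2_deriv 2 0 \<tau> / (4 * of_real pi * \<i>)) (at \<tau>)"
  using theta_derivs_along_line(3)[OF \<tau>, of 0 0 0] theta_derivs_along_line(4)[OF \<tau>, of 0 0 0]
    theta_derivs_along_line(2)[OF \<tau>, of 0 0 0]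
  by (simp_all add: numeral_2_eq_2)

lemma theta_constants_ratio_DERIV:
  assumes \<tau>: "Im \<tau> > 0"
  shows "((\<lambda>t. theta4 0 t / theta3 0 t) has_field_derivative
            (theta4 0 \<tau> / theta3 0 \<tau>) * (- (of_real pi * \<i> / 4) * (theta2 0 \<tau>)^4)) (at \<tau>)"
proof -
  note nz = theta_constants_nonzero[OF \<tau>]
  from DERIV_divide[OF theta_constants_DERIV(2,1)[OF \<tau>] nz(2)]
  have "((\<lambda>t. theta4 0 t / theta3 0 t) has_field_derivative
     (theta4_deriv 2 0 \<tau> / (4 * of_real pi * \<i>) * theta3 0 \<tau> - theta4 0 \<tau> * (theta3_deriv 2 0 \<tau> / (4 * of_real pi * \<i>)))
       / (theta3 0 \<tau> * theta3 0 \<tau>)) (at \<tau>)" .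
  also have "(theta4_deriv 2 0 \<tau> / (4 * of_real pi * \<i>) * theta3 0 \<tau> - theta4 0 \<tau> * (theta3_deriv 2 0 \<tau> / (4 * of_real pi * \<i>)))
       / (theta3 0 \<tau> * theta3 0 \<tau>) =
     (theta4 0 \<tau> / theta3 0 \<tau>) * ((theta4_deriv 2 0 \<tau> / theta4 0 \<tau> - theta3_deriv 2 0 \<tau> / theta3 0 \<tau>) / (4 * of_real pi * \<i>))"
    using nz by (simp add: field_simps)
  also have "(theta4_deriv 2 0 \<tau> / theta4 0 \<tau> - theta3_deriv 2 0 \<tau> / theta3 0 \<tau>) / (4 * of_real pi * \<i>)
      = - (of_real pi * \<i> / 4) * (theta2 0 \<tau>)^4"
    unfolding theta4_theta3_second_derivatives[OF \<tau>] by (simp add: field_simps power2_eq_square)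
  finally show ?thesis .
qed

text \<open>The logarithmic derivative of \<open>\<theta>\<^sub>4(0) / \<theta>\<^sub>3(0)\<close> is a quarter of that of \<open>theta_lambda\<close>, and
  \<open>\<theta>\<^sub>2\<^sup>4 = \<theta>\<^sub>3\<^sup>4 (1 - theta_lambda)\<close>.\<close>

lemma theta_lambda_DERIV:
  assumes \<tau>: "Im \<tau> > 0"
  shows "(theta_lambda has_field_derivative
            - of_real pi * \<i> * (theta3 0 \<tau>)^4 * (theta_lambda \<tau> * (1 - theta_lambda \<tau>))) (at \<tau>)"
proof -
  have "((\<lambda>t. (theta4 0 t / theta3 0 t)^4) has_field_derivative
     of_nat 4 * ((theta4 0 \<tau> / theta3 0 \<tau>) * (- (of_real pi * \<i> / 4) * (theta2 0 \<tau>)^4) * (theta4 0 \<tau> / theta3 0 \<tau>)^(4 - Suc 0))) (at \<tau>)"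
    by (rule DERIV_power[OF theta_constants_ratio_DERIV[OF \<tau>]])
  moreover have "of_nat 4 * ((theta4 0 \<tau> / theta3 0 \<tau>) * (- (of_real pi * \<i> / 4) * (theta2 0 \<tau>)^4) * (theta4 0 \<tau> / theta3 0 \<tau>)^(4 - Suc 0))
     = - of_real pi * \<i> * (theta_lambda \<tau> * (theta2 0 \<tau>)^4)"
    by (simp add: theta_lambda_def power4_eq_xxxx power3_eq_cube numeral_3_eq_3 mult_ac)
  ultimately show ?thesis
    unfolding one_minus_theta_lambda[OF \<tau>, symmetric] theta_lambda_def[abs_def] by (simp add: mult_ac)
qed

context
  fixes \<tau> :: complex
  assumes reg: "regular \<tau>"
begin

lemma \<tau>: "Im \<tau> > 0" and nz: "theta1 (a * \<tau> + b) \<tau> \<noteq> 0" "theta2 (a * \<tau> + b) \<tau> \<noteq> 0"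
     "theta3 (a * \<tau> + b) \<tau> \<noteq> 0" "theta4 (a * \<tau> + b) \<tau> \<noteq> 0"
  using reg by (auto simp: regular_def)

lemma u_nonzero: "u \<tau> \<noteq> 0" "u \<tau> - 1 \<noteq> 0" "u \<tau> - theta_lambda \<tau> \<noteq> 0" and v_nonzero: "v \<tau> \<noteq> 0"
proof -
  note c = theta_constants_nonzero[OF \<tau>]
  show "u \<tau> - 1 \<noteq> 0" "u \<tau> - theta_lambda \<tau> \<noteq> 0"
    unfolding u_def ell_U_minus[OF \<tau> nz(1)] using c nz by auto
  show "u \<tau> \<noteq> 0" "v \<tau> \<noteq> 0" unfolding u_def v_def ell_U_def ell_V_def using c nz by auto
qed

lemma v_squared: "(v \<tau>)^2 = - 4 * of_real pi ^ 2 * (theta3 0 \<tau>)^4 * (u \<tau> * (u \<tau> - 1) * (u \<tau> - theta_lambda \<tau>))"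
  unfolding u_def v_def by (rule ell_V_squared[OF \<tau> nz(1)])

lemma theta_ratio_DERIV:
  "((\<lambda>t. theta2 (a * t + b) t / theta1 (a * t + b) t) has_field_derivative
      (theta2 (a * \<tau> + b) \<tau> / theta1 (a * \<tau> + b) \<tau>) *
      ((of_real pi ^ 2 * (theta3 0 \<tau>)^4 * (1 + theta_lambda \<tau> - 2 * u \<tau>) + zet \<tau> * v \<tau> / u \<tau>) / (4 * of_real pi * \<i>))) (at \<tau>)"
proof -
  let ?z = "a * \<tau> + b"
  let ?pi = "4 * of_real pi * \<i> :: complex"
  define t1 d1 e1 t2 d2 e2 where "t1 = theta1 ?z \<tau>" "d1 = theta1_deriv 1 ?z \<tau>" "e1 = theta1_deriv 2 ?z \<tau>"
    "t2 = theta2 ?z \<tau>" "d2 = theta2_deriv 1 ?z \<tau>" "e2 = theta2_deriv 2 ?z \<tau>"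
  note d = this
  have nz': "t1 \<noteq> 0" "t2 \<noteq> 0" using nz by (simp_all add: d)
  have 1: "((\<lambda>t. theta1 (a * t + b) t) has_field_derivative (a * d1 + e1 / ?pi)) (at \<tau>)"
    and 2: "((\<lambda>t. theta2 (a * t + b) t) has_field_derivative (a * d2 + e2 / ?pi)) (at \<tau>)"
    using theta_derivs_along_line(1)[OF \<tau>, of 0 a b] theta_derivs_along_line(2)[OF \<tau>, of 0 a b]
    by (simp_all add: d numeral_2_eq_2)
  from DERIV_divide[OF 2 1 nz(1)]
  have "((\<lambda>t. theta2 (a * t + b) t / theta1 (a * t + b) t) has_field_derivative
     ((a * d2 + e2 / ?pi) * t1 - t2 * (a * d1 + e1 / ?pi)) / (t1 * t1)) (at \<tau>)"
    by (simp add: d)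
  also have "((a * d2 + e2 / ?pi) * t1 - t2 * (a * d1 + e1 / ?pi)) / (t1 * t1) =
     (t2 / t1) * (a * (d2 / t2 - d1 / t1) + (e2 / t2 - e1 / t1) / ?pi)"
    using nz' by (simp add: field_simps)
  also have "e2 / t2 - e1 / t1 =
     ((e2 / t2 - (d2 / t2)^2) - (e1 / t1 - (d1 / t1)^2)) + (d2 / t2 - d1 / t1) * ((d2 / t2 - d1 / t1) + 2 * (d1 / t1))"
    by (simp add: power2_eq_square algebra_simps)
  also have "a * (d2 / t2 - d1 / t1) + (((e2 / t2 - (d2 / t2)^2) - (e1 / t1 - (d1 / t1)^2)) + (d2 / t2 - d1 / t1) * ((d2 / t2 - d1 / t1) + 2 * (d1 / t1))) / ?pi
     = (of_real pi ^ 2 * (theta3 0 \<tau>)^4 * (1 + theta_lambda \<tau> - 2 * u \<tau>) + zet \<tau> * v \<tau> / u \<tau>) / ?pi"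
  proof (rule theta_log_ratio_flow_algebra)
    show "u \<tau> \<noteq> 0" by (rule u_nonzero)
    show "(v \<tau>)^2 = - 4 * of_real pi ^ 2 * (theta3 0 \<tau>)^4 * (u \<tau> * (u \<tau> - 1) * (u \<tau> - theta_lambda \<tau>))"
      by (rule v_squared)
    show "d2 / t2 - d1 / t1 = v \<tau> / (2 * u \<tau>)"
      unfolding d u_def v_def by (rule theta_log_derivatives_difference[OF \<tau> nz(1,2)])
    show "e2 / t2 - (d2 / t2)\<^sup>2 - (e1 / t1 - (d1 / t1)\<^sup>2) = of_real pi ^ 2 * (theta3 0 \<tau>)^4 * (theta_lambda \<tau> / u \<tau> - u \<tau>)"
      unfolding d u_def by (rule theta2_theta1_second_derivatives[OF \<tau> nz(1,2)])
    show "zet \<tau> = d1 / t1 + 2 * of_real pi * \<i> * a" by (simp add: zet_def d)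
  qed simp
  finally show ?thesis by (simp add: d)
qed

lemma u_DERIV:
  "(u has_field_derivative
      (- of_real pi * \<i> * (theta3 0 \<tau>)^4 * (u \<tau> * (1 - u \<tau>)) - \<i> * zet \<tau> * v \<tau> / (2 * of_real pi))) (at \<tau>)"
proof -
  define R where "R = (of_real pi ^ 2 * (theta3 0 \<tau>)^4 * (1 + theta_lambda \<tau> - 2 * u \<tau>) + zet \<tau> * v \<tau> / u \<tau>) / (4 * of_real pi * \<i>)"
  define M where "M = - (of_real pi * \<i> / 4) * (theta2 0 \<tau>)^4"
  define m r where "m = theta4 0 \<tau> / theta3 0 \<tau>" "r = theta2 (a * \<tau> + b) \<tau> / theta1 (a * \<tau> + b) \<tau>"
  have "((\<lambda>t. - ((theta4 0 t / theta3 0 t)^2 * (theta2 (a * t + b) t / theta1 (a * t + b) t)^2)) has_field_derivative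
     - (of_nat 2 * (m * M * m ^ (2 - Suc 0)) * r^2 + of_nat 2 * (r * R * r ^ (2 - Suc 0)) * m^2)) (at \<tau>)"
    unfolding m_r_def
    by (intro DERIV_minus DERIV_mult DERIV_power)
       (use theta_constants_ratio_DERIV[OF \<tau>] theta_ratio_DERIV in \<open>simp_all add: M_def R_def\<close>)
  also have "- (of_nat 2 * (m * M * m ^ (2 - Suc 0)) * r^2 + of_nat 2 * (r * R * r ^ (2 - Suc 0)) * m^2)
     = 2 * u \<tau> * (M + R)"
    unfolding u_def ell_U_def m_r_def[symmetric] by (simp add: power2_eq_square algebra_simps)
  also have "\<dots> = - of_real pi * \<i> * (theta3 0 \<tau>)^4 * (u \<tau> * (1 - u \<tau>)) - \<i> * zet \<tau> * v \<tau> / (2 * of_real pi)"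
  proof -
    have "2 * w * (- (p * \<i> / 4) * (E * (1 - x)) + (p ^ 2 * E * (1 + x - 2 * w) + s * V / w) / (4 * p * \<i>))
        = - p * \<i> * E * (w * (1 - w)) - \<i> * s * V / (2 * p)" if "p \<noteq> 0" "w \<noteq> 0" for p w E x s V :: complex
    proof -
      have i: "1 / (4 * p * \<i>) = - \<i> / (4 * p)" using that by (simp add: field_simps)
      have "(p ^ 2 * E * (1 + x - 2 * w) + s * V / w) / (4 * p * \<i>) = (p ^ 2 * E * (1 + x - 2 * w) + s * V / w) * (1 / (4 * p * \<i>))"
        by simp
      also have "\<dots> = - \<i> * (p * E * (1 + x - 2 * w) / 4 + s * V / (4 * p * w))"
        unfolding i using that by (simp add: field_simps power2_eq_square)
      finally show ?thesis using that by (simp add: field_simps power2_eq_square)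
    qed
    thus ?thesis unfolding M_def R_def one_minus_theta_lambda[OF \<tau>, symmetric] using u_nonzero(1) by simp
  qed
  finally show ?thesis unfolding u_def[abs_def] ell_U_def .
qed

text \<open>The heat equation brings in the third derivative of \<open>\<theta>\<^sub>1\<close> and the slope the second one; they combine to the third logarithmic
  derivative of \<open>\<theta>\<^sub>1\<close>, a multiple of \<open>v\<close>, and to \<open>2 \<zeta>\<close> times the second one.\<close>

lemma zet_DERIV:
  "(zet has_field_derivative
     (of_real pi ^ 2 * (theta3 0 \<tau>)^4 * v \<tau>
       + 2 * zet \<tau> * (theta3_deriv 2 0 \<tau> / theta3 0 \<tau> + of_real pi ^ 2 * (theta3 0 \<tau>)^4 * (u \<tau> - theta_lambda \<tau>)))
       / (4 * of_real pi * \<i>)) (at \<tau>)"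
proof -
  let ?z = "a * \<tau> + b"
  let ?pi = "4 * of_real pi * \<i> :: complex"
  define t0 t1 t2 t3 where "t0 = theta1 ?z \<tau>" "t1 = theta1_deriv 1 ?z \<tau>" "t2 = theta1_deriv 2 ?z \<tau>" "t3 = theta1_deriv 3 ?z \<tau>"
  note d = this
  have nz': "t0 \<noteq> 0" using nz by (simp_all add: d)
  have 1: "((\<lambda>t. theta1 (a * t + b) t) has_field_derivative (a * t1 + t2 / ?pi)) (at \<tau>)"
    and 2: "((\<lambda>t. theta1_deriv 1 (a * t + b) t) has_field_derivative (a * t2 + t3 / ?pi)) (at \<tau>)"
    using theta_derivs_along_line(1)[OF \<tau>, of 0 a b] theta_derivs_along_line(1)[OF \<tau>, of 1 a b]
    by (simp_all add: d numeral_2_eq_2 numeral_3_eq_3)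
  have "(zet has_field_derivative ((a * t2 + t3 / ?pi) * t0 - t1 * (a * t1 + t2 / ?pi)) / (t0 * t0) + 0) (at \<tau>)"
    unfolding zet_def[abs_def] using DERIV_add[OF DERIV_divide[OF 2 1 nz(1)] DERIV_const] unfolding d .
  also have "((a * t2 + t3 / ?pi) * t0 - t1 * (a * t1 + t2 / ?pi)) / (t0 * t0) + 0
     = ((t3 / t0 - 3 * t2 * t1 / t0^2 + 2 * (t1 / t0)^3) + 2 * (t1 / t0 + 2 * of_real pi * \<i> * a) * (t2 / t0 - (t1 / t0)^2)) / ?pi"
  proof -
    have "((a * t2 + t3 / (4 * p)) * t0 - t1 * (a * t1 + t2 / (4 * p))) / (t0 * t0) + 0
     = ((t3 / t0 - 3 * t2 * t1 / t0^2 + 2 * (t1 / t0)^3) + 2 * (t1 / t0 + 2 * p * a) * (t2 / t0 - (t1 / t0)^2)) / (4 * p)"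
      if "p \<noteq> 0" for p :: complex
      using that nz' by (simp add: field_simps power2_eq_square power3_eq_cube)
    from this[of "of_real pi * \<i>"] show ?thesis by (simp add: mult.assoc)
  qed
  also have "t3 / t0 - 3 * t2 * t1 / t0^2 + 2 * (t1 / t0)^3 = of_real pi ^ 2 * (theta3 0 \<tau>)^4 * v \<tau>"
    unfolding d v_def by (rule theta1_third_log_derivative[OF \<tau> nz(1)])
  also have "t2 / t0 - (t1 / t0)^2 = theta3_deriv 2 0 \<tau> / theta3 0 \<tau> + of_real pi ^ 2 * (theta3 0 \<tau>)^4 * (u \<tau> - theta_lambda \<tau>)"
    using theta1_theta3_second_derivatives[OF \<tau> nz(1)] by (simp add: d u_def algebra_simps)
  also have "t1 / t0 + 2 * of_real pi * \<i> * a = zet \<tau>" by (simp add: d zet_def)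
  finally show ?thesis .
qed

lemma theta_line_field_differentiable:
  "(\<lambda>t. theta1 (a * t + b) t) field_differentiable at \<tau>" "(\<lambda>t. theta2 (a * t + b) t) field_differentiable at \<tau>"
  "(\<lambda>t. theta3 (a * t + b) t) field_differentiable at \<tau>" "(\<lambda>t. theta4 (a * t + b) t) field_differentiable at \<tau>"
  unfolding field_differentiable_def using theta_derivs_along_line[OF \<tau>, of 0 a b] by auto

lemma eventually_regular: "\<forall>\<^sub>F t in nhds \<tau>. regular t"
proof -
  have ne: "\<forall>\<^sub>F t in nhds \<tau>. f t \<noteq> 0" if "f field_differentiable at \<tau>" "f \<tau> \<noteq> 0" for f :: "complex \<Rightarrow> complex"
    using field_differentiable_imp_continuous_at[OF that(1)] that(2)
    by (intro tendsto_imp_eventually_ne[of f "f \<tau>"]) (simp_all add: isCont_def tendsto_at_iff_tendsto_nhds)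
  have "\<forall>\<^sub>F t in nhds \<tau>. t \<in> {t. Im t > 0}"
    by (rule eventually_nhds_in_open) (use \<tau> in \<open>auto simp: open_halfspace_Im_gt\<close>)
  thus ?thesis
    using ne[OF theta_line_field_differentiable(1) nz(1)] ne[OF theta_line_field_differentiable(2) nz(2)]
      ne[OF theta_line_field_differentiable(3) nz(3)] ne[OF theta_line_field_differentiable(4) nz(4)]
    by eventually_elim (simp add: regular_def)
qed

lemma v_field_differentiable: "v field_differentiable at \<tau>"
proof -
  have "(\<lambda>t. theta4 0 t) field_differentiable at \<tau>" "(\<lambda>t. theta3 0 t) field_differentiable at \<tau>"
    "(\<lambda>t. theta2 0 t) field_differentiable at \<tau>"
    unfolding field_differentiable_def using theta_constants_DERIV[OF \<tau>] by auto
  thus ?thesis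
    unfolding v_def[abs_def] ell_V_def using nz theta_constants_nonzero[OF \<tau>]
    by (intro field_differentiable_mult field_differentiable_divide field_differentiable_power
         field_differentiable_const theta_line_field_differentiable) auto
qed

end

text \<open>Logarithmic differentiation of \<open>v_squared\<close>. The constant \<open>\<theta>\<^sub>3(0)\<^sup>4\<close> contributes the term with \<open>theta3_deriv 2\<close>.\<close>

lemma v_DERIV:
  fixes u' :: complex
  assumes reg: "regular \<tau>" and u': "(u has_field_derivative u') (at \<tau>)"
  defines "x' \<equiv> - of_real pi * \<i> * (theta3 0 \<tau>)^4 * (theta_lambda \<tau> * (1 - theta_lambda \<tau>))"
  shows "(v has_field_derivative v \<tau> / 2 * (theta3_deriv 2 0 \<tau> / theta3 0 \<tau> / (of_real pi * \<i>)
           + u' / u \<tau> + u' / (u \<tau> - 1) + (u' - x') / (u \<tau> - theta_lambda \<tau>))) (at \<tau>)"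
proof -
  have \<tau>: "Im \<tau> > 0" using reg by (simp add: regular_def)
  note c0 = theta_constants_nonzero[OF \<tau>]
  note un = u_nonzero[OF reg] v_nonzero[OF reg]
  obtain v' where v': "(v has_field_derivative v') (at \<tau>)"
    using v_field_differentiable[OF reg] by (auto simp: field_differentiable_def)
  define E x k where "E = (theta3 0 \<tau>)^4" "x = theta_lambda \<tau>" "k = theta3_deriv 2 0 \<tau> / theta3 0 \<tau> / (of_real pi * \<i>)"
  note d = this
  have E: "((\<lambda>t. (theta3 0 t)^4) has_field_derivative E * k) (at \<tau>)"
  proof -
    have "of_nat 4 * (theta3_deriv 2 0 \<tau> / (4 * of_real pi * \<i>) * (theta3 0 \<tau>)^(4 - Suc 0)) = E * k"
      using c0 by (simp add: d field_simps power4_eq_xxxx power3_eq_cube)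
    with DERIV_power[OF theta_constants_DERIV(1)[OF \<tau>], of 4] show ?thesis by simp
  qed
  have x: "(theta_lambda has_field_derivative x') (at \<tau>)"
    unfolding x'_def by (rule theta_lambda_DERIV[OF \<tau>])
  have C: "((\<lambda>t. u t * (u t - 1) * (u t - theta_lambda t)) has_field_derivative
      (u' * (u \<tau> - 1) + (u' - 0) * u \<tau>) * (u \<tau> - x) + (u' - x') * (u \<tau> * (u \<tau> - 1))) (at \<tau>)"
    unfolding d by (intro DERIV_mult DERIV_diff u' x DERIV_const)
  from DERIV_mult[OF DERIV_cmult[OF E, of "- 4 * of_real pi ^ 2"] C]
  have R: "((\<lambda>t. - 4 * of_real pi ^ 2 * (theta3 0 t)^4 * (u t * (u t - 1) * (u t - theta_lambda t))) has_field_derivative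
     - 4 * of_real pi ^ 2 * (E * k) * (u \<tau> * (u \<tau> - 1) * (u \<tau> - x)) +
     ((u' * (u \<tau> - 1) + (u' - 0) * u \<tau>) * (u \<tau> - x) + (u' - x') * (u \<tau> * (u \<tau> - 1))) * (- 4 * of_real pi ^ 2 * E)) (at \<tau>)"
    unfolding d by simp
  have L: "((\<lambda>t. (v t)^2) has_field_derivative of_nat 2 * (v' * v \<tau> ^ (2 - Suc 0))) (at \<tau>)"
    by (rule DERIV_power[OF v'])
  have ev: "\<forall>\<^sub>F t in nhds \<tau>. (v t)^2 = - 4 * of_real pi ^ 2 * (theta3 0 t)^4 * (u t * (u t - 1) * (u t - theta_lambda t))"
    using eventually_regular[OF reg] by eventually_elim (rule v_squared)
  have "of_nat 2 * (v' * v \<tau> ^ (2 - Suc 0)) = - 4 * of_real pi ^ 2 * (E * k) * (u \<tau> * (u \<tau> - 1) * (u \<tau> - x)) +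
     ((u' * (u \<tau> - 1) + (u' - 0) * u \<tau>) * (u \<tau> - x) + (u' - x') * (u \<tau> * (u \<tau> - 1))) * (- 4 * of_real pi ^ 2 * E)"
    using DERIV_unique[OF L] R unfolding DERIV_cong_ev[OF refl ev refl] by blast
  also have "\<dots> = (- 4 * of_real pi ^ 2 * E * (u \<tau> * (u \<tau> - 1) * (u \<tau> - x))) *
      (k + u' / u \<tau> + u' / (u \<tau> - 1) + (u' - x') / (u \<tau> - x))"
  proof -
    have "c * (E * k) * (U * U1 * U2) + ((p * U1 + (p - 0) * U) * U2 + r * (U * U1)) * (c * E)
        = (c * E * (U * U1 * U2)) * (k + p / U + p / U1 + r / U2)"
      if "U \<noteq> 0" "U1 \<noteq> 0" "U2 \<noteq> 0" for c E k p r U U1 U2 :: complex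
      using that by (simp add: field_simps)
    from this[of "u \<tau>" "u \<tau> - 1" "u \<tau> - x"] un show ?thesis by (simp only: d not_False_eq_True)
  qed
  also have "- 4 * of_real pi ^ 2 * E * (u \<tau> * (u \<tau> - 1) * (u \<tau> - x)) = (v \<tau>)^2"
    using v_squared[OF reg] by (simp add: d)
  finally have eq: "2 * v' * v \<tau> = (v \<tau>)^2 * (k + u' / u \<tau> + u' / (u \<tau> - 1) + (u' - x') / (u \<tau> - x))"
    by (simp add: mult.assoc)
  have "v' = v \<tau> / 2 * (k + u' / u \<tau> + u' / (u \<tau> - 1) + (u' - x') / (u \<tau> - x))"
  proof -
    have "s' = s / 2 * S" if "2 * s' * s = s^2 * S" "s \<noteq> 0" for s s' S :: complex
    proof -
      have "2 * s' = s * S" using that by (simp add: power2_eq_square)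
      from arg_cong[OF this, of "\<lambda>t. t / 2"] show ?thesis by simp
    qed
    from this[OF eq un(4)] show ?thesis .
  qed
  from v'[unfolded this] show ?thesis unfolding d .
qed

text \<open>The logarithmic derivative of \<open>\<theta>\<^sub>3(0)\<close> occurs with the same coefficient in \<open>v' / v\<close> and in \<open>\<zeta>' / \<zeta>\<close>, and hence
  cancels in the derivative of \<open>v / (2 \<zeta>)\<close>. Replacing \<open>\<zeta>\<close> by \<open>v / (2 (y - u))\<close> leaves \<open>v\<close> only in the form \<open>v\<^sup>2\<close>, a
  polynomial in \<open>u\<close>.\<close>

theorem u_y_system:
  assumes reg: "regular \<tau>" and z: "zet \<tau> \<noteq> 0"
  defines "x \<equiv> theta_lambda \<tau>" and "F \<equiv> of_real pi * \<i> * (theta3 0 \<tau>)^4"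
  shows "y \<tau> \<noteq> u \<tau>"
    and "(u has_field_derivative F * (u \<tau> * (u \<tau> - 1) * (y \<tau> - x) / (y \<tau> - u \<tau>))) (at \<tau>)"
    and "(y has_field_derivative F * (y \<tau> * (y \<tau> - 1) * (y \<tau> - x) / (y \<tau> - u \<tau>) - ((y \<tau>)^2 - 2 * x * y \<tau> + x) / 2)) (at \<tau>)"
proof -
  have \<tau>: "Im \<tau> > 0" using reg by (simp add: regular_def)
  note un = u_nonzero[OF reg] v_nonzero[OF reg]
  define w where "w = v \<tau> / (2 * zet \<tau>)"
  have w: "w \<noteq> 0" using un z by (simp add: w_def)
  have y: "y \<tau> = u \<tau> + w" by (simp add: y_def w_def)
  show "y \<tau> \<noteq> u \<tau>" using w by (simp add: y)
  define E where "E = (theta3 0 \<tau>)^4"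
  have zv: "zet \<tau> * v \<tau> = - 2 * of_real pi ^ 2 * E * (u \<tau> * (u \<tau> - 1) * (u \<tau> - x)) / w"
  proof -
    have "zet \<tau> * v \<tau> = (v \<tau>)^2 / (2 * w)" using un z by (simp add: w_def field_simps power2_eq_square)
    thus ?thesis unfolding v_squared[OF reg] by (simp add: E_def x_def)
  qed
  define u' where "u' = F * (u \<tau> * (u \<tau> - 1) * (u \<tau> + w - x) / w)"
  have "- of_real pi * \<i> * (theta3 0 \<tau>)^4 * (u \<tau> * (1 - u \<tau>)) - \<i> * zet \<tau> * v \<tau> / (2 * of_real pi) = u'"
  proof -
    have "- p * \<i> * E * (U * (1 - U)) - \<i> * (- 2 * p ^ 2 * E * (U * (U - 1) * (U - x)) / w) / (2 * p) =
       p * \<i> * E * (U * (U - 1) * (U + w - x) / w)" if "p \<noteq> 0" for p U :: complex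
      using that w by (simp add: field_simps power2_eq_square)
    from this[of "of_real pi" "u \<tau>"] show ?thesis
      unfolding mult.assoc[of \<i> "zet \<tau>"] zv by (simp add: u'_def E_def F_def)
  qed
  hence u: "(u has_field_derivative u') (at \<tau>)" using u_DERIV[OF reg] by simp
  thus "(u has_field_derivative F * (u \<tau> * (u \<tau> - 1) * (y \<tau> - x) / (y \<tau> - u \<tau>))) (at \<tau>)"
    by (simp add: u'_def y)
  define x' where "x' = - (F * (x * (1 - x)))"
  define k where "k = theta3_deriv 2 0 \<tau> / theta3 0 \<tau>"
  define v' where "v' = v \<tau> / 2 * (k / (of_real pi * \<i>) + u' / u \<tau> + u' / (u \<tau> - 1) + (u' - x') / (u \<tau> - x))"
  define z' where "z' = (of_real pi ^ 2 * E * v \<tau> + 2 * zet \<tau> * (k + of_real pi ^ 2 * E * (u \<tau> - x))) / (4 * of_real pi * \<i>)"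
  have v: "(v has_field_derivative v') (at \<tau>)"
    using v_DERIV[OF reg u] by (simp add: v'_def k_def x'_def F_def x_def)
  have z': "(zet has_field_derivative z') (at \<tau>)"
    using zet_DERIV[OF reg] by (simp add: z'_def E_def k_def x_def)
  have "((\<lambda>t. u t + v t / (2 * zet t)) has_field_derivative
     u' + (v' * (2 * zet \<tau>) - v \<tau> * (2 * z')) / (2 * zet \<tau> * (2 * zet \<tau>))) (at \<tau>)"
    by (intro DERIV_add DERIV_divide u v DERIV_cmult z') (use z in simp)
  also have "(v' * (2 * zet \<tau>) - v \<tau> * (2 * z')) / (2 * zet \<tau> * (2 * zet \<tau>)) = w * (v' / v \<tau> - z' / zet \<tau>)"
    using un z by (simp add: w_def field_simps)
  also have "v' / v \<tau> = (k / (of_real pi * \<i>) + u' / u \<tau> + u' / (u \<tau> - 1) + (u' - x') / (u \<tau> - x)) / 2"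
    using un by (simp add: v'_def)
  also have "z' / zet \<tau> = (k / (of_real pi * \<i>) - F * (u \<tau> + w - x)) / 2"
  proof -
    have v: "v \<tau> = 2 * zet \<tau> * w" using z by (simp add: w_def)
    have "((p^2 * E * (2 * s * w) + 2 * s * (k + p^2 * E * (U - x))) / (4 * p * \<i>)) / s = (k / (p * \<i>) - p * \<i> * E * (U + w - x)) / 2"
      if "p \<noteq> 0" "s \<noteq> 0" for p s U :: complex
      using that by (simp add: field_simps power2_eq_square)
    from this[of "of_real pi" "zet \<tau>" "u \<tau>"] z show ?thesis
      unfolding z'_def v F_def by (simp add: E_def)
  qed
  also have "u' + w * ((k / (of_real pi * \<i>) + u' / u \<tau> + u' / (u \<tau> - 1) + (u' - x') / (u \<tau> - x)) / 2 - (k / (of_real pi * \<i>) - F * (u \<tau> + w - x)) / 2)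
     = F * ((u \<tau> + w) * (u \<tau> + w - 1) * (u \<tau> + w - x) / w - ((u \<tau> + w)^2 - 2 * x * (u \<tau> + w) + x) / 2)"
  proof -
    define g where "g = (\<lambda>U. U * (U - 1) * (U + w - x) / w)"
    have g: "u' = F * g (u \<tau>)" by (simp add: u'_def g_def)
    have "g U + w * (g U / U + g U / (U - 1) + (g U + x * (1 - x)) / (U - x) + (U + w - x)) / 2
      = (U + w) * (U + w - 1) * (U + w - x) / w - ((U + w)^2 - 2 * x * (U + w) + x) / 2"
      if U: "U \<noteq> 0" "U - 1 \<noteq> 0" "U - x \<noteq> 0" for U
    proof -
      have e1: "(g U + x * (1 - x)) / (U - x) = ((U + w - x) * U - (U + w) * (1 - x)) / w"
        using U w by (simp add: g_def divide_simps) (simp add: algebra_simps power2_eq_square)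
      have e2: "g U / U = (U - 1) * (U + w - x) / w" "g U / (U - 1) = U * (U + w - x) / w"
        using U by (simp_all add: g_def)
      show ?thesis
        unfolding e1 e2 unfolding g_def using w by (simp add: field_simps power2_eq_square)
    qed
    from this[of "u \<tau>"] un
    have "F * (g (u \<tau>) + w * (g (u \<tau>) / u \<tau> + g (u \<tau>) / (u \<tau> - 1) + (g (u \<tau>) + x * (1 - x)) / (u \<tau> - x) + (u \<tau> + w - x)) / 2)
      = F * ((u \<tau> + w) * (u \<tau> + w - 1) * (u \<tau> + w - x) / w - ((u \<tau> + w)^2 - 2 * x * (u \<tau> + w) + x) / 2)"
      by (simp add: x_def)
    moreover have "u' + w * ((k / (of_real pi * \<i>) + u' / u \<tau> + u' / (u \<tau> - 1) + (u' - x') / (u \<tau> - x)) / 2 - (k / (of_real pi * \<i>) - F * (u \<tau> + w - x)) / 2)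
      = F * (g (u \<tau>) + w * (g (u \<tau>) / u \<tau> + g (u \<tau>) / (u \<tau> - 1) + (g (u \<tau>) + x * (1 - x)) / (u \<tau> - x) + (u \<tau> + w - x)) / 2)"
      unfolding g x'_def by (simp add: add_divide_distrib diff_divide_distrib algebra_simps)
    ultimately show ?thesis by simp
  qed
  finally show "(y has_field_derivative F * (y \<tau> * (y \<tau> - 1) * (y \<tau> - x) / (y \<tau> - u \<tau>) - ((y \<tau>)^2 - 2 * x * y \<tau> + x) / 2)) (at \<tau>)"
    unfolding y_def[abs_def] by (simp add: w_def)
qed

end

section \<open>The complete elliptic integral\<close>

text \<open>Legendre's form of the integral. It is defined on the whole slit plane and is visibly holomorphic there, unlike the
  Gauss series, which converges in the unit disc only.\<close>

definition ell_K :: "complex \<Rightarrow> complex" where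
  "ell_K x = integral {0..pi/2} (\<lambda>t. 1 / csqrt (1 - x * of_real (sin t ^ 2)))"

definition slit :: "complex set" where "slit = - complex_of_real ` {1..}"

lemma slit_iff: "x \<in> slit \<longleftrightarrow> Im x \<noteq> 0 \<or> Re x < 1"
proof -
  have "x \<in> complex_of_real ` {1..} \<longleftrightarrow> Im x = 0 \<and> Re x \<ge> 1"
  proof safe
    assume "Im x = 0" "Re x \<ge> 1"
    hence "x = of_real (Re x)" "Re x \<in> {1..}" by (simp_all add: complex_eq_iff)
    thus "x \<in> complex_of_real ` {1..}" by blast
  qed simp_all
  thus ?thesis by (auto simp: slit_def)
qed

lemma open_slit: "open slit"
proof -
  have "slit = {x. Im x \<noteq> 0} \<union> {x. Re x < 1}" by (auto simp: slit_iff)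
  moreover have "open ({x. Im x \<noteq> 0} \<union> {x. Re x < 1})"
    by (intro open_Un open_Collect_neq open_halfspace_Re_lt continuous_intros)
  ultimately show ?thesis by simp
qed

lemma connected_slit: "connected slit"
proof -
  have "starlike slit"
    unfolding starlike_def
  proof (intro bexI[of _ 0] ballI subsetI)
    fix x y assume x: "x \<in> slit" and "y \<in> closed_segment 0 x"
    then obtain s where s: "0 \<le> s" "s \<le> 1" "y = s *\<^sub>R x" by (auto simp: in_segment)
    show "y \<in> slit"
    proof (cases "Im x = 0 \<or> s = 0")
      case True
      hence "Re y < 1"
      proof
        assume "Im x = 0"
        hence "Re x < 1" using x by (simp add: slit_iff)
        thus ?thesis using s by (simp add: s(3)) (smt (verit) mult_le_cancel_left1 mult_left_le_one_le mult_nonneg_nonpos)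
      qed (use s in simp)
      thus ?thesis by (simp add: slit_iff)
    next
      case False
      thus ?thesis using s(3) by (simp add: slit_iff)
    qed
  qed (simp add: slit_iff)
  thus ?thesis by (rule starlike_imp_connected)
qed

lemma one_minus_slit_not_nonpos:
  assumes "x \<in> slit" "0 \<le> s" "s \<le> 1"
  shows "1 - x * complex_of_real s \<notin> \<real>\<^sub>\<le>\<^sub>0"
proof
  assume "1 - x * complex_of_real s \<in> \<real>\<^sub>\<le>\<^sub>0"
  hence 1: "Im x * s = 0" "1 \<le> Re x * s" by (auto simp: complex_nonpos_Reals_iff)
  hence "s \<noteq> 0" by auto
  hence "Im x = 0" "Re x < 1" using 1 assms by (auto simp: slit_iff)
  moreover have "s > 0" using \<open>s \<noteq> 0\<close> assms by simp
  ultimately have "Re x * s < 1 * s" by (intro mult_strict_right_mono)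
  thus False using 1 assms by simp
qed

lemma sin_sq_le_1: "(sin t)^2 \<le> (1::real)"
  by (simp add: abs_square_le_1)

lemma continuous_on_csqrt_compose:
  assumes "continuous_on A f" "\<And>x. x \<in> A \<Longrightarrow> f x \<notin> \<real>\<^sub>\<le>\<^sub>0"
  shows "continuous_on A (\<lambda>x. csqrt (f x))"
  by (rule continuous_on_compose2[OF continuous_on_csqrt assms(1)]) (use assms(2) in auto)

lemma ell_K_integrand_continuous:
  assumes "x \<in> slit"
  shows "continuous_on A (\<lambda>t. 1 / csqrt (1 - x * of_real (sin t ^ 2)))"
proof -
  have nz: "1 - x * of_real (sin t ^ 2) \<notin> \<real>\<^sub>\<le>\<^sub>0" for t
    by (rule one_minus_slit_not_nonpos[OF assms]) (simp_all add: sin_sq_le_1)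
  hence "1 - x * of_real (sin t ^ 2) \<noteq> 0" for t by (metis nonpos_Reals_zero_I)
  show ?thesis
    by (intro continuous_on_divide continuous_on_csqrt_compose continuous_intros)
       (use nz \<open>\<And>t. 1 - x * of_real (sin t ^ 2) \<noteq> 0\<close> in simp_all)
qed

lemma ell_K_has_integral:
  assumes "x \<in> slit"
  shows "((\<lambda>t. 1 / csqrt (1 - x * of_real (sin t ^ 2))) has_integral ell_K x) {0..pi/2}"
  unfolding ell_K_def
  by (intro integrable_integral integrable_continuous_real ell_K_integrand_continuous assms)

lemma ell_K_holomorphic: "ell_K holomorphic_on slit"
proof (subst holomorphic_on_open[OF open_slit], intro ballI)
  fix x assume "x \<in> slit"
  then obtain r where r: "r > 0" "ball x r \<subseteq> slit" using open_slit open_contains_ball by meson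
  define fx where "fx = (\<lambda>x t. of_real (sin t ^ 2) / (2 * csqrt (1 - x * of_real (sin t ^ 2)) ^ 3))"
  have nz: "1 - x * of_real (sin t ^ 2) \<notin> \<real>\<^sub>\<le>\<^sub>0" "1 - x * of_real (sin t ^ 2) \<noteq> 0" if "x \<in> ball x0 r" "ball x0 r \<subseteq> slit" for x x0 t
  proof -
    show *: "1 - x * of_real (sin t ^ 2) \<notin> \<real>\<^sub>\<le>\<^sub>0"
      using that by (intro one_minus_slit_not_nonpos) (auto simp: sin_sq_le_1)
    show "1 - x * of_real (sin t ^ 2) \<noteq> 0" using * by (metis nonpos_Reals_zero_I)
  qed
  have "(\<lambda>x. integral (cbox 0 (pi/2)) ((\<lambda>x t. 1 / csqrt (1 - x * of_real (sin t ^ 2))) x)) holomorphic_on ball x r"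
  proof (rule leibniz_rule_holomorphic[where fx = fx])
    show "((\<lambda>x. 1 / csqrt (1 - x * of_real (sin t ^ 2))) has_field_derivative fx z t) (at z within ball x r)"
      if "z \<in> ball x r" for z t
    proof -
      let ?w = "1 - z * of_real (sin t ^ 2)"
      have n: "?w \<notin> \<real>\<^sub>\<le>\<^sub>0" "csqrt ?w \<noteq> 0" using nz[OF that r(2), of t] by auto
      have 1: "((\<lambda>x. 1 - x * of_real (sin t ^ 2)) has_field_derivative - of_real (sin t ^ 2)) (at z)"
        by (auto intro!: derivative_eq_intros)
      have "((\<lambda>x. csqrt (1 - x * of_real (sin t ^ 2))) has_field_derivative
             inverse (2 * csqrt ?w) * - of_real (sin t ^ 2)) (at z)"
        by (rule DERIV_chain2[OF has_field_derivative_csqrt[OF n(1)] 1])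
      from DERIV_divide[OF DERIV_const[of 1] this n(2)]
      have "((\<lambda>x. 1 / csqrt (1 - x * of_real (sin t ^ 2))) has_field_derivative
         (0 * csqrt ?w - 1 * (inverse (2 * csqrt ?w) * - of_real (sin t ^ 2))) / (csqrt ?w * csqrt ?w)) (at z)" .
      moreover have "(0 * csqrt ?w - 1 * (inverse (2 * csqrt ?w) * - of_real (sin t ^ 2))) / (csqrt ?w * csqrt ?w) = fx z t"
        using n(2) by (simp add: fx_def power3_eq_cube field_simps)
      ultimately show ?thesis by (simp add: has_field_derivative_at_within)
    qed
    show "(\<lambda>t. 1 / csqrt (1 - z * of_real (sin t ^ 2))) integrable_on cbox 0 (pi/2)" if "z \<in> ball x r" for z
      using that r(2) by (intro integrable_continuous ell_K_integrand_continuous) auto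
    show "continuous_on (ball x r \<times> cbox 0 (pi/2)) (\<lambda>(z, t). fx z t)"
      unfolding fx_def case_prod_unfold
    proof (rule continuous_on_divide)
      have "continuous_on (ball x r \<times> cbox 0 (pi/2)) (\<lambda>p. csqrt (1 - fst p * complex_of_real ((sin (snd p))\<^sup>2)))"
      proof (rule continuous_on_csqrt_compose)
        fix p :: "complex \<times> real" assume "p \<in> ball x r \<times> cbox 0 (pi/2)"
        hence p: "fst p \<in> ball x r" by auto
        show "1 - fst p * complex_of_real ((sin (snd p))\<^sup>2) \<notin> \<real>\<^sub>\<le>\<^sub>0"
          by (rule nz(1)[OF p r(2)])
      qed (intro continuous_intros)
      thus "continuous_on (ball x r \<times> cbox 0 (pi/2)) (\<lambda>p. 2 * csqrt (1 - fst p * complex_of_real ((sin (snd p))\<^sup>2)) ^ 3)"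
        by (intro continuous_on_mult continuous_on_power continuous_on_const)
      show "\<forall>p\<in>ball x r \<times> cbox 0 (pi/2). 2 * csqrt (1 - fst p * complex_of_real ((sin (snd p))\<^sup>2)) ^ 3 \<noteq> 0"
      proof
        fix p :: "complex \<times> real" assume "p \<in> ball x r \<times> cbox 0 (pi/2)"
        hence p: "fst p \<in> ball x r" by auto
        show "2 * csqrt (1 - fst p * complex_of_real ((sin (snd p))\<^sup>2)) ^ 3 \<noteq> 0"
          using nz(2)[OF p r(2), of "snd p"] by simp
      qed
    qed (intro continuous_intros)
  qed simp
  hence "ell_K holomorphic_on ball x r" unfolding ell_K_def[abs_def] cbox_interval .
  thus "\<exists>f'. (ell_K has_field_derivative f') (at x)"
    using r(1) by (subst (asm) holomorphic_on_open) auto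
qed

text \<open>Integration of the derivative of \<open>- cos t sin\<^sup>2\<^sup>n\<^sup>+\<^sup>1 t\<close>, which vanishes at both ends, gives the recursion.\<close>

lemma wallis_integral:
  "((\<lambda>t. sin t ^ (2 * n)) has_integral (pi / 2 * (pochhammer (1/2) n / fact n))) {0..pi/2}"
proof (induction n)
  case 0
  show ?case using has_integral_const_real[of "1::real" 0 "pi/2"] by simp
next
  case (Suc n)
  have d: "((\<lambda>t. - (cos t * sin t ^ (2 * n + 1))) has_vector_derivative
      (2 * n + 2) * sin t ^ (2 * Suc n) - (2 * n + 1) * sin t ^ (2 * n)) (at t within {0..pi/2})" for t :: real
  proof -
    have "((\<lambda>t. - (cos t * sin t ^ (2 * n + 1))) has_real_derivative
       - (- sin t * sin t ^ (2 * n + 1) + cos t * ((2 * n + 1) * sin t ^ (2 * n) * cos t))) (at t)"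
    proof -
      have "((\<lambda>t. sin t ^ Suc (2 * n)) has_real_derivative (1 + real (2 * n)) * (cos t * sin t ^ (2 * n))) (at t)"
        by (rule DERIV_power_Suc[OF DERIV_sin])
      from DERIV_minus[OF DERIV_mult[OF DERIV_cos this]] show ?thesis
        by (simp add: algebra_simps)
    qed
    also have "- (- sin t * sin t ^ (2 * n + 1) + cos t * ((2 * n + 1) * sin t ^ (2 * n) * cos t))
      = sin t ^ (2 * Suc n) - (2 * n + 1) * sin t ^ (2 * n) * (cos t)^2"
      by (simp add: power2_eq_square algebra_simps)
    also have "\<dots> = (2 * n + 2) * sin t ^ (2 * Suc n) - (2 * n + 1) * sin t ^ (2 * n)"
      unfolding cos_squared_eq by (simp add: algebra_simps power_add power2_eq_square)
    finally show ?thesis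
      unfolding has_real_derivative_iff_has_vector_derivative
      by (rule has_vector_derivative_at_within)
  qed
  have "((\<lambda>t. (2 * n + 2) * sin t ^ (2 * Suc n) - (2 * n + 1) * sin t ^ (2 * n)) has_integral
     (- (cos (pi/2) * sin (pi/2) ^ (2 * n + 1)) - (- (cos 0 * sin 0 ^ (2 * n + 1))))) {0..pi/2}"
    by (rule fundamental_theorem_of_calculus[OF _ d]) simp
  hence "((\<lambda>t. (2 * n + 2) * sin t ^ (2 * Suc n) - (2 * n + 1) * sin t ^ (2 * n)) has_integral 0) {0..pi/2}" by simp
  from has_integral_add[OF this has_integral_mult_right[OF Suc, of "2 * n + 1"]]
  have *: "((\<lambda>t. (2 * n + 2) * sin t ^ (2 * Suc n)) has_integral (2 * n + 1) * (pi / 2 * (pochhammer (1/2) n / fact n))) {0..pi/2}"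
    by simp
  have "((\<lambda>t. sin t ^ (2 * Suc n)) has_integral (1 / real (2 * n + 2) * (2 * n + 1) * (pi / 2) * (pochhammer (1/2) n / fact n))) {0..pi/2}"
  proof -
    have c: "1 / real (2 * n + 2) * real (2 * n + 2) = 1" by simp
    show ?thesis
      using has_integral_mult_right[OF *, of "1 / real (2 * n + 2)"]
      unfolding mult.assoc[symmetric] c mult_1 .
  qed
  also have "1 / real (2 * n + 2) * (2 * n + 1) * (pi / 2) * (pochhammer (1/2) n / fact n) = pi / 2 * (pochhammer (1/2) (Suc n) / fact (Suc n))"
    by (simp add: pochhammer_Suc field_simps)
  finally show ?case by simp
qed

lemma inverse_csqrt_series:
  assumes "norm w < 1"
  shows "(\<lambda>n. pochhammer (1/2) n / fact n * w^n) sums (1 / csqrt (1 - w))"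
proof -
  have "(\<lambda>n. ((- 1/2) gchoose n) * (-w)^n) sums (1 + (-w)) powr (- 1/2)"
    by (rule gen_binomial_complex) (use assms in simp)
  moreover have "((- 1/2) gchoose n) * (-w)^n = pochhammer (1/2) n / fact n * w^n" for n
  proof -
    have 1: "(-1) ^ n * (-1) ^ n = (1 :: complex)" by (simp flip: power_mult_distrib)
    have "((- 1/2) gchoose n) * (-w)^n = ((-1) ^ n * (-1) ^ n) * (pochhammer (1/2) n / fact n * w^n)"
      unfolding gbinomial_pochhammer power_minus[of w] by (simp only: minus_divide_left minus_minus mult_ac times_divide_eq_left times_divide_eq_right)
    thus ?thesis unfolding 1 by simp
  qed
  moreover have "(1 + (-w)) powr (- 1/2) = 1 / csqrt (1 - w)"
    using powr_minus_divide[of "1 - w" "1/2"] assms by (auto simp: csqrt_conv_powr)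
  ultimately show ?thesis by simp
qed

lemma pochhammer_half_le: "norm (pochhammer (1/2) n / fact n :: complex) \<le> 1"
proof (induction n)
  case (Suc n)
  have "pochhammer (1/2) (Suc n) / fact (Suc n) = pochhammer (1/2) n / fact n * ((1/2 + of_nat n) / (of_nat (Suc n)) :: complex)"
    by (simp add: pochhammer_Suc)
  moreover have "norm ((1/2 + of_nat n) / (of_nat (Suc n)) :: complex) \<le> 1"
  proof -
    have "(1/2 + of_nat n) / (of_nat (Suc n)) = complex_of_real ((1/2 + real n) / real (Suc n))" by simp
    thus ?thesis by (simp only: norm_of_real) simp
  qed
  ultimately show ?case using Suc mult_le_one[OF Suc norm_ge_zero] by (simp only: norm_mult)
qed simp

text \<open>The binomial series of the integrand converges uniformly in \<open>t\<close>, and the Wallis integrals supply the second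
  Pochhammer quotient.\<close>

lemma ell_K_series:
  assumes x: "norm x < 1"
  shows "(\<lambda>n. pochhammer (1/2) n * pochhammer (1/2) n / (pochhammer 1 n * fact n) * x^n) sums (2 / of_real pi * ell_K x)"
proof -
  define c where "c = (\<lambda>n. pochhammer (1/2) n / fact n :: complex)"
  have cr: "c n = of_real (pochhammer (1/2) n / fact n)" for n
    unfolding c_def by (simp add: pochhammer_of_real[symmetric])
  have xs: "x \<in> slit" using x complex_Re_le_cmod[of x] by (auto simp: slit_iff)
  define f where "f = (\<lambda>n (t::real). c n * x^n * of_real (sin t ^ (2*n)))"
  have fn: "norm (f n t) \<le> norm x ^ n" for n t
  proof -
    have "\<bar>sin t\<bar> ^ (2*n) \<le> 1" by (intro power_le_one) auto
    hence "norm (f n t) \<le> 1 * norm x ^ n * 1"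
      unfolding f_def norm_mult norm_power norm_of_real using pochhammer_half_le[of n]
      by (intro mult_mono) (auto simp: c_def power_abs)
    thus ?thesis by simp
  qed
  have ul: "uniform_limit (cbox 0 (pi/2)) (\<lambda>N t. \<Sum>n<N. f n t) (\<lambda>t. \<Sum>n. f n t) sequentially"
    by (rule Weierstrass_m_test[OF fn]) (use x in \<open>simp add: summable_geometric\<close>)
  have sf: "(\<Sum>n. f n t) = 1 / csqrt (1 - x * of_real (sin t ^ 2))" for t
  proof -
    have "norm (x * of_real (sin t ^ 2)) \<le> norm x * 1"
      unfolding norm_mult norm_of_real by (intro mult_left_mono) (auto simp: sin_sq_le_1)
    hence "norm (x * of_real (sin t ^ 2)) < 1" using x by simp
    note s = inverse_csqrt_series[OF this]
    have "f n t = pochhammer (1/2) n / fact n * (x * of_real (sin t ^ 2))^n" for n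
      unfolding f_def c_def power_mult_distrib power_mult of_real_power by (simp only: mult.assoc)
    hence "(\<lambda>n. f n t) sums (1 / csqrt (1 - x * of_real (sin t ^ 2)))" using s by (simp only:)
    thus ?thesis by (rule sums_unique[symmetric])
  qed
  have I: "(f n has_integral (c n * x^n * of_real (pi / 2 * (pochhammer (1/2) n / fact n)))) (cbox 0 (pi/2))" for n
    unfolding f_def cbox_interval by (rule has_integral_mult_right[OF has_integral_of_real[OF wallis_integral[of n]]])
  obtain I J where IJ: "\<And>N. ((\<lambda>t. \<Sum>n<N. f n t) has_integral I N) (cbox 0 (pi/2))"
     "((\<lambda>t. \<Sum>n. f n t) has_integral J) (cbox 0 (pi/2))" "(I \<longlongrightarrow> J) sequentially"
    by (rule uniform_limit_integral_cbox[OF ul]) (auto simp: f_def intro!: continuous_intros)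
  have "I = (\<lambda>N. \<Sum>n<N. c n * x^n * of_real (pi / 2 * (pochhammer (1/2) n / fact n)))"
    by (rule ext, rule has_integral_unique[OF IJ(1)], rule has_integral_sum) (use I in auto)
  moreover have "J = ell_K x"
    using has_integral_unique[OF IJ(2)] ell_K_has_integral[OF xs] unfolding sf by simp
  ultimately have "(\<lambda>n. c n * x^n * of_real (pi / 2 * (pochhammer (1/2) n / fact n))) sums ell_K x"
    using IJ(3) by (simp add: sums_def)
  from sums_mult[OF this, of "2 / of_real pi"]
  have "(\<lambda>n. 2 / of_real pi * (c n * x^n * of_real (pi / 2 * (pochhammer (1/2) n / fact n)))) sums (2 / of_real pi * ell_K x)" .
  moreover have "2 / of_real pi * (c n * x^n * of_real (pi / 2 * (pochhammer (1/2) n / fact n))) =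
     pochhammer (1/2) n * pochhammer (1/2) n / (pochhammer 1 n * fact n) * x^n" for n
  proof -
    have "2 / of_real pi * (c n * x^n * of_real (pi / 2 * (pochhammer (1/2) n / fact n))) = c n * x^n * c n"
      unfolding of_real_mult[of "pi / 2"] cr[symmetric] by simp
    also have "\<dots> = pochhammer (1/2) n * pochhammer (1/2) n / (pochhammer 1 n * fact n) * x^n"
      unfolding c_def pochhammer_fact[symmetric] by simp
    finally show ?thesis .
  qed
  ultimately show ?thesis by (simp only:)
qed

text \<open>The integral continues the Gauss series to the slit plane, and the continuation is unique.\<close>

lemma hyp2F1_half_eq:
  assumes "x \<in> slit"
  shows "hyp2F1 (1/2) (1/2) 1 x = 2 / of_real pi * ell_K x"
proof -
  define P where "P = (\<lambda>f. f holomorphic_on slit \<and> (\<forall>z. norm z < 1 \<longrightarrow>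
     (\<lambda>n. pochhammer (1/2) n * pochhammer (1/2) n / (pochhammer 1 n * fact n) * z^n) sums f z))"
  define g where "g = (\<lambda>x. 2 / of_real pi * ell_K x)"
  have g: "P g" unfolding P_def g_def
    by (intro conjI allI impI holomorphic_on_mult holomorphic_on_const ell_K_holomorphic ell_K_series)
  have "hyp2F1 (1/2) (1/2) 1 = (SOME f. P f)" unfolding hyp2F1_def P_def slit_def ..
  hence h: "P (hyp2F1 (1/2) (1/2) 1)" using someI[of P, OF g] by simp
  have "hyp2F1 (1/2) (1/2) 1 x - g x = 0"
  proof (rule analytic_continuation[where f = "\<lambda>x. hyp2F1 (1/2) (1/2) 1 x - g x" and S = slit and U = "ball 0 1" and \<xi> = 0])
    show "(\<lambda>x. hyp2F1 (1/2) (1/2) 1 x - g x) holomorphic_on slit"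
      using g h unfolding P_def by (intro holomorphic_on_diff) blast+
    show "ball 0 1 \<subseteq> slit"
    proof
      fix z :: complex assume "z \<in> ball 0 1"
      thus "z \<in> slit" using complex_Re_le_cmod[of z] by (auto simp: slit_iff)
    qed
    show "(0::complex) islimpt ball 0 1" by (intro interior_limit_point) simp
    show "hyp2F1 (1/2) (1/2) 1 z - g z = 0" if "z \<in> ball 0 1" for z
      proof -
      have "norm z < 1" using that by simp
      hence "(\<lambda>n. pochhammer (1/2) n * pochhammer (1/2) n / (pochhammer 1 n * fact n) * z^n) sums hyp2F1 (1/2) (1/2) 1 z"
        "(\<lambda>n. pochhammer (1/2) n * pochhammer (1/2) n / (pochhammer 1 n * fact n) * z^n) sums g z"
        using g h unfolding P_def by blast+
      from sums_unique2[OF this] show ?thesis by simp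
    qed
  qed (use assms open_slit connected_slit in \<open>auto simp: slit_iff\<close>)
  thus ?thesis by (simp add: g_def)
qed

lemma cut_plane_iff: "x \<in> cut_plane \<longleftrightarrow> x \<in> slit \<and> 1 - x \<in> slit"
proof -
  have "1 - x \<in> complex_of_real ` {1..} \<longleftrightarrow> x \<in> complex_of_real ` {..0}"
  proof
    assume "1 - x \<in> complex_of_real ` {1..}"
    then obtain a where a: "1 - x = of_real a" "a \<ge> 1" by blast
    hence "x = of_real (1 - a)" by (simp add: algebra_simps)
    thus "x \<in> complex_of_real ` {..0}" using a(2) by (intro image_eqI[of _ _ "1 - a"]) simp_all
  next
    assume "x \<in> complex_of_real ` {..0}"
    then obtain a where a: "x = of_real a" "a \<le> 0" by blast
    hence "1 - x = of_real (1 - a)" by simp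
    thus "1 - x \<in> complex_of_real ` {1..}" using a(2) by (intro image_eqI[of _ _ "1 - a"]) simp_all
  qed
  thus ?thesis unfolding cut_plane_def slit_def by (simp only: Compl_iff image_Un Un_iff) blast
qed

lemma K_sqrt_eq: "x \<in> cut_plane \<Longrightarrow> K_sqrt x = ell_K x"
  and K'_sqrt_eq: "x \<in> cut_plane \<Longrightarrow> K'_sqrt x = ell_K (1 - x)"
  by (simp_all add: K_sqrt_def K'_sqrt_def cut_plane_iff hyp2F1_half_eq)

text \<open>With \<open>p = a + \<i> b\<close> and \<open>q = c + \<i> d\<close> the assumptions read \<open>a b = - c d\<close> and \<open>a\<^sup>2 + c\<^sup>2 > b\<^sup>2 + d\<^sup>2\<close>. Eliminating \<open>d\<close>
  from the latter gives \<open>c\<^sup>2 > b\<^sup>2\<close>, and \<open>c (a c + b d) = a (c\<^sup>2 - b\<^sup>2)\<close>.\<close>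

lemma Re_mult_cnj_pos_of_sum_squares:
  fixes p q :: complex
  assumes "Re p > 0" "Re q > 0" and im: "Im (p^2 + q^2) = 0" and re: "Re (p^2 + q^2) > 0"
  shows "Re (p * cnj q) > 0"
proof -
  define a b c d where "a = Re p" "b = Im p" "c = Re q" "d = Im q"
  note D = this
  have pos: "a > 0" "c > 0" using assms by (simp_all add: D)
  have 1: "a * b + c * d = 0"
  proof -
    have "Im (p^2 + q^2) = 2 * (a * b + c * d)" by (simp add: D power2_eq_square)
    thus ?thesis using im by simp
  qed
  have 2: "a^2 - b^2 + (c^2 - d^2) > 0" using re by (simp add: D power2_eq_square)
  have cd: "c * d = - (a * b)" using 1 by simp
  have "c^2 * (a^2 - b^2 + (c^2 - d^2)) = c^2 * a^2 - c^2 * b^2 + c^4 - (c * d)^2"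
    by (simp add: algebra_simps power2_eq_square power4_eq_xxxx)
  also have "\<dots> = (a^2 + c^2) * (c^2 - b^2)"
    unfolding cd by (simp add: algebra_simps power2_eq_square power4_eq_xxxx)
  finally have "(a^2 + c^2) * (c^2 - b^2) > 0" using 2 pos by (metis mult_pos_pos zero_less_power)
  hence "c^2 - b^2 > 0" by (simp add: zero_less_mult_iff not_less[symmetric] sum_power2_ge_zero) (smt (verit) sum_power2_ge_zero)
  hence "a * (c^2 - b^2) > 0" using pos by simp
  also have "a * (c^2 - b^2) = c * (a * c + b * d)"
    using cd by (simp add: algebra_simps power2_eq_square)
  finally have "a * c + b * d > 0" using pos by (simp add: zero_less_mult_iff)
  thus ?thesis by (simp add: D)
qed

lemma Re_csqrt_pos: "w \<notin> \<real>\<^sub>\<le>\<^sub>0 \<Longrightarrow> Re (csqrt w) > 0"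
proof -
  assume w: "w \<notin> \<real>\<^sub>\<le>\<^sub>0"
  have "Re (csqrt w) \<noteq> 0"
  proof
    assume 0: "Re (csqrt w) = 0"
    have "w = (csqrt w)^2" by simp
    hence "Im w = 0" "Re w \<le> 0" using 0 by (metis Im_power2 mult_zero_right mult_zero_left, metis Re_power2 0 diff_0 neg_le_0_iff_le power_zero_numeral zero_le_power2)
    thus False using w by (simp add: complex_nonpos_Reals_iff)
  qed
  thus ?thesis using Re_csqrt[of w] by linarith
qed

text \<open>For the two radicands \<open>P\<^sup>2 = 1 - x s\<^sup>2\<close> and \<open>Q\<^sup>2 = 1 - (1 - x) r\<^sup>2\<close> the combination
  \<open>(r P)\<^sup>2 + (s Q)\<^sup>2 = r\<^sup>2 + s\<^sup>2 - r\<^sup>2 s\<^sup>2\<close> does not involve \<open>x\<close>.\<close>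

lemma ell_K_integrands_Re_pos:
  assumes x: "x \<in> slit" "1 - x \<in> slit" and s: "0 \<le> s" "s \<le> 1" and r: "0 \<le> r" "r \<le> 1"
  shows "Re ((1 / csqrt (1 - x * of_real (s^2))) * cnj (1 / csqrt (1 - (1 - x) * of_real (r^2)))) > 0"
proof -
  define P Q where "P = csqrt (1 - x * of_real (s^2))" "Q = csqrt (1 - (1 - x) * of_real (r^2))"
  note d = this
  have s2: "s^2 \<le> 1" "r^2 \<le> 1" using s r by (simp_all add: abs_square_le_1)
  have P: "Re P > 0" and Q: "Re Q > 0"
    unfolding d using Re_csqrt_pos[OF one_minus_slit_not_nonpos[OF x(1) zero_le_power2 s2(1)]] Re_csqrt_pos[OF one_minus_slit_not_nonpos[OF x(2) zero_le_power2 s2(2)]] by (simp_all only:)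
  have PQ: "Re (P * cnj Q) > 0"
  proof (cases "r = 0 \<or> s = 0")
    case True
    thus ?thesis
    proof
      assume "r = 0" thus ?thesis using P by (simp add: d)
    next
      assume "s = 0" thus ?thesis using Q by (simp add: d)
    qed
  next
    case False
    hence rs: "r > 0" "s > 0" using r s by auto
    have eq: "(of_real r * P)^2 + (of_real s * Q)^2 = of_real (r^2 + s^2 - r^2 * s^2)"
      by (simp add: d power_mult_distrib algebra_simps)
    have "r^2 * s^2 \<le> 1 * s^2" using s2 by (intro mult_right_mono) auto
    moreover have "r^2 > 0" using rs by simp
    ultimately have "0 < r^2 + s^2 - r^2 * s^2" by linarith
    hence im: "Im ((of_real r * P)^2 + (of_real s * Q)^2) = 0" and re: "Re ((of_real r * P)^2 + (of_real s * Q)^2) > 0"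
      unfolding eq Im_complex_of_real Re_complex_of_real by simp_all
    have "Re (of_real r * P) > 0" "Re (of_real s * Q) > 0" using P Q rs by simp_all
    from Re_mult_cnj_pos_of_sum_squares[OF this im re] have "Re (of_real (r * s) * (P * cnj Q)) > 0"
      by (simp add: mult_ac)
    hence "0 < r * s * Re (P * cnj Q)" unfolding Re_complex_of_real times_complex.sel Im_complex_of_real by simp
    moreover have "0 < r * s" using rs by simp
    ultimately show ?thesis by (rule zero_less_mult_pos)
  qed
  have "(1 / P) * cnj (1 / Q) = inverse (P * cnj Q)"
    by (simp only: divide_inverse complex_cnj_mult complex_cnj_inverse complex_cnj_one mult_1 inverse_mult_distrib)
  moreover have "Re (inverse (P * cnj Q)) > 0"
    unfolding inverse_complex.sel using PQ by (intro divide_pos_pos add_pos_nonneg zero_less_power zero_le_power2)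
  ultimately show ?thesis unfolding d by (simp only:)
qed

text \<open>The double integral of a positive function. Dividing by \<open>|K'|\<^sup>2\<close>, it says that \<open>K / K'\<close> lies in the right half-plane,
  so that \<open>\<i> K / K'\<close> is a legitimate argument \<open>\<tau>\<close>.\<close>

lemma ell_K_Re_pos:
  assumes x: "x \<in> cut_plane"
  shows "Re (ell_K x * cnj (ell_K (1 - x))) > 0"
proof -
  have xs: "x \<in> slit" "1 - x \<in> slit" using x by (simp_all add: cut_plane_iff)
  define f where "f = (\<lambda>t::real. 1 / csqrt (1 - x * of_real (sin t ^ 2)))"
  define g where "g = (\<lambda>t::real. 1 / csqrt (1 - (1 - x) * of_real (sin t ^ 2)))"
  have cont: "continuous_on A f" "continuous_on A g" for A
    unfolding f_def g_def by (intro ell_K_integrand_continuous xs)+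
  have K: "(f has_integral ell_K x) {0..pi/2}" "(g has_integral ell_K (1 - x)) {0..pi/2}"
    unfolding f_def g_def by (intro ell_K_has_integral xs)+
  have pos: "integral {0..pi/2} h > 0" if "continuous_on {0..pi/2} h" "\<And>t. t \<in> {0..pi/2} \<Longrightarrow> h t > 0" for h :: "real \<Rightarrow> real"
  proof -
    have "{0<..<pi/2} \<noteq> {}" using pi_half_gt_zero greaterThanLessThan_empty_iff[of 0 "pi/2"] by linarith
    from integral_less_real[OF continuous_on_const that(1) this, of 0] that(2) show ?thesis by simp
  qed
  have s01: "0 \<le> sin t" "sin t \<le> 1" if "t \<in> {0..pi/2}" for t :: real
    using that by (auto intro!: sin_ge_zero)
  have 1: "Re (ell_K x * cnj (g r)) > 0" if r: "r \<in> {0..pi/2}" for r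
  proof -
    have bl: "bounded_linear (\<lambda>z. Re (z * cnj (g r)))"
      by (intro bounded_linear_compose[OF bounded_linear_Re] bounded_linear_mult_left)
    from has_integral_linear[OF K(1) bl]
    have "((\<lambda>t. Re (f t * cnj (g r))) has_integral Re (ell_K x * cnj (g r))) {0..pi/2}" by (simp add: o_def)
    moreover have "integral {0..pi/2} (\<lambda>t. Re (f t * cnj (g r))) > 0"
    proof (rule pos)
      show "continuous_on {0..pi/2} (\<lambda>t. Re (f t * cnj (g r)))" by (intro continuous_intros cont)
      show "Re (f t * cnj (g r)) > 0" if "t \<in> {0..pi/2}" for t
        unfolding f_def g_def by (rule ell_K_integrands_Re_pos[OF xs s01[OF that] s01[OF r]])
    qed
    ultimately show ?thesis by (simp add: integral_unique)
  qed
  have bl: "bounded_linear (\<lambda>z. Re (ell_K x * cnj z))"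
    by (intro bounded_linear_compose[OF bounded_linear_Re] bounded_linear_compose[OF bounded_linear_mult_right] bounded_linear_cnj)
  from has_integral_linear[OF K(2) bl]
  have "((\<lambda>r. Re (ell_K x * cnj (g r))) has_integral Re (ell_K x * cnj (ell_K (1 - x)))) {0..pi/2}" by (simp add: o_def)
  moreover have "integral {0..pi/2} (\<lambda>r. Re (ell_K x * cnj (g r))) > 0"
    by (rule pos, intro continuous_intros cont, rule 1)
  ultimately show ?thesis by (simp add: integral_unique)
qed

section \<open>Inversion of the period ratio\<close>

text \<open>A function \<open>N\<close> that runs from 0 to 1 and satisfies the differential equation of the square of the Jacobian sine
  is monotone, because Rolle's theorem excludes that a value is taken twice; the substitution
  \<open>N = sin\<^sup>2 \<phi>\<close> then computes the complete elliptic integral.\<close>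

lemma complete_elliptic_integral_real:
  fixes N N' :: "real \<Rightarrow> real"
  assumes l: "l > 0" and k: "0 \<le> k" "k < 1" and c: "c > 0"
    and cont: "continuous_on {0..l} N" and N0: "N 0 = 0" and Nl: "N l = 1"
    and der: "\<And>y. 0 < y \<Longrightarrow> y < l \<Longrightarrow> (N has_real_derivative N' y) (at y)"
    and ne: "\<And>y. 0 < y \<Longrightarrow> y < l \<Longrightarrow> N' y \<noteq> 0"
    and sq: "\<And>y. 0 < y \<Longrightarrow> y < l \<Longrightarrow> (N' y)^2 = 4 * c^2 * (N y * (1 - N y) * (1 - k * N y))"
  shows "integral {0..pi/2} (\<lambda>t. 1 / sqrt (1 - k * sin t ^ 2)) = c * l"
proof -
  have inj: "N a \<noteq> N b" if ab: "0 \<le> a" "a < b" "b \<le> l" for a b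
  proof
    assume eq: "N a = N b"
    have "\<exists>z. a < z \<and> z < b \<and> (N has_real_derivative 0) (at z)"
    proof (rule Rolle[OF ab(2) eq])
      show "continuous_on {a..b} N" by (rule continuous_on_subset[OF cont]) (use ab in auto)
      show "N differentiable (at y)" if "a < y" "y < b" for y
        using der[of y] that ab by (auto simp: real_differentiable_def)
    qed
    then obtain z where z: "a < z" "z < b" "(N has_real_derivative 0) (at z)" by blast
    have "N' z = 0" using DERIV_unique[OF der z(3)] z ab by auto
    thus False using ne[of z] z ab by auto
  qed
  have c': "continuous_on {a..b} N" if "0 \<le> a" "b \<le> l" for a b
    by (rule continuous_on_subset[OF cont]) (use that in auto)
  have pos: "0 < N y" if y: "0 < y" "y < l" for y
  proof (rule ccontr)
    assume "\<not> 0 < N y"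
    then obtain z where "y \<le> z" "z \<le> l" "N z = 0"
      using IVT'[of N y 0 l] c'[of y l] y Nl by auto
    thus False using inj[of 0 z] N0 y by auto
  qed
  have lt1: "N y < 1" if y: "0 < y" "y < l" for y
  proof (rule ccontr)
    assume "\<not> N y < 1"
    then obtain z where "0 \<le> z" "z \<le> y" "N z = 1"
      using IVT'[of N 0 1 y] c'[of 0 y] y N0 by auto
    thus False using inj[of z l] Nl y by auto
  qed
  have N'pos: "N' y > 0" if y: "0 < y" "y < l" for y
  proof (rule ccontr)
    assume "\<not> N' y > 0"
    hence "N' y < 0" using ne[OF y] by simp
    from DERIV_neg_dec_right[OF der[OF y] this] obtain d where d: "d > 0" "\<And>h. h > 0 \<Longrightarrow> h < d \<Longrightarrow> N (y + h) < N y"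
      by blast
    define h where "h = min d (l - y) / 2"
    have h: "h > 0" "h < d" "y + h < l" using d(1) y by (auto simp: h_def min_def field_simps)
    obtain z where "y + h \<le> z" "z \<le> l" "N z = N y"
      using IVT'[of N "y + h" "N y" l] c'[of "y + h" l] d(2)[OF h(1,2)] lt1[OF y] h y Nl by auto
    thus False using inj[of y z] y h by auto
  qed
  define f where "f = (\<lambda>t. 1 / sqrt (1 - k * sin t ^ 2))"
  define F where "F = (\<lambda>p. integral {0..p} f)"
  have rad: "1 - k * sin t ^ 2 > 0" for t
  proof -
    have "k * sin t ^ 2 \<le> k * 1" using k by (intro mult_left_mono) (simp_all add: sin_sq_le_1)
    thus ?thesis using k by simp
  qed
  have fc: "continuous_on A f" for A
    unfolding f_def using rad by (intro continuous_intros) (auto simp: less_imp_neq[symmetric])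
  have Fd: "(F has_real_derivative f p) (at p within {0..pi/2})" if "p \<in> {0..pi/2}" for p
    unfolding F_def by (rule integral_has_real_derivative[OF fc that])
  have Fd': "(F has_real_derivative f p) (at p)" if "0 < p" "p < pi/2" for p
    using Fd[of p] that at_within_interior[of p "{0..pi/2}"] by (simp add: interior_atLeastAtMost_real)
  have Fc: "continuous_on {0..pi/2} F"
    by (rule DERIV_continuous_on[OF Fd])
  \<comment> \<open>\<open>F (\<phi> y) - c y\<close> has derivative 0, where \<open>F\<close> is the incomplete integral.\<close>
  define \<phi> where "\<phi> = (\<lambda>y. arcsin (sqrt (N y)))"
  have N01: "0 \<le> N y" "N y \<le> 1" if "y \<in> {0..l}" for y
    using that pos[of y] lt1[of y] N0 Nl by (cases "y = 0"; cases "y = l"; force)+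
  have \<phi>c: "continuous_on {0..l} \<phi>"
    unfolding \<phi>_def
    by (intro continuous_on_compose2[OF continuous_on_arcsin'] continuous_on_arcsin continuous_intros cont ballI conjI)
       (use N01 in \<open>auto intro: order_trans[OF _ real_sqrt_ge_zero]\<close>)
  have \<phi>r: "\<phi> y \<in> {0..pi/2}" if "y \<in> {0..l}" for y
  proof -
    have s: "0 \<le> sqrt (N y)" "sqrt (N y) \<le> 1" using N01[OF that] by simp_all
    hence "- 1 \<le> sqrt (N y)" by linarith
    thus ?thesis
      unfolding \<phi>_def using arcsin_le_arcsin[of 0 "sqrt (N y)"] arcsin_le_arcsin[of "sqrt (N y)" 1] s by simp
  qed
  have "F (\<phi> l) - c * l = F (\<phi> 0) - c * 0"
  proof (rule DERIV_isconst_end[OF l])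
    show "continuous_on {0..l} (\<lambda>y. F (\<phi> y) - c * y)"
      by (intro continuous_on_diff continuous_on_compose2[OF Fc \<phi>c] continuous_intros) (use \<phi>r in blast)
    fix y assume y: "0 < y" "y < l"
    define n where "n = N y"
    have n: "0 < n" "n < 1" using pos[OF y] lt1[OF y] by (simp_all add: n_def)
    have sn: "0 < sqrt n" "sqrt n < 1" using n by simp_all
    hence sn': "- 1 \<le> sqrt n" by linarith
    have kn: "1 - k * n > 0" using rad[of "arcsin (sqrt n)"] n sn sn' by (simp add: sin_arcsin)
    have "(\<phi> has_real_derivative inverse (sqrt (1 - (sqrt n)^2)) * (N' y * (inverse (sqrt n) / 2))) (at y)"
      unfolding \<phi>_def
    proof (rule DERIV_chain2[where f = arcsin and g = "\<lambda>y. sqrt (N y)"])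
      show "(arcsin has_real_derivative inverse (sqrt (1 - (sqrt n)^2))) (at (sqrt (N y)))"
        unfolding n_def[symmetric] by (rule DERIV_arcsin) (use sn in linarith)+
      show "((\<lambda>y. sqrt (N y)) has_real_derivative N' y * (inverse (sqrt n) / 2)) (at y)"
        using DERIV_chain2[OF DERIV_real_sqrt[of "N y"] der[OF y]] n by (simp add: n_def mult.commute)
    qed
    moreover have "0 < \<phi> y" "\<phi> y < pi / 2"
      unfolding \<phi>_def using arcsin_less_arcsin[of 0 "sqrt n"] arcsin_less_arcsin[of "sqrt n" 1] sn sn' by (simp_all add: n_def)
    ultimately have d: "((\<lambda>y. F (\<phi> y)) has_real_derivative f (\<phi> y) * (inverse (sqrt (1 - (sqrt n)^2)) * (N' y * (inverse (sqrt n) / 2)))) (at y)"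
      using DERIV_chain2[OF Fd'] by blast
    have N'y: "N' y = 2 * c * (sqrt n * sqrt (1 - n) * sqrt (1 - k * n))"
    proof -
      have "N' y = sqrt ((N' y)^2)" using N'pos[OF y] by simp
      also have "\<dots> = sqrt ((2 * c)^2 * (n * (1 - n) * (1 - k * n)))"
        unfolding sq[OF y] by (simp add: n_def power_mult_distrib)
      also have "\<dots> = 2 * c * (sqrt n * sqrt (1 - n) * sqrt (1 - k * n))"
        using c by (simp add: real_sqrt_mult)
      finally show ?thesis .
    qed
    have "f (\<phi> y) = 1 / sqrt (1 - k * n)"
      using sn sn' n by (simp add: f_def \<phi>_def n_def sin_arcsin)
    hence "f (\<phi> y) * (inverse (sqrt (1 - (sqrt n)^2)) * (N' y * (inverse (sqrt n) / 2))) = c"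
      unfolding N'y using n kn by (simp add: field_simps)
    with d have "((\<lambda>y. F (\<phi> y)) has_real_derivative c) (at y)" by simp
    from DERIV_diff[OF this DERIV_cmult_Id[of c]] show "((\<lambda>y. F (\<phi> y) - c * y) has_real_derivative 0) (at y)" by simp
  qed
  thus ?thesis by (simp add: \<phi>_def N0 Nl F_def f_def)
qed

lemma ell_K_of_real:
  assumes k: "0 \<le> k" "k < 1"
  shows "ell_K (of_real k) = of_real (integral {0..pi/2} (\<lambda>t. 1 / sqrt (1 - k * sin t ^ 2)))"
proof -
  have rad: "1 - k * sin t ^ 2 > 0" for t
  proof -
    have "k * sin t ^ 2 \<le> k * 1" using k by (intro mult_left_mono) (simp_all add: sin_sq_le_1)
    thus ?thesis using k by simp
  qed
  have eq: "1 / csqrt (1 - of_real k * of_real (sin t ^ 2)) = complex_of_real (1 / sqrt (1 - k * sin t ^ 2))" for t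
  proof -
    have "1 - of_real k * of_real (sin t ^ 2) = complex_of_real (1 - k * sin t ^ 2)" by simp
    moreover have "csqrt (complex_of_real (1 - k * sin t ^ 2)) = complex_of_real (sqrt (1 - k * sin t ^ 2))"
      by (rule of_real_sqrt[symmetric]) (use rad[of t] in simp)
    ultimately show ?thesis by (simp only: of_real_divide of_real_1)
  qed
  have "continuous_on {0..pi/2} (\<lambda>t. 1 / sqrt (1 - k * sin t ^ 2))"
    using rad by (intro continuous_intros) (auto simp: less_imp_neq[symmetric])
  hence "((\<lambda>t. 1 / sqrt (1 - k * sin t ^ 2)) has_integral integral {0..pi/2} (\<lambda>t. 1 / sqrt (1 - k * sin t ^ 2))) {0..pi/2}"
    by (intro integrable_integral integrable_continuous_real)
  from has_integral_of_real[OF this, where ?'b = complex] show ?thesis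
    unfolding ell_K_def eq by (rule integral_unique)
qed

text \<open>The form in which the integral is used: \<open>G\<close> is an elliptic function and \<open>\<alpha>\<close> is the direction of one of its periods,
  along which it is real.\<close>

lemma ell_K_from_real_curve:
  fixes G :: "complex \<Rightarrow> complex"
  assumes l: "l > 0" and k: "0 \<le> k" "k < 1" and c: "c > 0"
    and real: "\<And>y::real. G (\<alpha> * of_real y) \<in> \<real>"
    and cont: "continuous_on {0..l} (\<lambda>y. G (\<alpha> * of_real y))" and G0: "G 0 = 0" and Gl: "G (\<alpha> * of_real l) = 1"
    and der: "\<And>y. 0 < y \<Longrightarrow> y < l \<Longrightarrow> (G has_field_derivative D y) (at (\<alpha> * of_real y))"
    and ne: "\<And>y. 0 < y \<Longrightarrow> y < l \<Longrightarrow> \<alpha> * D y \<noteq> 0"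
    and sq: "\<And>y. 0 < y \<Longrightarrow> y < l \<Longrightarrow> (\<alpha> * D y)^2 = 4 * of_real c^2 *
        (G (\<alpha> * of_real y) * (1 - G (\<alpha> * of_real y)) * (1 - of_real k * G (\<alpha> * of_real y)))"
  shows "ell_K (of_real k) = of_real (c * l)"
proof -
  define N where "N = (\<lambda>y::real. Re (G (\<alpha> * of_real y)))"
  have GN: "G (\<alpha> * of_real y) = of_real (N y)" for y
    unfolding N_def using real[of y] by (metis of_real_Re)
  have d: "(N has_real_derivative Re (\<alpha> * D y)) (at y) \<and> \<alpha> * D y = of_real (Re (\<alpha> * D y))" if y: "0 < y" "y < l" for y
  proof -
    have "((\<lambda>y. \<alpha> * complex_of_real y) has_vector_derivative \<alpha>) (at y)"
      by (auto intro!: derivative_eq_intros simp: has_vector_derivative_def scaleR_conv_of_real mult_ac)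
    from field_vector_diff_chain_at[OF this der[OF y]]
    have v: "((\<lambda>y. G (\<alpha> * of_real y)) has_vector_derivative \<alpha> * D y) (at y)"
      by (simp add: o_def)
    from bounded_linear.has_vector_derivative[OF bounded_linear_Re this]
    have r: "(N has_vector_derivative Re (\<alpha> * D y)) (at y)" by (simp add: N_def)
    from bounded_linear.has_vector_derivative[OF bounded_linear_of_real this]
    have "((\<lambda>y. G (\<alpha> * of_real y)) has_vector_derivative of_real (Re (\<alpha> * D y))) (at y)" by (simp add: GN)
    with v have "\<alpha> * D y = of_real (Re (\<alpha> * D y))" by (rule vector_derivative_unique_at)
    thus ?thesis using r by (simp add: has_real_derivative_iff_has_vector_derivative)
  qed
  have "integral {0..pi/2} (\<lambda>t. 1 / sqrt (1 - k * sin t ^ 2)) = c * l"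
  proof (rule complete_elliptic_integral_real[OF l k c, where N = N and N' = "\<lambda>y. Re (\<alpha> * D y)"])
    show "continuous_on {0..l} N" unfolding N_def by (intro continuous_on_Re cont)
    show "N 0 = 0" using G0 by (simp add: N_def)
    show "N l = 1" using Gl by (simp add: N_def)
    fix y assume y: "0 < y" "y < l"
    show "(N has_real_derivative Re (\<alpha> * D y)) (at y)" using d[OF y] by blast
    show "Re (\<alpha> * D y) \<noteq> 0" using d[OF y] ne[OF y] by (metis of_real_0)
    have "complex_of_real ((Re (\<alpha> * D y))^2) = (\<alpha> * D y)^2" using d[OF y] by (metis of_real_power)
    also have "\<dots> = of_real (4 * c^2 * (N y * (1 - N y) * (1 - k * N y)))"
      unfolding sq[OF y] GN by simp
    finally show "(Re (\<alpha> * D y))^2 = 4 * c^2 * (N y * (1 - N y) * (1 - k * N y))"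
      unfolding of_real_eq_iff .
  qed
  thus ?thesis using ell_K_of_real[OF k] by simp
qed

text \<open>For \<open>\<tau>\<close> on the imaginary axis the zeros of a theta function form the rectangular lattice \<open>\<int> + \<i> t \<int>\<close> or its translate by a
  half period; on the axes this is a question about the real and imaginary parts separately.\<close>

lemma theta_zero_free_on_axes:
  fixes t y :: real
  assumes t: "t > 0"
  defines "\<tau> \<equiv> \<i> * of_real t"
  shows "0 < y \<Longrightarrow> y \<le> 1/2 \<Longrightarrow> theta1 (of_real y) \<tau> \<noteq> 0"
    and "0 < y \<Longrightarrow> y < 1/2 \<Longrightarrow> theta2 (of_real y) \<tau> \<noteq> 0"
    and "theta3 (of_real y) \<tau> \<noteq> 0" and "theta4 (of_real y) \<tau> \<noteq> 0"
    and "0 < y \<Longrightarrow> y \<le> t/2 \<Longrightarrow> theta1 (\<i> * of_real y) \<tau> \<noteq> 0"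
    and "theta2 (\<i> * of_real y) \<tau> \<noteq> 0" and "theta3 (\<i> * of_real y) \<tau> \<noteq> 0"
    and "0 < y \<Longrightarrow> y < t/2 \<Longrightarrow> theta4 (\<i> * of_real y) \<tau> \<noteq> 0"
proof -
  have \<tau>: "Im \<tau> > 0" using t by (simp add: \<tau>_def)
  have half: False if "1/2 = real_of_int n" for n
  proof -
    have "1 = 2 * n" using that by linarith
    thus False by presburger
  qed
  have halft: False if "t / 2 = real_of_int n * t" for n
  proof -
    have "t * (1/2) = t * real_of_int n" using that by (simp add: mult.commute)
    hence "1/2 = real_of_int n" using t by (metis less_irrefl mult_left_cancel)
    thus False by (rule half)
  qed
  have between: False if "0 < r" "r < 1" "r = real_of_int n" for r n
    using that by simp
  show "theta1 (of_real y) \<tau> \<noteq> 0" if y: "0 < y" "y \<le> 1/2"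
  proof
    assume "theta1 (of_real y) \<tau> = 0"
    then obtain m n :: int where "of_real y = of_int m + of_int n * \<tau>" using theta1_zero_imp_lattice[OF \<tau>] by blast
    hence "y = m" by (auto simp: complex_eq_iff \<tau>_def)
    with between[of y m] y show False by simp
  qed
  show "theta2 (of_real y) \<tau> \<noteq> 0" if y: "0 < y" "y < 1/2"
  proof
    assume "theta2 (of_real y) \<tau> = 0"
    then obtain m n :: int where "of_real y + 1/2 = of_int m + of_int n * \<tau>" using theta2_zero_imp_lattice[OF \<tau>] by blast
    hence "y + 1/2 = m" by (auto simp: complex_eq_iff \<tau>_def)
    with between[of "y + 1/2" m] y show False by simp
  qed
  show "theta3 (of_real y) \<tau> \<noteq> 0"
  proof
    assume "theta3 (of_real y) \<tau> = 0"
    then obtain m n :: int where "of_real y + \<tau>/2 + 1/2 = of_int m + of_int n * \<tau>" using theta3_zero_imp_lattice[OF \<tau>] by blast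
    hence "t / 2 = n * t" by (auto simp: complex_eq_iff \<tau>_def)
    thus False by (rule halft)
  qed
  show "theta4 (of_real y) \<tau> \<noteq> 0"
  proof
    assume "theta4 (of_real y) \<tau> = 0"
    then obtain m n :: int where "of_real y + \<tau>/2 = of_int m + of_int n * \<tau>" using theta4_zero_imp_lattice[OF \<tau>] by blast
    hence "t / 2 = n * t" by (auto simp: complex_eq_iff \<tau>_def)
    thus False by (rule halft)
  qed
  show "theta1 (\<i> * of_real y) \<tau> \<noteq> 0" if y: "0 < y" "y \<le> t/2"
  proof
    assume "theta1 (\<i> * of_real y) \<tau> = 0"
    then obtain m n :: int where "\<i> * of_real y = of_int m + of_int n * \<tau>" using theta1_zero_imp_lattice[OF \<tau>] by blast
    hence "y = n * t" by (auto simp: complex_eq_iff \<tau>_def)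
    hence "y / t = n" using t by (simp add: field_simps)
    moreover have "0 < y / t" "y / t < 1" using y t by (simp_all add: field_simps)
    ultimately show False using between[of "y / t" n] by simp
  qed
  show "theta2 (\<i> * of_real y) \<tau> \<noteq> 0"
  proof
    assume "theta2 (\<i> * of_real y) \<tau> = 0"
    then obtain m n :: int where "\<i> * of_real y + 1/2 = of_int m + of_int n * \<tau>" using theta2_zero_imp_lattice[OF \<tau>] by blast
    hence "1 / 2 = real_of_int m" by (auto simp: complex_eq_iff \<tau>_def)
    with half show False by blast
  qed
  show "theta3 (\<i> * of_real y) \<tau> \<noteq> 0"
  proof
    assume "theta3 (\<i> * of_real y) \<tau> = 0"
    then obtain m n :: int where "\<i> * of_real y + \<tau>/2 + 1/2 = of_int m + of_int n * \<tau>" using theta3_zero_imp_lattice[OF \<tau>] by blast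
    hence "1 / 2 = real_of_int m" by (auto simp: complex_eq_iff \<tau>_def)
    with half show False by blast
  qed
  show "theta4 (\<i> * of_real y) \<tau> \<noteq> 0" if y: "0 < y" "y < t/2"
  proof
    assume "theta4 (\<i> * of_real y) \<tau> = 0"
    then obtain m n :: int where "\<i> * of_real y + \<tau>/2 = of_int m + of_int n * \<tau>" using theta4_zero_imp_lattice[OF \<tau>] by blast
    hence "y + t / 2 = n * t" by (auto simp: complex_eq_iff \<tau>_def)
    hence "y / t + 1 / 2 = n" using t by (simp add: field_simps)
    moreover have "0 < y / t + 1 / 2" "y / t + 1 / 2 < 1" using y t by (simp_all add: field_simps)
    ultimately show False using between[of "y / t + 1/2" n] by simp
  qed
qed

lemma theta_half_period_values:
  "theta2 (1/2) \<tau> = 0" "theta4 (\<tau>/2) \<tau> = 0"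
proof -
  show "theta2 (1/2) \<tau> = 0"
    using theta1_shift_half[of "1/2" \<tau>] theta1_shift_1[of 0 \<tau>] by simp
  obtain c where c: "c \<noteq> 0" "theta1 (\<tau>/2 + \<tau>/2) \<tau> = c * theta4 (\<tau>/2) \<tau>"
    using theta1_shift_half_tau by blast
  have "theta1 (\<tau>/2 + \<tau>/2) \<tau> = 0" using theta1_shift_tau[of 0 \<tau>] by simp
  thus "theta4 (\<tau>/2) \<tau> = 0" using c by simp
qed

context
  fixes t :: real and \<tau> :: complex
  assumes t: "t > 0" and \<tau>_eq: "\<tau> = \<i> * of_real t"
begin

lemma Im_\<tau>: "Im \<tau> > 0" and cnj_\<tau>: "cnj \<tau> = - \<tau>"
  using t by (simp_all add: \<tau>_eq)

lemma theta_constants_real: "theta2 0 \<tau> \<in> \<real>" "theta3 0 \<tau> \<in> \<real>" "theta4 0 \<tau> \<in> \<real>"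
  using theta_conj[OF cnj_\<tau>, of 0] by (simp_all add: Reals_cnj_iff)

lemma theta_lambda_real: "\<exists>k. theta_lambda \<tau> = of_real k \<and> 0 < k \<and> k < 1"
proof -
  obtain b c d where b: "theta2 0 \<tau> = of_real b" and c: "theta3 0 \<tau> = of_real c" and d: "theta4 0 \<tau> = of_real d"
    using theta_constants_real by (auto elim!: Reals_cases)
  have nz: "b \<noteq> 0" "c \<noteq> 0" "d \<noteq> 0" using theta_constants_nonzero[OF Im_\<tau>] b c d by auto
  have l: "theta_lambda \<tau> = of_real ((d / c)^4)" unfolding theta_lambda_def c d by simp
  have "complex_of_real (b^4 + d^4) = of_real (c^4)"
    using theta_square_relations(3)[OF Im_\<tau>] unfolding b c d by simp
  hence "b^4 + d^4 = c^4" by (simp only: of_real_eq_iff)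
  moreover have "b^4 > 0" "c^4 > 0" "d^4 > 0" using nz by (simp_all add: zero_less_power_eq)
  ultimately have "d^4 < c^4" "d^4 > 0" "c^4 > 0" by linarith+
  hence "0 < (d/c)^4" "(d/c)^4 < 1" unfolding power_divide by (simp_all only: zero_less_divide_iff divide_less_eq_1) auto
  thus ?thesis using l by blast
qed

text \<open>On the segment from 0 to \<open>1/2\<close> the function \<open>1 / (1 - U)\<close>, the square of the Jacobian sine, runs from
  0 to 1; on the segment from 0 to \<open>\<tau>/2\<close> the function \<open>1 / U\<close> does.\<close>

lemma theta_inversion_imaginary_axis:
  "ell_K (1 - theta_lambda \<tau>) = of_real pi / 2 * (theta3 0 \<tau>)^2"
  "ell_K (theta_lambda \<tau>) = of_real t * (of_real pi / 2 * (theta3 0 \<tau>)^2)"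
proof -
  obtain k where k: "theta_lambda \<tau> = of_real k" "0 < k" "k < 1" using theta_lambda_real by blast
  obtain c0 where c0: "theta3 0 \<tau> = of_real c0" using theta_constants_real(2) by (auto elim!: Reals_cases)
  note nz = theta_constants_nonzero[OF Im_\<tau>]
  have "c0 \<noteq> 0" using nz c0 by auto
  define c where "c = pi * c0^2"
  have c: "c > 0" using \<open>c0 \<noteq> 0\<close> by (simp add: c_def)
  have cc: "of_real c = of_real pi * (theta3 0 \<tau>)^2" by (simp add: c_def c0)
  note zf = theta_zero_free_on_axes[OF t, folded \<tau>_eq]
  have hc: "continuous_on A (\<lambda>z. theta1 z \<tau>)" "continuous_on A (\<lambda>z. theta2 z \<tau>)" "continuous_on A (\<lambda>z. theta4 z \<tau>)" for A
    by (intro holomorphic_on_imp_continuous_on theta_holomorphic Im_\<tau>)+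
  have Vsq: "(ell_V z \<tau>)^2 = - 4 * of_real c^2 * (ell_U z \<tau> * (ell_U z \<tau> - 1) * (ell_U z \<tau> - of_real k))"
    if "theta1 z \<tau> \<noteq> 0" for z
    using ell_V_squared[OF Im_\<tau> that] unfolding k(1) cc by (simp add: power_mult_distrib)
  have V0: "ell_V z \<tau> \<noteq> 0" if "theta1 z \<tau> \<noteq> 0" "theta2 z \<tau> \<noteq> 0" "theta3 z \<tau> \<noteq> 0" "theta4 z \<tau> \<noteq> 0" for z
    using that nz by (simp add: ell_V_def)
  have ev: "\<forall>\<^sub>F w in nhds z. theta1 w \<tau> \<noteq> 0" if "theta1 z \<tau> \<noteq> 0" for z
    using eventually_nhds_in_open[OF open_theta1_nonzero[OF Im_\<tau>], of z] that by simp

  define G where "G = (\<lambda>z. (theta3 0 \<tau> / theta2 0 \<tau>)^2 * (theta1 z \<tau> / theta4 z \<tau>)^2)"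
  have GU: "G z = 1 / (1 - ell_U z \<tau>)" if "theta1 z \<tau> \<noteq> 0" for z
  proof -
    have "1 - ell_U z \<tau> = (theta2 0 \<tau> / theta3 0 \<tau>)^2 * (theta4 z \<tau> / theta1 z \<tau>)^2"
      using ell_U_minus(1)[OF Im_\<tau> that] by (simp add: algebra_simps)
    thus ?thesis by (simp add: G_def power_divide)
  qed
  have "ell_K (of_real (1 - k)) = of_real (c * (1/2))"
  proof (rule ell_K_from_real_curve[where \<alpha> = 1 and G = G and D = "\<lambda>y. ell_V (of_real y) \<tau> / (1 - ell_U (of_real y) \<tau>)^2"])
    show "G (1 * of_real y) \<in> \<real>" for y :: real
      using theta_constants_real theta_conj[OF cnj_\<tau>, of "of_real y"]
      unfolding G_def by (intro Reals_mult Reals_power Reals_divide) (simp_all add: Reals_cnj_iff)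
    show "continuous_on {0..1/2} (\<lambda>y::real. G (1 * of_real y))"
      unfolding G_def
      by (intro continuous_on_mult continuous_on_power continuous_on_divide continuous_on_const
            continuous_on_compose2[OF hc(1)] continuous_on_compose2[OF hc(3)] continuous_intros)
         (use zf(4) in auto)
    show "G 0 = 0" by (simp add: G_def)
    have "theta1 (1/2) \<tau> \<noteq> 0" using zf(1)[of "1/2"] by simp
    thus "G (1 * of_real (1/2)) = 1"
      using GU[of "1/2"] theta_half_period_values(1)[of \<tau>] by (simp add: ell_U_def)
    fix y :: real assume y: "0 < y" "y < 1/2"
    let ?z = "complex_of_real y"
    have t1: "theta1 ?z \<tau> \<noteq> 0" and t2: "theta2 ?z \<tau> \<noteq> 0" using zf(1,2)[of y] y by simp_all
    have U1: "1 - ell_U ?z \<tau> \<noteq> 0"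
    proof -
      have "ell_U ?z \<tau> - 1 \<noteq> 0" unfolding ell_U_minus(1)[OF Im_\<tau> t1] using nz t1 zf(4)[of y] by simp
      thus ?thesis by simp
    qed
    from DERIV_divide[OF DERIV_const[of 1] DERIV_diff[OF DERIV_const[of 1] ell_U_DERIV[OF Im_\<tau> t1]] U1]
    have "((\<lambda>z. 1 / (1 - ell_U z \<tau>)) has_field_derivative ell_V ?z \<tau> / (1 - ell_U ?z \<tau>)^2) (at ?z)"
      by (simp add: power2_eq_square)
    moreover have "\<forall>\<^sub>F w in nhds ?z. G w = 1 / (1 - ell_U w \<tau>)"
      using ev[OF t1] by eventually_elim (rule GU)
    ultimately have "(G has_field_derivative ell_V ?z \<tau> / (1 - ell_U ?z \<tau>)^2) (at ?z)"
      by (subst DERIV_cong_ev[OF refl _ refl]) auto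
    thus "(G has_field_derivative ell_V ?z \<tau> / (1 - ell_U ?z \<tau>)^2) (at (1 * ?z))" by simp
    show "1 * (ell_V ?z \<tau> / (1 - ell_U ?z \<tau>)^2) \<noteq> 0"
      using V0[OF t1 t2 zf(3,4)] U1 by simp
    have alg: "- 4 * q * (W * (W - 1) * (W - K)) / (1 - W)^4 = 4 * q * (1 / (1 - W) * (1 - 1 / (1 - W)) * (1 - (1 - K) * (1 / (1 - W))))"
      if "1 - W \<noteq> 0" for q W K :: complex
    proof -
      define X where "X = 1 - W"
      have W: "W = 1 - X" and X: "X \<noteq> 0" using that by (simp_all add: X_def)
      show ?thesis unfolding W using X by (simp add: field_simps power4_eq_xxxx)
    qed
    have "(1 * (ell_V ?z \<tau> / (1 - ell_U ?z \<tau>)^2))^2 = (ell_V ?z \<tau>)^2 / (1 - ell_U ?z \<tau>)^4"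
      by (simp add: power_divide)
    also have "\<dots> = 4 * of_real c^2 * (G ?z * (1 - G ?z) * (1 - (1 - of_real k) * G ?z))"
      unfolding Vsq[OF t1] GU[OF t1] by (rule alg[OF U1])
    finally show "(1 * (ell_V ?z \<tau> / (1 - ell_U ?z \<tau>)^2))^2 =
        4 * of_real c^2 * (G (1 * ?z) * (1 - G (1 * ?z)) * (1 - of_real (1 - k) * G (1 * ?z)))" by simp
  qed (use k c in auto)
  thus "ell_K (1 - theta_lambda \<tau>) = of_real pi / 2 * (theta3 0 \<tau>)^2"
    using cc by (simp add: k(1))

  define H where "H = (\<lambda>z. - ((theta3 0 \<tau> / theta4 0 \<tau>)^2 * (theta1 z \<tau> / theta2 z \<tau>)^2))"
  have HU: "H z = 1 / ell_U z \<tau>" for z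
    by (simp add: H_def ell_U_def power_divide)
  have "ell_K (of_real k) = of_real (c * (t/2))"
  proof (rule ell_K_from_real_curve[where \<alpha> = \<i> and G = H and D = "\<lambda>y. - ell_V (\<i> * of_real y) \<tau> / (ell_U (\<i> * of_real y) \<tau>)^2"])
    show "H (\<i> * of_real y) \<in> \<real>" for y :: real
    proof -
      have "cnj ((theta1 (\<i> * of_real y) \<tau>)^2) = (theta1 (\<i> * of_real y) \<tau>)^2"
        using theta1_minus[of "\<i> * of_real y" \<tau>] by (simp add: theta_conj[OF cnj_\<tau>])
      moreover have "cnj ((theta2 (\<i> * of_real y) \<tau>)^2) = (theta2 (\<i> * of_real y) \<tau>)^2"
        using theta2_minus[of "\<i> * of_real y" \<tau>] by (simp add: theta_conj[OF cnj_\<tau>])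
      ultimately have "(theta1 (\<i> * of_real y) \<tau>)^2 \<in> \<real>" "(theta2 (\<i> * of_real y) \<tau>)^2 \<in> \<real>"
        by (simp_all only: Reals_cnj_iff)
      hence "(theta1 (\<i> * of_real y) \<tau> / theta2 (\<i> * of_real y) \<tau>)^2 \<in> \<real>"
        unfolding power_divide by (rule Reals_divide)
      moreover have "(theta3 0 \<tau> / theta4 0 \<tau>)^2 \<in> \<real>"
        by (intro Reals_power Reals_divide theta_constants_real)
      ultimately show ?thesis unfolding H_def by (intro Reals_minus Reals_mult)
    qed
    show "continuous_on {0..t/2} (\<lambda>y::real. H (\<i> * of_real y))"
      unfolding H_def
      by (intro continuous_on_minus continuous_on_mult continuous_on_power continuous_on_divide continuous_on_const
            continuous_on_compose2[OF hc(1)] continuous_on_compose2[OF hc(2)] continuous_intros)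
         (use zf(6) in auto)
    show "H 0 = 0" by (simp add: H_def)
    have z: "\<i> * of_real (t/2) = \<tau>/2" by (simp add: \<tau>_eq)
    have "theta1 (\<i> * of_real (t/2)) \<tau> \<noteq> 0" by (rule zf(5)) (use t in simp_all)
    hence "theta1 (\<tau>/2) \<tau> \<noteq> 0" unfolding z .
    from ell_U_minus(1)[OF Im_\<tau> this] have "ell_U (\<tau>/2) \<tau> = 1"
      using theta_half_period_values(2)[of \<tau>] by simp
    thus "H (\<i> * of_real (t/2)) = 1" unfolding z HU by simp
    fix y :: real assume y: "0 < y" "y < t/2"
    let ?z = "\<i> * complex_of_real y"
    have t1: "theta1 ?z \<tau> \<noteq> 0" and t4: "theta4 ?z \<tau> \<noteq> 0" using zf(5,8)[of y] y by simp_all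
    have U: "ell_U ?z \<tau> \<noteq> 0" using nz t1 zf(6)[of y] by (simp add: ell_U_def)
    from DERIV_divide[OF DERIV_const[of 1] ell_U_DERIV[OF Im_\<tau> t1] U]
    show "(H has_field_derivative - ell_V ?z \<tau> / (ell_U ?z \<tau>)^2) (at ?z)"
      unfolding HU[abs_def] by (simp add: power2_eq_square)
    show "\<i> * (- ell_V ?z \<tau> / (ell_U ?z \<tau>)^2) \<noteq> 0"
      using V0[OF t1 zf(6,7) t4] U by simp
    have alg: "- (- 4 * q * (W * (W - 1) * (W - K))) / W^4 = 4 * q * (1 / W * (1 - 1 / W) * (1 - K * (1 / W)))"
      if "W \<noteq> 0" for q W K :: complex
      using that by (simp add: field_simps power4_eq_xxxx)
    have "(\<i> * (- ell_V ?z \<tau> / (ell_U ?z \<tau>)^2))^2 = - ((ell_V ?z \<tau>)^2) / (ell_U ?z \<tau>)^4"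
      by (simp add: power_divide power_mult_distrib)
    also have "\<dots> = 4 * of_real c^2 * (H ?z * (1 - H ?z) * (1 - of_real k * H ?z))"
      unfolding Vsq[OF t1] HU by (rule alg[OF U])
    finally show "(\<i> * (- ell_V ?z \<tau> / (ell_U ?z \<tau>)^2))^2 =
        4 * of_real c^2 * (H ?z * (1 - H ?z) * (1 - of_real k * H ?z))" .
  qed (use k c t in auto)
  thus "ell_K (theta_lambda \<tau>) = of_real t * (of_real pi / 2 * (theta3 0 \<tau>)^2)"
    using cc by (simp add: k(1))
qed

end

definition tau_of :: "complex \<Rightarrow> complex" where
  "tau_of x = \<i> * (K_sqrt x / K'_sqrt x)"

lemma Im_tau_of: "x \<in> cut_plane \<Longrightarrow> Im (tau_of x) > 0" and K'_nonzero: "x \<in> cut_plane \<Longrightarrow> K'_sqrt x \<noteq> 0"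
proof -
  assume x: "x \<in> cut_plane"
  have pos: "Re (K_sqrt x * cnj (K'_sqrt x)) > 0" using ell_K_Re_pos[OF x] by (simp add: K_sqrt_eq[OF x] K'_sqrt_eq[OF x])
  show nz: "K'_sqrt x \<noteq> 0" using pos by auto
  have "K_sqrt x / K'_sqrt x = (K_sqrt x * cnj (K'_sqrt x)) / of_real ((norm (K'_sqrt x))^2)"
    using complex_div_cnj[of "K_sqrt x" "K'_sqrt x"] by (simp only: of_real_power)
  hence "Re (K_sqrt x / K'_sqrt x) = Re (K_sqrt x * cnj (K'_sqrt x)) / (norm (K'_sqrt x))^2"
    by (simp only: Re_divide_of_real)
  also have "\<dots> > 0" using pos nz by (intro divide_pos_pos) simp_all
  finally show "Im (tau_of x) > 0" unfolding tau_of_def by (simp only: Im_i_times)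
qed

lemma open_cut_plane: "open cut_plane"
proof -
  have "cut_plane = slit \<inter> (\<lambda>x. 1 - x) -` slit" by (auto simp: cut_plane_iff)
  moreover have "open (slit \<inter> (\<lambda>x. 1 - x) -` slit)"
    by (intro open_Int open_slit open_vimage continuous_intros)
  ultimately show ?thesis by (simp only:)
qed

text \<open>The set is star-shaped with respect to \<open>1/2\<close>.\<close>

lemma connected_cut_plane: "connected cut_plane"
proof -
  have iff: "x \<in> cut_plane \<longleftrightarrow> Im x \<noteq> 0 \<or> (0 < Re x \<and> Re x < 1)" for x
    by (auto simp: cut_plane_iff slit_iff)
  have "starlike cut_plane"
    unfolding starlike_def
  proof (intro bexI[of _ "1/2"] ballI subsetI)
    fix x y assume x: "x \<in> cut_plane" and "y \<in> closed_segment (1/2) x"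
    then obtain s where s: "0 \<le> s" "s \<le> 1" "y = (1 - s) *\<^sub>R (1/2) + s *\<^sub>R x" by (auto simp: in_segment)
    have Im: "Im y = s * Im x" and Re: "Re y = (1 - s) / 2 + s * Re x" by (simp_all add: s(3))
    show "y \<in> cut_plane"
    proof (cases "Im x = 0 \<or> s = 0")
      case False
      thus ?thesis using Im by (simp add: iff)
    next
      case True
      have "0 < Re y \<and> Re y < 1"
      proof (cases "s = 0")
        case False
        hence "Im x = 0" using True by simp
        hence r: "0 < Re x" "Re x < 1" using x by (auto simp: iff)
        have "0 < s * Re x" "s * Re x < s * 1" using r s False by (intro mult_pos_pos mult_strict_left_mono; simp)+
        moreover have "0 < (1 - s) / 2 + p \<and> (1 - s) / 2 + p < 1" if "0 < p" "p < s * 1" for p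
          using that s(1,2) by (simp add: field_simps)
        ultimately show ?thesis unfolding Re by blast
      qed (simp add: Re)
      thus ?thesis by (simp add: iff)
    qed
  qed (simp add: iff)
  thus ?thesis by (rule starlike_imp_connected)
qed

lemma tau_of_holomorphic: "tau_of holomorphic_on cut_plane"
proof -
  have "(\<lambda>x. ell_K x) holomorphic_on cut_plane"
    by (rule holomorphic_on_subset[OF ell_K_holomorphic]) (auto simp: cut_plane_iff)
  hence 1: "K_sqrt holomorphic_on cut_plane" by (rule holomorphic_transform) (simp add: K_sqrt_eq)
  have "(ell_K \<circ> (\<lambda>x. 1 - x)) holomorphic_on cut_plane"
    by (rule holomorphic_on_compose_gen[OF _ ell_K_holomorphic]) (auto simp: cut_plane_iff intro!: holomorphic_intros)
  hence "(\<lambda>x. ell_K (1 - x)) holomorphic_on cut_plane" by (simp only: o_def)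
  hence 2: "K'_sqrt holomorphic_on cut_plane" by (rule holomorphic_transform) (simp add: K'_sqrt_eq)
  show ?thesis unfolding tau_of_def[abs_def] by (intro holomorphic_intros 1 2 K'_nonzero)
qed

lemma theta_constants_holomorphic:
  "(\<lambda>\<tau>. theta3 0 \<tau>) holomorphic_on {\<tau>. Im \<tau> > 0}" "(\<lambda>\<tau>. theta4 0 \<tau>) holomorphic_on {\<tau>. Im \<tau> > 0}"
  "theta_lambda holomorphic_on {\<tau>. Im \<tau> > 0}"
proof -
  show "(\<lambda>\<tau>. theta3 0 \<tau>) holomorphic_on {\<tau>. Im \<tau> > 0}" "(\<lambda>\<tau>. theta4 0 \<tau>) holomorphic_on {\<tau>. Im \<tau> > 0}"
    unfolding holomorphic_on_def field_differentiable_def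
    by (rule ballI, rule exI, rule has_field_derivative_at_within,
        rule theta_line.theta_constants_DERIV(1) theta_line.theta_constants_DERIV(2), simp)+
  thus "theta_lambda holomorphic_on {\<tau>. Im \<tau> > 0}"
    unfolding theta_lambda_def[abs_def]
    by (intro holomorphic_on_power holomorphic_on_divide) (use theta_constants_nonzero(2) in auto)
qed

text \<open>On the imaginary \<open>\<tau>\<close>-axis the two values of the elliptic integral give \<open>tau_of (theta_lambda \<tau>) = \<tau>\<close>. Hence the claim holds
  for all \<open>x\<close> in the image of the axis, a connected subset of \<open>(0, 1)\<close> with more than one point, and the identity theorem
  extends it to the cut plane.\<close>

theorem theta_lambda_tau_of:
  assumes "x \<in> cut_plane"
  shows "theta_lambda (tau_of x) = x"
proof -
  define S where "S = (\<lambda>t. theta_lambda (\<i> * of_real t)) ` {0<..}"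
  have inv: "theta_lambda (\<i> * of_real t) \<in> cut_plane \<and> tau_of (theta_lambda (\<i> * of_real t)) = \<i> * of_real t"
    if t: "t > 0" for t
  proof -
    define \<tau> where "\<tau> = \<i> * complex_of_real t"
    obtain k where k: "theta_lambda \<tau> = of_real k" "0 < k" "k < 1" using theta_lambda_real[OF t \<tau>_def] by blast
    have c: "theta_lambda \<tau> \<in> cut_plane" unfolding k(1) using k by (simp add: cut_plane_iff slit_iff)
    have "theta3 0 \<tau> \<noteq> 0" by (rule theta_constants_nonzero) (use t in \<open>simp add: \<tau>_def\<close>)
    hence "tau_of (theta_lambda \<tau>) = \<tau>"
      unfolding tau_of_def K_sqrt_eq[OF c] K'_sqrt_eq[OF c] theta_inversion_imaginary_axis[OF t \<tau>_def]
      by (simp add: \<tau>_def)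
    with c show ?thesis by (simp add: \<tau>_def)
  qed
  have S: "S \<subseteq> cut_plane" "theta_lambda \<i> \<in> S"
    unfolding S_def using inv by (auto intro!: image_eqI[of _ _ 1])
  have "connected S" unfolding S_def
  proof (rule connected_continuous_image)
    show "continuous_on {0<..} (\<lambda>t. theta_lambda (\<i> * of_real t))"
      by (rule continuous_on_compose2[OF holomorphic_on_imp_continuous_on[OF theta_constants_holomorphic(3)]])
         (auto intro!: continuous_intros)
  qed (rule connected_Ioi)
  moreover have "S \<noteq> {a}" for a
  proof
    assume a: "S = {a}"
    have "theta_lambda (\<i> * of_real 1) \<in> S" "theta_lambda (\<i> * of_real 2) \<in> S"
      unfolding S_def by (rule imageI; simp)+
    hence "theta_lambda (\<i> * of_real 1) = a" "theta_lambda (\<i> * of_real 2) = a"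
      using a by blast+
    hence "\<i> * of_real 1 = \<i> * complex_of_real 2" using inv[of 1] inv[of 2] by (metis zero_less_one zero_less_numeral)
    thus False by simp
  qed
  ultimately have lp: "theta_lambda \<i> islimpt S" using S(2) by (intro connected_imp_perfect)
  have "theta_lambda (tau_of x) - x = 0"
  proof (rule analytic_continuation[where f = "\<lambda>x. theta_lambda (tau_of x) - x" and S = cut_plane and U = S and \<xi> = "theta_lambda \<i>"])
    have "(theta_lambda \<circ> tau_of) holomorphic_on cut_plane"
      by (rule holomorphic_on_compose_gen[OF tau_of_holomorphic theta_constants_holomorphic(3)]) (use Im_tau_of in auto)
    thus "(\<lambda>x. theta_lambda (tau_of x) - x) holomorphic_on cut_plane"
      by (auto simp: o_def intro!: holomorphic_intros)
    show "theta_lambda (tau_of z) - z = 0" if "z \<in> S" for z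
      using that inv unfolding S_def by auto
  qed (use assms S lp open_cut_plane connected_cut_plane in auto)
  thus ?thesis by simp
qed

text \<open>Both sides have the square \<open>x\<close>, so their quotient is continuous with values \<open>\<plusminus> 1\<close> and constant on the connected cut plane. At
  \<open>x = 1/2\<close>, where \<open>\<tau> = \<i>\<close>, both are nonnegative.\<close>

lemma csqrt_eq_theta_quotient:
  assumes "x \<in> cut_plane"
  shows "csqrt x = (theta4 0 (tau_of x) / theta3 0 (tau_of x))^2"
proof -
  have np: "x \<notin> \<real>\<^sub>\<le>\<^sub>0" if "x \<in> cut_plane" for x
    using that by (auto simp: cut_plane_iff slit_iff complex_nonpos_Reals_iff)
  define q where "q = (\<lambda>x. (theta4 0 (tau_of x) / theta3 0 (tau_of x))^2 / csqrt x)"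
  have q2: "(q x)^2 = 1" if x: "x \<in> cut_plane" for x
  proof -
    have "(q x)^2 = theta_lambda (tau_of x) / x" by (simp add: q_def theta_lambda_def power_divide power_mult_distrib)
    also have "\<dots> = 1" unfolding theta_lambda_tau_of[OF x] using np[OF x] by auto
    finally show ?thesis .
  qed
  have "q constant_on cut_plane"
  proof (rule continuous_finite_range_constant[OF connected_cut_plane])
    have 1: "continuous_on cut_plane (\<lambda>x. theta3 0 (tau_of x))" "continuous_on cut_plane (\<lambda>x. theta4 0 (tau_of x))"
      by (rule continuous_on_compose2[OF holomorphic_on_imp_continuous_on[OF theta_constants_holomorphic(1)]
              holomorphic_on_imp_continuous_on[OF tau_of_holomorphic]]
            continuous_on_compose2[OF holomorphic_on_imp_continuous_on[OF theta_constants_holomorphic(2)]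
              holomorphic_on_imp_continuous_on[OF tau_of_holomorphic]]; use Im_tau_of in blast)+
    have 2: "continuous_on cut_plane csqrt" by (rule continuous_on_csqrt_compose[OF continuous_on_id np])
    have 3: "\<forall>x\<in>cut_plane. csqrt x \<noteq> 0" "\<forall>x\<in>cut_plane. theta3 0 (tau_of x) \<noteq> 0"
      using np[of 0] theta_constants_nonzero Im_tau_of by auto
    show "continuous_on cut_plane q" unfolding q_def
      by (intro continuous_on_divide continuous_on_power 1 2 3)
    have "q ` cut_plane \<subseteq> {1, -1}" using q2 by (auto simp: power2_eq_1_iff)
    thus "finite (q ` cut_plane)" by (rule finite_subset) simp
  qed
  then obtain e where e: "\<And>x. x \<in> cut_plane \<Longrightarrow> q x = e" by (auto simp: constant_on_def)
  define x0 where "x0 = complex_of_real (1/2)"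
  have x0: "x0 \<in> cut_plane" by (simp add: x0_def cut_plane_iff slit_iff)
  have "e = 1"
  proof -
    have "K_sqrt x0 = K'_sqrt x0" by (simp add: K_sqrt_def K'_sqrt_def x0_def)
    hence ti: "tau_of x0 = \<i> * of_real 1" using K'_nonzero[OF x0] by (simp add: tau_of_def)
    obtain c d where c: "theta3 0 (tau_of x0) = of_real c" and d: "theta4 0 (tau_of x0) = of_real d"
      using theta_constants_real[OF zero_less_one ti] by (auto elim!: Reals_cases)
    have "q x0 = of_real ((d / c)^2 / sqrt (1/2))"
    proof -
      have "csqrt x0 = of_real (sqrt (1/2))" unfolding x0_def by (rule of_real_sqrt[symmetric]) simp
      thus ?thesis unfolding q_def c d by simp
    qed
    moreover have "(d / c)^2 / sqrt (1/2) \<ge> 0" by simp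
    moreover have "q x0 = 1 \<or> q x0 = -1" using q2[OF x0] by (simp add: power2_eq_1_iff)
    moreover have "complex_of_real r \<noteq> -1" if "r \<ge> 0" for r
    proof
      assume "complex_of_real r = -1"
      hence "complex_of_real r = of_real (-1)" by simp
      hence "r = -1" by (simp only: of_real_eq_iff)
      with that show False by simp
    qed
    ultimately have "q x0 = 1" by (simp only:) blast
    thus ?thesis using e[OF x0] by simp
  qed
  hence "(theta4 0 (tau_of x) / theta3 0 (tau_of x))^2 / csqrt x = 1" using e[OF assms] by (simp add: q_def)
  moreover have "csqrt x \<noteq> 0" using np[OF assms] by auto
  ultimately show ?thesis by (simp del: power_divide)
qed

text \<open>The derivative of an inverse function of \<open>theta_lambda\<close>.\<close>

lemma tau_of_DERIV:
  assumes x: "x \<in> cut_plane"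
  shows "(tau_of has_field_derivative \<i> / (of_real pi * (theta3 0 (tau_of x))^4 * (x * (1 - x)))) (at x)"
proof -
  let ?\<tau> = "tau_of x"
  note \<tau> = Im_tau_of[OF x]
  obtain d where d: "(tau_of has_field_derivative d) (at x)"
    using tau_of_holomorphic x open_cut_plane by (auto simp: holomorphic_on_open)
  from DERIV_chain2[OF theta_line.theta_lambda_DERIV[OF \<tau>] d]
  have 1: "((\<lambda>x. theta_lambda (tau_of x)) has_field_derivative
     - of_real pi * \<i> * (theta3 0 ?\<tau>)^4 * (x * (1 - x)) * d) (at x)"
    by (simp add: theta_lambda_tau_of[OF x])
  have "\<forall>\<^sub>F z in nhds x. theta_lambda (tau_of z) = z"
    using eventually_nhds_in_open[OF open_cut_plane x] by eventually_elim (rule theta_lambda_tau_of)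
  hence "((\<lambda>x. theta_lambda (tau_of x)) has_field_derivative 1) (at x)"
    by (subst DERIV_cong_ev[OF refl _ refl]) auto
  from DERIV_unique[OF 1 this] have eq: "- of_real pi * \<i> * (theta3 0 ?\<tau>)^4 * (x * (1 - x)) * d = 1" .
  have nz: "theta3 0 ?\<tau> \<noteq> 0" "x \<noteq> 0" "1 - x \<noteq> 0"
    using theta_constants_nonzero[OF \<tau>] theta_lambda_not_0_1[OF \<tau>] by (auto simp: theta_lambda_tau_of[OF x])
  define P where "P = of_real pi * (theta3 0 ?\<tau>)^4 * (x * (1 - x))"
  have P: "P \<noteq> 0" using nz by (simp add: P_def)
  have "P * d = \<i> * (- of_real pi * \<i> * (theta3 0 ?\<tau>)^4 * (x * (1 - x)) * d)" by (simp add: P_def algebra_simps)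
  hence "P * d = \<i>" unfolding eq by simp
  hence "d = \<i> / P" using P by (simp add: field_simps)
  with d show ?thesis by (simp add: P_def)
qed

section \<open>Hitchin's function solves the sixth Painleve equation\<close>

text \<open>The algebraic half of the elimination of \<open>u\<close>. Here \<open>k = 1 / (y - u)\<close>, the definition of \<open>p\<close> is the first order equation for
  \<open>y\<close>, and the right-hand side of the conclusion is the derivative of \<open>p\<close> computed from the system, with
  \<open>k\<^sup>2 u'\<close> written as a polynomial in \<open>k\<close>.\<close>

lemma painleve_VI_from_system:
  fixes x y k :: complex
  assumes nz: "y \<noteq> 0" "y - 1 \<noteq> 0" "y - x \<noteq> 0" "x \<noteq> 0" "x - 1 \<noteq> 0"
  defines "m \<equiv> x * (x - 1)" and "g \<equiv> y * (y - 1) * (y - x)" and "h \<equiv> y^2 - 2 * x * y + x"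
  defines "gy \<equiv> (y - 1) * (y - x) + y * (y - x) + y * (y - 1)"
  defines "p \<equiv> (2 * g * k - h) / (2 * m)"
  shows "PVI_rhs (1/8) (1/8) (1/8) (1/8) x y p =
     (2 * (p * gy - y * (y - 1)) * k - 2 * g * (p * k^2 - (y - x) * (y * (y - 1) * k^3 - (2 * y - 1) * k^2 + k) / m)
        - ((2 * y - 2 * x) * p - 2 * y + 1)) / (2 * m) - p * (2 * x - 1) / m"
proof -
  have m: "m \<noteq> 0" and g: "g \<noteq> 0" using nz by (simp_all add: m_def g_def)
  have 1: "1/2 * (1/y + 1/(y - 1) + 1/(y - x)) = gy / (2 * g)"
    using nz by (simp add: gy_def g_def field_simps)
  have 2: "1/x + 1/(x - 1) + 1/(y - x) = ((2 * x - 1) * (y - x) + m) * (y * (y - 1)) / (m * g)"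
  proof -
    have frac: "1/a + 1/b + 1/c = ((a + b) * c + a * b) * Y / (a * b * (Y * c))"
      if "a \<noteq> 0" "b \<noteq> 0" "c \<noteq> 0" "Y \<noteq> 0" for a b c Y :: complex
      using that by (simp add: field_simps)
    have "1/x + 1/(x - 1) + 1/(y - x) = ((x + (x - 1)) * (y - x) + x * (x - 1)) * (y * (y - 1)) / (x * (x - 1) * (y * (y - 1) * (y - x)))"
      by (rule frac) (use nz in simp_all)
    moreover have "x + (x - 1) = 2 * x - 1" by simp
    ultimately show ?thesis unfolding m_def g_def by (simp only:)
  qed
  have 3: "y * (y - 1) * (y - x) / (x^2 * (x - 1)^2) *
       (1/8 - 1/8 * (x / y^2) + 1/8 * ((x - 1) / (y - 1)^2) - (1/8 - 1/2) * (x * (x - 1) / (y - x)^2))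
     = (g^2 - x * ((y - 1) * (y - x))^2 + (x - 1) * (y * (y - x))^2 + 3 * m * (y * (y - 1))^2) / (8 * m^2 * g)"
  proof -
    have "1/8 - 1/8 * (x / y^2) + 1/8 * ((x - 1) / (y - 1)^2) - (1/8 - 1/2) * (x * (x - 1) / (y - x)^2)
      = (g^2 - x * ((y - 1) * (y - x))^2 + (x - 1) * (y * (y - x))^2 + 3 * m * (y * (y - 1))^2) / (8 * g^2)"
    proof -
      have alg: "1/8 - 1/8 * (a1 / g^2) + 1/8 * (a2 / g^2) - (1/8 - 1/2) * (a3 / g^2) = (g^2 - a1 + a2 + 3 * a3) / (8 * g^2)" for a1 a2 a3
        using g by (simp add: field_simps)
      have eqs: "x / y^2 = x * ((y - 1) * (y - x))^2 / g^2" "(x - 1) / (y - 1)^2 = (x - 1) * (y * (y - x))^2 / g^2"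
        "x * (x - 1) / (y - x)^2 = m * (y * (y - 1))^2 / g^2"
        using nz by (simp_all add: g_def m_def power_mult_distrib)
      show ?thesis unfolding eqs alg by (simp add: mult.assoc)
    qed
    moreover have "y * (y - 1) * (y - x) / (x^2 * (x - 1)^2) = g / m^2" by (simp add: g_def m_def power_mult_distrib)
    ultimately show ?thesis using g m by (simp add: power2_eq_square)
  qed
  define r where "r = 2 * g * k - h"
  have p: "p = r / (2 * m)" by (simp add: p_def r_def)
  define Y d c where "Y = y * (y - 1)" "d = y - x" "c = (2 * x - 1) * (y - x) + m"
  note Ydc = this
  define S where "S = g^2 - x * ((y - 1) * (y - x))^2 + (x - 1) * (y * (y - x))^2 + 3 * m * (y * (y - 1))^2"
  have L: "PVI_rhs (1/8) (1/8) (1/8) (1/8) x y p = (gy * r^2 - 4 * c * Y * r + S) / (8 * m^2 * g)"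
  proof -
    have "gy / (2 * g) * (r / (2 * m))^2 - c * Y / (m * g) * (r / (2 * m)) + S / (8 * m^2 * g) =
          (gy * r^2 - 4 * c * Y * r + S) / (8 * m^2 * g)"
      using m g by (simp add: field_simps power2_eq_square)
    thus ?thesis unfolding PVI_rhs_def 1 2 3 unfolding p Ydc S_def .
  qed
  define T where "T = 2 * (r * gy - 2 * m * Y) * k - 2 * g * (r * k^2 - 2 * (d * (Y * k^3 - (2 * y - 1) * k^2 + k)))
        - (2 * d * r - 4 * m * y + 2 * m) - 2 * r * (2 * x - 1)"
  have Rr: "(2 * (p * gy - y * (y - 1)) * k - 2 * g * (p * k^2 - (y - x) * (y * (y - 1) * k^3 - (2 * y - 1) * k^2 + k) / m)
        - ((2 * y - 2 * x) * p - 2 * y + 1)) / (2 * m) - p * (2 * x - 1) / m = T / (4 * m^2)"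
  proof -
    have "(2 * (r / (2 * m) * gy - Y) * k - 2 * g * (r / (2 * m) * k^2 - F / m) - (2 * d * (r / (2 * m)) - 2 * y + 1)) / (2 * m)
        - r / (2 * m) * t / m = (2 * (r * gy - 2 * m * Y) * k - 2 * g * (r * k^2 - 2 * F) - (2 * d * r - 4 * m * y + 2 * m) - 2 * r * t) / (4 * m^2)"
      for F t using m by (simp add: field_simps power2_eq_square)
    moreover have "2 * y - 2 * x = 2 * d" by (simp add: Ydc)
    ultimately show ?thesis unfolding p T_def Ydc(1,2)[symmetric] by (simp only:)
  qed
  \<comment> \<open>Both numerators are quadratic polynomials in \<open>k\<close>; their coefficients agree.\<close>
  have gY: "g = Y * d" by (simp add: g_def Ydc)
  have e2: "gy + h = 2 * (d * (2 * y - 1))"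
    by (simp add: gy_def h_def Ydc algebra_simps power2_eq_square)
  have e0: "gy * h^2 + 4 * c * Y * h + S = 2 * g * (2 * d * h + 4 * m * y - 2 * m + 2 * h * (2 * x - 1))"
    by (simp add: gy_def h_def g_def Ydc S_def m_def algebra_simps power2_eq_square)
  have "gy * r^2 - 4 * c * Y * r + S = 4 * g^2 * gy * k^2 - (4 * g * h * gy + 8 * g * (c * Y)) * k + (gy * h^2 + 4 * c * Y * h + S)"
    by (simp add: r_def algebra_simps power2_eq_square)
  also have "c * Y = (2 * x - 1) * g + m * Y" unfolding gY by (simp add: Ydc algebra_simps)
  also have "4 * g^2 * gy * k^2 = 2 * g * (2 * g * (2 * gy + h - 2 * (d * (2 * y - 1))) * k^2)"
    unfolding e2[symmetric] by (simp add: power2_eq_square algebra_simps)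
  also have "2 * g * (2 * g * (2 * gy + h - 2 * (d * (2 * y - 1))) * k^2)
       - (4 * g * h * gy + 8 * g * ((2 * x - 1) * g + m * Y)) * k + (gy * h^2 + 4 * c * Y * h + S)
     = 2 * g * (T + 4 * g * (g - Y * d) * k^3)"
    unfolding e0 by (simp add: T_def r_def algebra_simps power2_eq_square power3_eq_cube)
  also have "\<dots> = 2 * g * T" by (simp add: gY)
  finally have key: "gy * r^2 - 4 * c * Y * r + S = 2 * g * T" .
  show ?thesis unfolding L Rr key using m g by (simp add: field_simps)
qed

text \<open>The line \<open>z = a \<tau> + B\<close> with \<open>a = - \<i> A\<close> is the argument \<open>A K / K' + B\<close> of the theta functions. At a good
  point no denominator in the formula for \<open>y\<close> vanishes and \<open>z\<close> is not a half period.\<close>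

locale hitchin_solution =
  fixes A B :: complex
begin

definition "a = - \<i> * A"

abbreviation z_of :: "complex \<Rightarrow> complex" where "z_of x \<equiv> a * tau_of x + B"

definition u :: "complex \<Rightarrow> complex" where "u x = theta_line.u a B (tau_of x)"
definition y :: "complex \<Rightarrow> complex" where "y x = theta_line.y a B (tau_of x)"

definition good :: "complex \<Rightarrow> bool" where
  "good x \<longleftrightarrow> x \<in> cut_plane \<and> theta_line.regular a B (tau_of x) \<and> theta_line.zet a B (tau_of x) \<noteq> 0"

lemma z_of_eq: "A * (K_sqrt x / K'_sqrt x) + B = z_of x" and tau_of_eq: "\<i> * (K_sqrt x / K'_sqrt x) = tau_of x"
proof -
  have "- \<i> * A * (\<i> * r) = A * r" for r
    by (simp add: mult.assoc mult.left_commute[of A "\<i>"])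
  thus "A * (K_sqrt x / K'_sqrt x) + B = z_of x" unfolding a_def tau_of_def by simp
qed (simp add: tau_of_def)

lemma hitchin_y_altdef:
  assumes x: "x \<in> cut_plane"
  shows "hitchin_y A B x = csqrt x / (theta1 (z_of x) (tau_of x))^2 *
     (of_real pi * (theta2 0 (tau_of x))^2 * theta2 (z_of x) (tau_of x) * theta3 (z_of x) (tau_of x) * theta4 (z_of x) (tau_of x) /
        (theta1_deriv 1 (z_of x) (tau_of x) + 2 * of_real pi * A * theta1 (z_of x) (tau_of x)) - (theta2 (z_of x) (tau_of x))^2)"
  unfolding hitchin_y_def Let_def z_of_eq tau_of_eq vartheta2_def theta1'_eq[OF Im_tau_of[OF x]] ..

text \<open>Hitchin's formula is \<open>U + V / (2 \<zeta>)\<close>: its second term \<open>- \<surd>x \<theta>\<^sub>2\<^sup>2 / \<theta>\<^sub>1\<^sup>2\<close> is \<open>U\<close>, because \<open>\<surd>x = \<theta>\<^sub>4(0)\<^sup>2 / \<theta>\<^sub>3(0)\<^sup>2\<close>, and its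
  denominator is \<open>\<theta>\<^sub>1 \<zeta>\<close>.\<close>

lemma hitchin_y_eq:
  assumes x: "x \<in> cut_plane" and nz: "theta1 (z_of x) (tau_of x) \<noteq> 0"
  shows "hitchin_y A B x = y x"
proof -
  define t t1 t2 t3 t4 where "t = theta1_deriv 1 (z_of x) (tau_of x)" "t1 = theta1 (z_of x) (tau_of x)"
    "t2 = theta2 (z_of x) (tau_of x)" "t3 = theta3 (z_of x) (tau_of x)" "t4 = theta4 (z_of x) (tau_of x)"
  note d = this
  have alg: "s / t1^2 * (p * b^2 * t2 * t3 * t4 / (t + c * t1) - t2^2) =
      - (s * (t2 / t1)^2) + 2 * p * s * b^2 * (t2 * t3 * t4) / t1^3 / (2 * (t / t1 + c))" if "t1 \<noteq> 0" for s p b c :: complex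
  proof -
    have 1: "t + c * t1 = t1 * (t / t1 + c)" using that by (simp add: field_simps)
    have "s / t1^2 * (p * b^2 * t2 * t3 * t4 / (t1 * Z) - t2^2) =
      - (s * (t2 / t1)^2) + 2 * p * s * b^2 * (t2 * t3 * t4) / t1^3 / (2 * Z)" for Z
      using that by (simp add: right_diff_distrib power2_eq_square power3_eq_cube mult_ac)
    thus ?thesis unfolding 1 .
  qed
  have "2 * of_real pi * \<i> * a = 2 * of_real pi * A" by (simp add: a_def)
  thus ?thesis
    unfolding hitchin_y_altdef[OF x] y_def theta_line.y_def theta_line.u_def theta_line.v_def theta_line.zet_def ell_U_def ell_V_def
      csqrt_eq_theta_quotient[OF x] d[symmetric] using alg nz by (simp add: d)
qed

lemma good_imp:
  assumes "good x"
  shows "x \<in> cut_plane" "theta1 (z_of x) (tau_of x) \<noteq> 0" "x \<noteq> 0" "x - 1 \<noteq> 0" "y x \<noteq> u x" "u x \<noteq> 0" "u x \<noteq> 1" "u x \<noteq> x"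
proof -
  show x: "x \<in> cut_plane" using assms by (simp add: good_def)
  have reg: "theta_line.regular a B (tau_of x)" and z: "theta_line.zet a B (tau_of x) \<noteq> 0"
    using assms by (simp_all add: good_def)
  show "theta1 (z_of x) (tau_of x) \<noteq> 0" using reg by (simp add: theta_line.regular_def)
  show "x \<noteq> 0" "x - 1 \<noteq> 0" using theta_lambda_not_0_1[OF Im_tau_of[OF x]] theta_lambda_tau_of[OF x] by auto
  show "y x \<noteq> u x" unfolding y_def u_def by (rule theta_line.u_y_system[OF reg z])
  show "u x \<noteq> 0" "u x \<noteq> 1" "u x \<noteq> x"
    using theta_line.u_nonzero[OF reg] unfolding u_def theta_lambda_tau_of[OF x] by auto
qed

text \<open>The change of variables from \<open>\<tau>\<close> to \<open>x\<close> replaces the factor \<open>\<pi> \<i> \<theta>\<^sub>3\<^sup>4\<close> of the system along the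
  curve by \<open>1 / (x (x - 1))\<close>.\<close>

lemma u_y_DERIV:
  assumes good: "good x"
  shows "(u has_field_derivative u x * (u x - 1) * (y x - x) / ((y x - u x) * (x * (x - 1)))) (at x)"
    and "(y has_field_derivative (2 * (y x * (y x - 1) * (y x - x)) * (1 / (y x - u x)) - ((y x)^2 - 2 * x * y x + x)) / (2 * (x * (x - 1)))) (at x)"
proof -
  note x = good_imp(1)[OF good]
  have reg: "theta_line.regular a B (tau_of x)" and z: "theta_line.zet a B (tau_of x) \<noteq> 0"
    using good by (simp_all add: good_def)
  define F where "F = of_real pi * \<i> * (theta3 0 (tau_of x))^4"
  define d where "d = \<i> / (of_real pi * (theta3 0 (tau_of x))^4 * (x * (1 - x)))"
  have nz: "theta3 0 (tau_of x) \<noteq> 0" by (rule theta_constants_nonzero[OF Im_tau_of[OF x]])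
  have Fd: "F * d = 1 / (x * (x - 1))"
  proof -
    have "F * d = - 1 / (x * (1 - x))" using nz by (simp add: F_def d_def)
    also have "x * (1 - x) = - (x * (x - 1))" by (simp add: algebra_simps)
    also have "- 1 / - (x * (x - 1)) = 1 / (x * (x - 1))" by (rule minus_divide_divide)
    finally show ?thesis .
  qed
  have td: "(tau_of has_field_derivative d) (at x)" unfolding d_def by (rule tau_of_DERIV[OF x])
  have "(u has_field_derivative F * (u x * (u x - 1) * (y x - x) / (y x - u x)) * d) (at x)"
    using DERIV_chain2[OF theta_line.u_y_system(2)[OF reg z] td]
    unfolding u_def[symmetric] y_def[symmetric] theta_lambda_tau_of[OF x] F_def[symmetric] .
  moreover have "F * (G / w) * d = G / (w * (x * (x - 1)))" for G w
  proof -
    have "F * (G / w) * d = (F * d) * (G / w)" by (simp only: mult_ac)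
    also have "\<dots> = G / (w * (x * (x - 1)))" unfolding Fd by (simp only: times_divide_times_eq mult_1 mult_1_right mult.commute)
    finally show ?thesis .
  qed
  ultimately show "(u has_field_derivative u x * (u x - 1) * (y x - x) / ((y x - u x) * (x * (x - 1)))) (at x)"
    by (simp only:)
  have "(y has_field_derivative F * (y x * (y x - 1) * (y x - x) / (y x - u x) - ((y x)^2 - 2 * x * y x + x) / 2) * d) (at x)"
    using DERIV_chain2[OF theta_line.u_y_system(3)[OF reg z] td]
    unfolding u_def[symmetric] y_def[symmetric] theta_lambda_tau_of[OF x] F_def[symmetric] .
  moreover have "F * (G / w - H / 2) * d = (2 * G * (1 / w) - H) / (2 * (x * (x - 1)))" for G w H
  proof -
    have e: "G / w - H / 2 = (2 * G * (1 / w) - H) / 2" by (simp add: diff_divide_distrib)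
    have "F * (G / w - H / 2) * d = (F * d) * ((2 * G * (1 / w) - H) / 2)" unfolding e by (simp only: mult_ac)
    also have "\<dots> = (2 * G * (1 / w) - H) / (2 * (x * (x - 1)))"
      unfolding Fd by (simp only: times_divide_times_eq mult_1 mult_1_right mult.commute)
    finally show ?thesis .
  qed
  ultimately show "(y has_field_derivative (2 * (y x * (y x - 1) * (y x - x)) * (1 / (y x - u x)) - ((y x)^2 - 2 * x * y x + x)) / (2 * (x * (x - 1)))) (at x)"
    by (simp only:)
qed

lemma eventually_good:
  assumes good: "good x"
  shows "\<forall>\<^sub>F x in nhds x. good x"
proof -
  note x = good_imp(1)[OF good]
  have reg: "theta_line.regular a B (tau_of x)" and z: "theta_line.zet a B (tau_of x) \<noteq> 0"
    using good by (simp_all add: good_def)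
  have t: "(tau_of \<longlongrightarrow> tau_of x) (nhds x)"
    using DERIV_isCont[OF tau_of_DERIV[OF x]] by (simp add: isCont_def tendsto_at_iff_tendsto_nhds)
  have "(theta_line.zet a B \<longlongrightarrow> theta_line.zet a B (tau_of x)) (nhds (tau_of x))"
    using DERIV_isCont[OF theta_line.zet_DERIV[OF reg]] by (simp add: isCont_def tendsto_at_iff_tendsto_nhds)
  from tendsto_imp_eventually_ne[OF this z] theta_line.eventually_regular[OF reg]
  have "\<forall>\<^sub>F s in nhds (tau_of x). theta_line.regular a B s \<and> theta_line.zet a B s \<noteq> 0"
    by eventually_elim simp
  from eventually_compose_filterlim[OF this t] eventually_nhds_in_open[OF open_cut_plane x]
  show ?thesis by eventually_elim (simp add: good_def)
qed

theorem painleve_at_good_point: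
  assumes good: "good x" and ny: "y x \<noteq> 0" "y x \<noteq> 1" "y x \<noteq> x"
  shows "deriv (deriv y) x = PVI_rhs (1/8) (1/8) (1/8) (1/8) x (y x) (deriv y x)"
proof -
  define k where "k = 1 / (y x - u x)"
  define m where "m = x * (x - 1)"
  note g = good_imp[OF good]
  have kw: "k * (y x - u x) = 1" using g by (simp add: k_def)
  have m: "m \<noteq> 0" using g by (simp add: m_def)
  define p where "p = (2 * (y x * (y x - 1) * (y x - x)) * k - ((y x)^2 - 2 * x * y x + x)) / (2 * m)"
  define q where "q = u x * (u x - 1) * (y x - x) * k / m"
  have dy: "(y has_field_derivative p) (at x)" and du: "(u has_field_derivative q) (at x)"
    using u_y_DERIV[OF good] by (simp_all add: p_def q_def k_def m_def mult_ac)
  have ev: "\<forall>\<^sub>F x in nhds x. deriv y x = (2 * (y x * (y x - 1) * (y x - x)) * (1 / (y x - u x)) - ((y x)^2 - 2 * x * y x + x)) / (2 * (x * (x - 1)))"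
    using eventually_good[OF good] by eventually_elim (rule DERIV_imp_deriv[OF u_y_DERIV(2)])
  have dk: "((\<lambda>x. 1 / (y x - u x)) has_field_derivative - (k^2 * (p - q))) (at x)"
  proof -
    have "- (k^2 * (p - q)) = (0 * (y x - u x) - 1 * (p - q)) / ((y x - u x) * (y x - u x))"
      by (simp add: k_def power2_eq_square diff_divide_distrib)
    thus ?thesis using DERIV_divide[OF DERIV_const[of 1] DERIV_diff[OF dy du]] g by (simp only:) simp
  qed
  define N where "N = 2 * (y x * (y x - 1) * (y x - x)) * k - ((y x)^2 - 2 * x * y x + x)"
  define N' where "N' = 2 * (p * (y x - 1) * (y x - x) + y x * p * (y x - x) + y x * (y x - 1) * (p - 1)) * k
     + 2 * (y x * (y x - 1) * (y x - x)) * (- (k^2 * (p - q))) - (2 * y x * p - (2 * y x + 2 * x * p) + 1)"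
  have dN: "((\<lambda>x. 2 * (y x * (y x - 1) * (y x - x)) * (1 / (y x - u x)) - ((y x)^2 - 2 * x * y x + x)) has_field_derivative N') (at x)"
  proof -
    have dg: "((\<lambda>x. y x * (y x - 1) * (y x - x)) has_field_derivative
        (p * (y x - 1) + (p - 0) * y x) * (y x - x) + (p - 1) * (y x * (y x - 1))) (at x)"
      by (intro DERIV_mult DERIV_diff dy DERIV_const DERIV_ident)
    have dh: "((\<lambda>x. (y x)^2 - 2 * x * y x + x) has_field_derivative
        of_nat 2 * (p * y x ^ (2 - Suc 0)) - (2 * y x + p * (2 * x)) + 1) (at x)"
      by (intro DERIV_add DERIV_diff DERIV_power DERIV_mult dy DERIV_cmult_Id DERIV_ident)
    have "(2 * ((p * (y x - 1) + (p - 0) * y x) * (y x - x) + (p - 1) * (y x * (y x - 1)))) * (1 / (y x - u x))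
        + - (k^2 * (p - q)) * (2 * (y x * (y x - 1) * (y x - x)))
        - (of_nat 2 * (p * y x ^ (2 - Suc 0)) - (2 * y x + p * (2 * x)) + 1) = N'"
      unfolding N'_def k_def[symmetric] by (simp add: algebra_simps)
    with DERIV_diff[OF DERIV_mult[OF DERIV_cmult[OF dg, of 2] dk] dh] show ?thesis by (simp only:)
  qed
  have dm: "((\<lambda>x. 2 * (x * (x - 1))) has_field_derivative 2 * (2 * x - 1)) (at x)"
  proof -
    have "((\<lambda>x. 2 * (x * (x - 1))) has_field_derivative 2 * (1 * (x - 1) + (1 - 0) * x)) (at x)"
      by (intro DERIV_cmult DERIV_mult DERIV_diff DERIV_ident DERIV_const)
    moreover have "2 * (1 * (x - 1) + (1 - 0) * x) = 2 * (2 * x - 1)" by (simp add: algebra_simps)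
    ultimately show ?thesis by (simp only:)
  qed
  have "((\<lambda>x. (2 * (y x * (y x - 1) * (y x - x)) * (1 / (y x - u x)) - ((y x)^2 - 2 * x * y x + x)) / (2 * (x * (x - 1))))
     has_field_derivative (N' * (2 * m) - N * (2 * (2 * x - 1))) / (2 * m * (2 * m))) (at x)"
    using DERIV_divide[OF dN dm] m by (simp add: m_def N_def k_def)
  hence "(deriv y has_field_derivative (N' * (2 * m) - N * (2 * (2 * x - 1))) / (2 * m * (2 * m))) (at x)"
    by (subst DERIV_cong_ev[OF refl ev refl])
  hence dd: "deriv (deriv y) x = (N' * (2 * m) - N * (2 * (2 * x - 1))) / (2 * m * (2 * m))"
    by (rule DERIV_imp_deriv)
  also have "\<dots> = N' / (2 * m) - p * (2 * x - 1) / m"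
    unfolding p_def N_def[symmetric] using m by (simp add: field_simps)
  also have "N' = 2 * (p * ((y x - 1) * (y x - x) + y x * (y x - x) + y x * (y x - 1)) - y x * (y x - 1)) * k
       - 2 * (y x * (y x - 1) * (y x - x)) * (p * k^2 - (y x - x) * (y x * (y x - 1) * k^3 - (2 * y x - 1) * k^2 + k) / m)
        - ((2 * y x - 2 * x) * p - 2 * y x + 1)"
  proof -
    have kq: "k^2 * q = (y x - x) * (y x * (y x - 1) * k^3 - (2 * y x - 1) * k^2 + k) / m"
    proof -
      have ku: "k * u x = k * y x - 1" using kw by (simp add: algebra_simps)
      have "k^2 * q = (k * u x) * (k * u x - k) * (y x - x) * k / m"
        unfolding q_def power2_eq_square by (simp add: algebra_simps)
      also have "(k * u x) * (k * u x - k) * (y x - x) * k = (y x - x) * (y x * (y x - 1) * k^3 - (2 * y x - 1) * k^2 + k)"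
        unfolding ku power2_eq_square power3_eq_cube by (simp add: algebra_simps)
      finally show ?thesis .
    qed
    have "2 * (y x * (y x - 1) * (y x - x)) * (p * k^2 - (y x - x) * (y x * (y x - 1) * k^3 - (2 * y x - 1) * k^2 + k) / m)
       = - (2 * (y x * (y x - 1) * (y x - x)) * (- (k^2 * (p - q))))"
    proof -
      have "R * (p * k^2 - S) = - (R * (- (k^2 * (p - q))))" if "k^2 * q = S" for R S
        unfolding that[symmetric] by (simp add: algebra_simps)
      from this[OF kq] show ?thesis .
    qed
    moreover have "P * k + - R - S = P * k - R - S" for P R S :: complex by simp
    moreover have "2 * (p * (y x - 1) * (y x - x) + y x * p * (y x - x) + y x * (y x - 1) * (p - 1))
       = 2 * (p * ((y x - 1) * (y x - x) + y x * (y x - x) + y x * (y x - 1)) - y x * (y x - 1))"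
      "2 * y x * p - (2 * y x + 2 * x * p) + 1 = (2 * y x - 2 * x) * p - 2 * y x + 1"
      by (simp_all add: algebra_simps)
    ultimately show ?thesis unfolding N'_def by (simp only: minus_minus diff_minus_eq_add)
  qed
  also have "\<dots> / (2 * m) - p * (2 * x - 1) / m = PVI_rhs (1/8) (1/8) (1/8) (1/8) x (y x) p"
    unfolding p_def m_def by (rule painleve_VI_from_system[symmetric]) (use ny g in auto)
  finally show ?thesis unfolding DERIV_imp_deriv[OF dy] .
qed

end

section \<open>Nondegeneracy for admissible constants\<close>

text \<open>If \<open>c \<tau> + d\<close> were a lattice point of \<open>\<int> + \<int> \<tau>\<close> for every value \<open>\<tau>\<close> of the period ratio, then, there
  being uncountably many values but only countably many pairs of coordinates, two values would share
  their coordinates, and these would have to be \<open>d\<close> and \<open>c\<close>.\<close>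

lemma always_lattice_imp_Ints:
  assumes "\<And>x. x \<in> cut_plane \<Longrightarrow> \<exists>m n::int. c * tau_of x + d = of_int m + of_int n * tau_of x"
  shows "c \<in> \<int> \<and> d \<in> \<int>"
proof -
  define f where "f = (\<lambda>x. SOME p::int \<times> int. c * tau_of x + d = of_int (fst p) + of_int (snd p) * tau_of x)"
  have f: "c * tau_of x + d = of_int (fst (f x)) + of_int (snd (f x)) * tau_of x" if "x \<in> cut_plane" for x
    unfolding f_def by (rule someI_ex) (use assms[OF that] in auto)
  have half: "1/2 \<in> cut_plane" by (simp add: cut_plane_iff slit_iff)
  then obtain r where r: "r > 0" "ball (1/2) r \<subseteq> cut_plane" using open_cut_plane open_contains_ball by meson
  have unc: "uncountable cut_plane"
    using uncountable_ball[OF r(1)] countable_subset[OF r(2)] by blast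
  have "\<not> inj_on f cut_plane"
  proof
    assume "inj_on f cut_plane"
    moreover have "countable (f ` cut_plane)" by (rule countableI_type)
    ultimately have "countable cut_plane" by (rule countable_image_inj_on[rotated])
    thus False using unc by blast
  qed
  then obtain x x' where x: "x \<in> cut_plane" "x' \<in> cut_plane" "x \<noteq> x'" "f x = f x'" by (auto simp: inj_on_def)
  have ne: "tau_of x \<noteq> tau_of x'" using x theta_lambda_tau_of by metis
  define m n where "m = (of_int (fst (f x)) :: complex)" "n = (of_int (snd (f x)) :: complex)"
  have 1: "c * tau_of x + d = m + n * tau_of x" and 2: "c * tau_of x' + d = m + n * tau_of x'"
    using f[OF x(1)] f[OF x(2)] by (simp_all add: m_n_def x(4))
  have "(c - n) * (tau_of x - tau_of x') = (c * tau_of x + d) - (c * tau_of x' + d) - n * (tau_of x - tau_of x')"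
    by (simp add: algebra_simps)
  also have "\<dots> = 0" unfolding 1 2 by (simp add: algebra_simps)
  finally have "c = n" using ne by simp
  moreover from this 1 have "d = m" by simp
  ultimately show ?thesis by (simp add: m_n_def)
qed

context hitchin_solution
begin

lemma theta_composites_holomorphic:
  "(\<lambda>x. theta1 (z_of x) (tau_of x)) holomorphic_on cut_plane" "(\<lambda>x. theta2 (z_of x) (tau_of x)) holomorphic_on cut_plane"
  "(\<lambda>x. theta3 (z_of x) (tau_of x)) holomorphic_on cut_plane" "(\<lambda>x. theta4 (z_of x) (tau_of x)) holomorphic_on cut_plane"
  "(\<lambda>x. theta1_deriv 1 (z_of x) (tau_of x)) holomorphic_on cut_plane"
  "(\<lambda>x. theta2 0 (tau_of x)) holomorphic_on cut_plane"
proof -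
  have comp: "(\<lambda>x. f (tau_of x)) holomorphic_on cut_plane"
    if "\<And>\<tau>. Im \<tau> > 0 \<Longrightarrow> \<exists>f'. (f has_field_derivative f') (at \<tau>)" for f
  proof (subst holomorphic_on_open[OF open_cut_plane], intro ballI)
    fix x assume x: "x \<in> cut_plane"
    from that[OF Im_tau_of[OF x]] obtain f' where "(f has_field_derivative f') (at (tau_of x))" by blast
    from DERIV_chain2[OF this tau_of_DERIV[OF x]] show "\<exists>f'. ((\<lambda>x. f (tau_of x)) has_field_derivative f') (at x)" by blast
  qed
  note d0 = theta_derivs_along_line[where n = 0, unfolded theta_derivs_0]
  show "(\<lambda>x. theta1 (z_of x) (tau_of x)) holomorphic_on cut_plane"
    by (rule comp[of "\<lambda>\<tau>. theta1 (a * \<tau> + B) \<tau>"], rule exI, rule d0(1))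
  show "(\<lambda>x. theta2 (z_of x) (tau_of x)) holomorphic_on cut_plane"
    by (rule comp[of "\<lambda>\<tau>. theta2 (a * \<tau> + B) \<tau>"], rule exI, rule d0(2))
  show "(\<lambda>x. theta3 (z_of x) (tau_of x)) holomorphic_on cut_plane"
    by (rule comp[of "\<lambda>\<tau>. theta3 (a * \<tau> + B) \<tau>"], rule exI, rule d0(3))
  show "(\<lambda>x. theta4 (z_of x) (tau_of x)) holomorphic_on cut_plane"
    by (rule comp[of "\<lambda>\<tau>. theta4 (a * \<tau> + B) \<tau>"], rule exI, rule d0(4))
  show "(\<lambda>x. theta1_deriv 1 (z_of x) (tau_of x)) holomorphic_on cut_plane"
    by (rule comp[of "\<lambda>\<tau>. theta1_deriv 1 (a * \<tau> + B) \<tau>"], rule exI, rule theta_derivs_along_line(1))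
  show "(\<lambda>x. theta2 0 (tau_of x)) holomorphic_on cut_plane"
    by (rule comp[of "\<lambda>\<tau>. theta2 0 \<tau>"], rule exI, rule theta_line.theta_constants_DERIV(3))
qed

lemma csqrt_holomorphic_cut_plane: "csqrt holomorphic_on cut_plane"
  by (rule holomorphic_on_subset[OF holomorphic_on_csqrt])
     (auto simp: cut_plane_iff slit_iff complex_nonpos_Reals_iff)

lemma hitchin_y_meromorphic: "hitchin_y A B meromorphic_on cut_plane"
proof -
  note m = analytic_on_imp_meromorphic_on[OF analytic_on_open[OF open_cut_plane, THEN iffD2]]
  note t = m[OF theta_composites_holomorphic(1)] m[OF theta_composites_holomorphic(2)] m[OF theta_composites_holomorphic(3)]
    m[OF theta_composites_holomorphic(4)] m[OF theta_composites_holomorphic(5)] m[OF theta_composites_holomorphic(6)]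
    m[OF csqrt_holomorphic_cut_plane]
  have "(\<lambda>x. csqrt x / (theta1 (z_of x) (tau_of x))^2 *
     (of_real pi * (theta2 0 (tau_of x))^2 * theta2 (z_of x) (tau_of x) * theta3 (z_of x) (tau_of x) * theta4 (z_of x) (tau_of x) /
        (theta1_deriv 1 (z_of x) (tau_of x) + 2 * of_real pi * A * theta1 (z_of x) (tau_of x)) - (theta2 (z_of x) (tau_of x))^2))
     meromorphic_on cut_plane"
    by (intro meromorphic_on_mult meromorphic_on_divide meromorphic_on_diff meromorphic_on_add meromorphic_on_power meromorphic_on_const t)
  thus ?thesis
  proof (rule meromorphic_on_cong[THEN iffD1, rotated 2])
    fix z assume "z \<in> cut_plane"
    hence "\<forall>\<^sub>F x in at z. x \<in> cut_plane" by (intro eventually_at_in_open' open_cut_plane)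
    thus "\<forall>\<^sub>F x in at z. csqrt x / (theta1 (z_of x) (tau_of x))^2 *
     (of_real pi * (theta2 0 (tau_of x))^2 * theta2 (z_of x) (tau_of x) * theta3 (z_of x) (tau_of x) * theta4 (z_of x) (tau_of x) /
        (theta1_deriv 1 (z_of x) (tau_of x) + 2 * of_real pi * A * theta1 (z_of x) (tau_of x)) - (theta2 (z_of x) (tau_of x))^2)
        = hitchin_y A B x"
      by eventually_elim (rule hitchin_y_altdef[symmetric])
  qed simp
qed

lemma holomorphic_zero_or_cosparse:
  assumes "f holomorphic_on cut_plane"
  shows "(\<forall>x\<in>cut_plane. f x = 0) \<or> (\<forall>\<^sub>\<approx>x\<in>cut_plane. f x \<noteq> 0)"
  by (rule nicely_meromorphic_imp_constant_or_avoid[OF analytic_on_imp_nicely_meromorphic_on open_cut_plane connected_cut_plane])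
     (use assms open_cut_plane in \<open>simp add: analytic_on_open\<close>)

text \<open>Each of the four functions \<open>\<theta>\<^sub>j(z)\<close> of \<open>x\<close> is holomorphic. If one of them vanished identically, \<open>z\<close> would be a half period for every
  \<open>x\<close>, and \<open>2 a\<close> and \<open>2 B\<close> would be integers.\<close>

lemma regular_cosparse:
  assumes adm: "admissible_constants A B"
  shows "\<forall>\<^sub>\<approx>x\<in>cut_plane. theta_line.regular a B (tau_of x)"
proof -
  have half: "2 * c \<in> \<int>" if "c + r \<in> \<int>" "r \<in> {0, 1/2}" for c r :: complex
  proof -
    have "2 * r \<in> \<int>"
    proof (cases "r = 0")
      case False
      hence r: "r = 1/2" using that(2) by blast
      show ?thesis unfolding r by simp
    qed simp
    moreover have "2 * (c + r) \<in> \<int>" by (rule Ints_mult[OF _ that(1)]) simp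
    ultimately have "2 * (c + r) - 2 * r \<in> \<int>" by (rule Ints_diff[rotated])
    thus ?thesis by (simp add: algebra_simps)
  qed
  have adm': "\<not> (2 * a \<in> \<int> \<and> 2 * B \<in> \<int>)"
  proof -
    have "2 * \<i> * A = - (2 * a)" by (simp add: a_def)
    hence "2 * \<i> * A \<in> \<int> \<longleftrightarrow> 2 * a \<in> \<int>" by (simp only: minus_in_Ints_iff)
    thus ?thesis using adm by (simp add: admissible_constants_def)
  qed
  have no: False if "\<And>x. x \<in> cut_plane \<Longrightarrow> \<exists>m n::int. (a * tau_of x + B) + (r * tau_of x + s) = of_int m + of_int n * tau_of x"
    "r \<in> {0, 1/2}" "s \<in> {0, 1/2}" for r s
  proof -
    have "a + r \<in> \<int> \<and> B + s \<in> \<int>"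
    proof (rule always_lattice_imp_Ints)
      fix x assume "x \<in> cut_plane"
      from that(1)[OF this] show "\<exists>m n::int. (a + r) * tau_of x + (B + s) = of_int m + of_int n * tau_of x"
        by (simp add: algebra_simps)
    qed
    thus False using half that(2,3) adm' by blast
  qed
  have "\<not> (\<forall>x\<in>cut_plane. theta1 (z_of x) (tau_of x) = 0)"
  proof
    assume z: "\<forall>x\<in>cut_plane. theta1 (z_of x) (tau_of x) = 0"
    show False
    proof (rule no[of 0 0])
      fix x assume x: "x \<in> cut_plane"
      have "theta1 (z_of x) (tau_of x) = 0" using z x by blast
      from theta1_zero_imp_lattice[OF Im_tau_of[OF x] this]
      show "\<exists>m n::int. (a * tau_of x + B) + (0 * tau_of x + 0) = of_int m + of_int n * tau_of x" by simp
    qed simp_all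
  qed
  moreover have "\<not> (\<forall>x\<in>cut_plane. theta2 (z_of x) (tau_of x) = 0)"
  proof
    assume z: "\<forall>x\<in>cut_plane. theta2 (z_of x) (tau_of x) = 0"
    show False
    proof (rule no[of 0 "1/2"])
      fix x assume x: "x \<in> cut_plane"
      have "theta2 (z_of x) (tau_of x) = 0" using z x by blast
      from theta2_zero_imp_lattice[OF Im_tau_of[OF x] this]
      show "\<exists>m n::int. (a * tau_of x + B) + (0 * tau_of x + 1/2) = of_int m + of_int n * tau_of x" by simp
    qed simp_all
  qed
  moreover have "\<not> (\<forall>x\<in>cut_plane. theta3 (z_of x) (tau_of x) = 0)"
  proof
    assume z: "\<forall>x\<in>cut_plane. theta3 (z_of x) (tau_of x) = 0"
    show False
    proof (rule no[of "1/2" "1/2"])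
      fix x assume x: "x \<in> cut_plane"
      have "theta3 (z_of x) (tau_of x) = 0" using z x by blast
      from theta3_zero_imp_lattice[OF Im_tau_of[OF x] this]
      show "\<exists>m n::int. (a * tau_of x + B) + (1/2 * tau_of x + 1/2) = of_int m + of_int n * tau_of x"
        by (simp add: add.assoc)
    qed simp_all
  qed
  moreover have "\<not> (\<forall>x\<in>cut_plane. theta4 (z_of x) (tau_of x) = 0)"
  proof
    assume z: "\<forall>x\<in>cut_plane. theta4 (z_of x) (tau_of x) = 0"
    show False
    proof (rule no[of "1/2" 0])
      fix x assume x: "x \<in> cut_plane"
      have "theta4 (z_of x) (tau_of x) = 0" using z x by blast
      from theta4_zero_imp_lattice[OF Im_tau_of[OF x] this]
      show "\<exists>m n::int. (a * tau_of x + B) + (1/2 * tau_of x + 0) = of_int m + of_int n * tau_of x" by simp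
    qed simp_all
  qed
  ultimately have "\<forall>\<^sub>\<approx>x\<in>cut_plane. theta1 (z_of x) (tau_of x) \<noteq> 0" "\<forall>\<^sub>\<approx>x\<in>cut_plane. theta2 (z_of x) (tau_of x) \<noteq> 0"
    "\<forall>\<^sub>\<approx>x\<in>cut_plane. theta3 (z_of x) (tau_of x) \<noteq> 0" "\<forall>\<^sub>\<approx>x\<in>cut_plane. theta4 (z_of x) (tau_of x) \<noteq> 0"
    using theta_composites_holomorphic(1-4)[THEN holomorphic_zero_or_cosparse] by blast+
  moreover have "\<forall>\<^sub>\<approx>x\<in>cut_plane. x \<in> cut_plane" by (rule eventually_in_cosparse[OF subset_refl open_cut_plane])
  ultimately show ?thesis
    by eventually_elim (simp add: theta_line.regular_def Im_tau_of)
qed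

lemma cut_plane_cosparse_exE:
  assumes "\<forall>\<^sub>\<approx>x\<in>cut_plane. P x"
  obtains x where "x \<in> cut_plane" "P x"
proof -
  have "1/2 \<in> cut_plane" by (simp add: cut_plane_iff slit_iff)
  hence "cosparse cut_plane \<noteq> bot" by auto
  moreover have "\<forall>\<^sub>\<approx>x\<in>cut_plane. x \<in> cut_plane \<and> P x"
    by (intro eventually_conj eventually_in_cosparse open_cut_plane assms subset_refl)
  ultimately show ?thesis using that eventually_happens' by blast
qed

text \<open>If \<open>\<zeta>\<close> vanished identically, its flow equation would force \<open>v = 0\<close>, but \<open>v\<close> has no zero at a regular point.\<close>

lemma good_cosparse:
  assumes adm: "admissible_constants A B"
  shows "\<forall>\<^sub>\<approx>x\<in>cut_plane. good x"
proof -
  define g where "g = (\<lambda>x. theta1_deriv 1 (z_of x) (tau_of x) + 2 * of_real pi * \<i> * a * theta1 (z_of x) (tau_of x))"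
  have g: "g holomorphic_on cut_plane"
    unfolding g_def by (intro holomorphic_on_add holomorphic_on_mult holomorphic_on_const theta_composites_holomorphic)
  have gz: "g x = theta1 (z_of x) (tau_of x) * theta_line.zet a B (tau_of x)" if "theta_line.regular a B (tau_of x)" for x
    using that by (simp add: g_def theta_line.zet_def theta_line.regular_def distrib_left)
  have "\<not> (\<forall>x\<in>cut_plane. g x = 0)"
  proof
    assume g0: "\<forall>x\<in>cut_plane. g x = 0"
    obtain x where x: "x \<in> cut_plane" and reg: "theta_line.regular a B (tau_of x)"
      using cut_plane_cosparse_exE[OF regular_cosparse[OF adm]] by blast
    have z0: "theta_line.zet a B (tau_of x) = 0" if "x \<in> cut_plane" "theta_line.regular a B (tau_of x)" for x
      using g0 gz[OF that(2)] that by (simp add: theta_line.regular_def)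
    have t: "(tau_of \<longlongrightarrow> tau_of x) (nhds x)"
      using DERIV_isCont[OF tau_of_DERIV[OF x]] by (simp add: isCont_def tendsto_at_iff_tendsto_nhds)
    have "\<forall>\<^sub>F x in nhds x. theta_line.zet a B (tau_of x) = 0"
      using eventually_compose_filterlim[OF theta_line.eventually_regular[OF reg] t] eventually_nhds_in_open[OF open_cut_plane x]
      by eventually_elim (rule z0)
    hence D0: "((\<lambda>x. theta_line.zet a B (tau_of x)) has_field_derivative 0) (at x)"
      by (subst DERIV_cong_ev[OF refl _ refl]) auto
    have nz: "theta3 0 (tau_of x) \<noteq> 0" by (rule theta_constants_nonzero[OF Im_tau_of[OF x]])
    have "x \<noteq> 0" "1 - x \<noteq> 0" using theta_lambda_not_0_1[OF Im_tau_of[OF x]] theta_lambda_tau_of[OF x] by auto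
    with DERIV_unique[OF DERIV_chain2[OF theta_line.zet_DERIV[OF reg] tau_of_DERIV[OF x]] D0] nz
    have "theta_line.v a B (tau_of x) = 0" by (simp add: z0[OF x reg])
    thus False using theta_line.v_nonzero[OF reg] by simp
  qed
  hence "\<forall>\<^sub>\<approx>x\<in>cut_plane. g x \<noteq> 0" using holomorphic_zero_or_cosparse[OF g] by blast
  moreover have "\<forall>\<^sub>\<approx>x\<in>cut_plane. x \<in> cut_plane" by (rule eventually_in_cosparse[OF subset_refl open_cut_plane])
  ultimately show ?thesis using regular_cosparse[OF adm]
    by eventually_elim (auto simp: good_def gz)
qed

lemma hitchin_y_eventually_eq:
  assumes "good x"
  shows "\<forall>\<^sub>F x in nhds x. hitchin_y A B x = y x"
  using eventually_good[OF assms] by eventually_elim (rule hitchin_y_eq[OF good_imp(1,2)])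

lemma deriv_hitchin_y:
  assumes "good x"
  shows "hitchin_y A B x = y x" "deriv (hitchin_y A B) x = deriv y x" "deriv (deriv (hitchin_y A B)) x = deriv (deriv y) x"
proof -
  have ev: "\<forall>\<^sub>F w in nhds x. hitchin_y A B w = y w" by (rule hitchin_y_eventually_eq[OF assms])
  thus "hitchin_y A B x = y x" by (rule eventually_nhds_x_imp_x)
  have "\<forall>\<^sub>F w in nhds x. \<forall>\<^sub>F v in nhds w. hitchin_y A B v = y v"
    using ev by (simp only: eventually_eventually)
  hence ev': "\<forall>\<^sub>F w in nhds x. deriv (hitchin_y A B) w = deriv y w"
    by eventually_elim (rule deriv_cong_ev[OF _ refl])
  show "deriv (hitchin_y A B) x = deriv y x" by (rule eventually_nhds_x_imp_x[OF ev'])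
  show "deriv (deriv (hitchin_y A B)) x = deriv (deriv y) x" by (rule deriv_cong_ev[OF ev' refl])
qed

text \<open>For \<open>y = 0\<close>, \<open>y = 1\<close> and \<open>y = x\<close> the term with \<open>u\<close> in the equation for \<open>y'\<close> drops out, and what remains gives the
  slopes \<open>- 1 / (2 (x - 1))\<close>, \<open>1 / (2 x)\<close> and \<open>1/2\<close> instead of 0, 0 and 1.\<close>

lemma y_avoids_singular_values:
  assumes good: "good x" and ev: "\<forall>\<^sub>F w in at x. y w = f w" and eq: "y x = f x"
    and f: "(f has_field_derivative f') (at x)"
  shows "\<not> (f x = 0 \<and> f' = 0)" "\<not> (f x = 1 \<and> f' = 0)" "\<not> (f x = x \<and> f' = 1)"
proof -
  note g = good_imp[OF good]
  have "\<forall>\<^sub>F w in nhds x. y w = f w" using ev eq by (simp add: eventually_nhds_conv_at)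
  hence "(y has_field_derivative f') (at x)" using f by (subst DERIV_cong_ev[OF refl _ refl]) auto
  from DERIV_unique[OF this u_y_DERIV(2)[OF good]]
  have f': "f' = (2 * (f x * (f x - 1) * (f x - x)) * (1 / (f x - u x)) - ((f x)^2 - 2 * x * f x + x)) / (2 * (x * (x - 1)))"
    by (simp only: eq)
  show "\<not> (f x = 0 \<and> f' = 0)" using f' g by auto
  show "\<not> (f x = 1 \<and> f' = 0)" using f' g by auto
  show "\<not> (f x = x \<and> f' = 1)"
  proof
    assume fx: "f x = x \<and> f' = 1"
    have "x^2 - 2 * x * x + x = - (x * (x - 1))" by (simp add: power2_eq_square algebra_simps)
    hence "f' = x * (x - 1) / (2 * (x * (x - 1)))" using f' fx by simp
    also have "\<dots> = 1 / 2" using g by simp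
    finally show False using fx by simp
  qed
qed

text \<open>Since \<open>y - 0\<close>, \<open>y - 1\<close> and \<open>y - x\<close> are meromorphic on a connected set, each is either zero almost everywhere or nonzero almost
  everywhere, and the former has been excluded.\<close>

theorem hitchin_y_painleve_VI:
  assumes adm: "admissible_constants A B"
  shows "PVI_solution (1/8) (1/8) (1/8) (1/8) cut_plane (hitchin_y A B)"
proof -
  note good = good_cosparse[OF adm]
  have av: "\<forall>\<^sub>\<approx>x\<in>cut_plane. hitchin_y A B x - f x \<noteq> 0"
    if mer: "f meromorphic_on cut_plane" and d: "\<And>x. (f has_field_derivative f') (at x)"
      and bad: "\<And>x. (f x = 0 \<and> f' = 0) \<or> (f x = 1 \<and> f' = 0) \<or> (f x = x \<and> f' = 1)" for f f'
  proof (rule ccontr)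
    assume "\<not> ?thesis"
    hence z: "\<forall>\<^sub>\<approx>x\<in>cut_plane. hitchin_y A B x - f x = 0"
      using meromorphic_imp_constant_or_avoid[OF meromorphic_on_diff[OF hitchin_y_meromorphic mer] open_cut_plane connected_cut_plane, of 0]
      by blast
    have "\<forall>\<^sub>\<approx>x\<in>cut_plane. good x \<and> hitchin_y A B x - f x = 0" using good z by eventually_elim simp
    then obtain x where x: "x \<in> cut_plane" "good x" "hitchin_y A B x - f x = 0"
      using cut_plane_cosparse_exE by blast
    have "\<forall>\<^sub>F w in at x. hitchin_y A B w - f w = 0"
      using eventually_cosparse_imp_eventually_at[OF z x(1), of UNIV] by simp
    moreover have "\<forall>\<^sub>F w in at x. hitchin_y A B w = y w"
      using hitchin_y_eventually_eq[OF x(2)] by (simp add: eventually_nhds_conv_at)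
    ultimately have "\<forall>\<^sub>F w in at x. y w = f w" by eventually_elim simp
    from y_avoids_singular_values[OF x(2) this _ d] bad[of x] x(3) deriv_hitchin_y(1)[OF x(2)]
    show False by auto
  qed
  have "\<forall>\<^sub>\<approx>x\<in>cut_plane. hitchin_y A B x - 0 \<noteq> 0"
    by (rule av[of "\<lambda>_. 0" 0]) (auto intro!: derivative_eq_intros meromorphic_on_const)
  moreover have "\<forall>\<^sub>\<approx>x\<in>cut_plane. hitchin_y A B x - 1 \<noteq> 0"
    by (rule av[of "\<lambda>_. 1" 0]) (auto intro!: derivative_eq_intros meromorphic_on_const)
  moreover have "\<forall>\<^sub>\<approx>x\<in>cut_plane. hitchin_y A B x - x \<noteq> 0"
    by (rule av[of "\<lambda>x. x" 1]) (auto intro!: derivative_eq_intros meromorphic_on_id)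
  ultimately have "\<forall>\<^sub>\<approx>x\<in>cut_plane. hitchin_y A B x \<noteq> 0 \<and> hitchin_y A B x \<noteq> 1 \<and> hitchin_y A B x \<noteq> x \<and>
        deriv (deriv (hitchin_y A B)) x = PVI_rhs (1/8) (1/8) (1/8) (1/8) x (hitchin_y A B x) (deriv (hitchin_y A B) x)"
    using good
  proof eventually_elim
    case (elim x)
    thus ?case unfolding deriv_hitchin_y[OF elim(4)] using painleve_at_good_point[OF elim(4)] by simp
  qed
  thus ?thesis unfolding PVI_solution_def using hitchin_y_meromorphic by blast
qed

end

section \<open>Uniqueness for the initial value problem\<close>

text \<open>The relation is preserved by sums, products and inverses, so a Lipschitz estimate for a rational expression can be
  read off from its form without computing partial derivatives. Boundedness is part of the relation because the rule for
  products needs it.\<close>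

definition lip :: "('a \<Rightarrow> real) \<Rightarrow> 'a filter \<Rightarrow> ('a \<Rightarrow> complex) \<Rightarrow> ('a \<Rightarrow> complex) \<Rightarrow> bool" where
  "lip \<Phi> F f g \<longleftrightarrow> (\<exists>C. \<forall>\<^sub>F x in F. norm (f x) \<le> C \<and> norm (g x) \<le> C \<and> norm (f x - g x) \<le> C * \<Phi> x)"

lemma lipE:
  assumes "lip \<Phi> F f g"
  obtains C where "C \<ge> 0" "\<forall>\<^sub>F x in F. norm (f x) \<le> C \<and> norm (g x) \<le> C \<and> norm (f x - g x) \<le> C * \<bar>\<Phi> x\<bar>"
proof -
  obtain C where C: "\<forall>\<^sub>F x in F. norm (f x) \<le> C \<and> norm (g x) \<le> C \<and> norm (f x - g x) \<le> C * \<Phi> x"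
    using assms by (auto simp: lip_def)
  have "\<forall>\<^sub>F x in F. norm (f x) \<le> \<bar>C\<bar> \<and> norm (g x) \<le> \<bar>C\<bar> \<and> norm (f x - g x) \<le> \<bar>C\<bar> * \<bar>\<Phi> x\<bar>"
    using C
  proof eventually_elim
    case (elim x)
    have "C * \<Phi> x \<le> \<bar>C\<bar> * \<bar>\<Phi> x\<bar>" by (metis abs_ge_self abs_mult)
    thus ?case using elim by linarith
  qed
  thus ?thesis using that[of "\<bar>C\<bar>"] by simp
qed

lemma lip_add:
  assumes "lip \<Phi> F f1 g1" "lip \<Phi> F f2 g2" and pos: "\<And>x. \<Phi> x \<ge> 0"
  shows "lip \<Phi> F (\<lambda>x. f1 x + f2 x) (\<lambda>x. g1 x + g2 x)"
proof -
  obtain C1 where C1: "C1 \<ge> 0" "\<forall>\<^sub>F x in F. norm (f1 x) \<le> C1 \<and> norm (g1 x) \<le> C1 \<and> norm (f1 x - g1 x) \<le> C1 * \<bar>\<Phi> x\<bar>"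
    by (rule lipE[OF assms(1)])
  obtain C2 where C2: "C2 \<ge> 0" "\<forall>\<^sub>F x in F. norm (f2 x) \<le> C2 \<and> norm (g2 x) \<le> C2 \<and> norm (f2 x - g2 x) \<le> C2 * \<bar>\<Phi> x\<bar>"
    by (rule lipE[OF assms(2)])
  have "\<forall>\<^sub>F x in F. norm (f1 x + f2 x) \<le> C1 + C2 \<and> norm (g1 x + g2 x) \<le> C1 + C2 \<and>
      norm ((f1 x + f2 x) - (g1 x + g2 x)) \<le> (C1 + C2) * \<Phi> x"
    using C1(2) C2(2)
  proof eventually_elim
    case (elim x)
    have "norm ((f1 x + f2 x) - (g1 x + g2 x)) \<le> norm (f1 x - g1 x) + norm (f2 x - g2 x)"
      by (metis add_diff_add norm_triangle_ineq)
    also have "\<dots> \<le> C1 * \<Phi> x + C2 * \<Phi> x" using elim pos[of x] by simp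
    finally show ?case using elim norm_triangle_ineq[of "f1 x" "f2 x"] norm_triangle_ineq[of "g1 x" "g2 x"]
      by (simp add: distrib_right)
  qed
  thus ?thesis unfolding lip_def by blast
qed

lemma lip_mult:
  assumes "lip \<Phi> F f1 g1" "lip \<Phi> F f2 g2" and pos: "\<And>x. \<Phi> x \<ge> 0"
  shows "lip \<Phi> F (\<lambda>x. f1 x * f2 x) (\<lambda>x. g1 x * g2 x)"
proof -
  obtain C1 where C1: "C1 \<ge> 0" "\<forall>\<^sub>F x in F. norm (f1 x) \<le> C1 \<and> norm (g1 x) \<le> C1 \<and> norm (f1 x - g1 x) \<le> C1 * \<bar>\<Phi> x\<bar>"
    by (rule lipE[OF assms(1)])
  obtain C2 where C2: "C2 \<ge> 0" "\<forall>\<^sub>F x in F. norm (f2 x) \<le> C2 \<and> norm (g2 x) \<le> C2 \<and> norm (f2 x - g2 x) \<le> C2 * \<bar>\<Phi> x\<bar>"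
    by (rule lipE[OF assms(2)])
  define C where "C = 2 * (C1 * C2)"
  have C: "C1 * C2 \<le> C" using C1(1) C2(1) by (simp add: C_def)
  have "\<forall>\<^sub>F x in F. norm (f1 x * f2 x) \<le> C \<and> norm (g1 x * g2 x) \<le> C \<and>
      norm (f1 x * f2 x - g1 x * g2 x) \<le> C * \<Phi> x"
    using C1(2) C2(2)
  proof eventually_elim
    case (elim x)
    have 1: "norm (f1 x * f2 x) \<le> C1 * C2" "norm (g1 x * g2 x) \<le> C1 * C2"
      unfolding norm_mult using elim C1(1) by (auto intro!: mult_mono)
    have "f1 x * f2 x - g1 x * g2 x = f1 x * (f2 x - g2 x) + (f1 x - g1 x) * g2 x" by (simp add: algebra_simps)
    hence "norm (f1 x * f2 x - g1 x * g2 x) \<le> norm (f1 x) * norm (f2 x - g2 x) + norm (f1 x - g1 x) * norm (g2 x)"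
      by (metis norm_mult norm_triangle_ineq)
    also have "\<dots> \<le> C1 * (C2 * \<Phi> x) + (C1 * \<Phi> x) * C2"
      using elim pos[of x] C1(1) by (intro add_mono mult_mono) auto
    also have "\<dots> = C * \<Phi> x" by (simp add: C_def algebra_simps)
    finally show ?case using 1 C by linarith
  qed
  thus ?thesis unfolding lip_def by blast
qed

lemma lip_same:
  assumes c: "(h \<longlongrightarrow> l) F" and pos: "\<And>x. \<Phi> x \<ge> 0"
  shows "lip \<Phi> F h h"
proof -
  have "\<forall>\<^sub>F x in F. dist (h x) l < 1" using c by (rule tendstoD) simp
  hence "\<forall>\<^sub>F x in F. norm (h x) \<le> norm l + 1 \<and> norm (h x) \<le> norm l + 1 \<and> norm (h x - h x) \<le> (norm l + 1) * \<Phi> x"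
  proof eventually_elim
    case (elim x)
    have "norm (h x) \<le> norm l + norm (h x - l)" using norm_triangle_ineq[of l "h x - l"] by simp
    thus ?case using elim pos[of x] by (simp add: dist_norm)
  qed
  thus ?thesis unfolding lip_def by blast
qed

lemma lip_diff:
  assumes "lip \<Phi> F f1 g1" "lip \<Phi> F f2 g2" and pos: "\<And>x. \<Phi> x \<ge> 0"
  shows "lip \<Phi> F (\<lambda>x. f1 x - f2 x) (\<lambda>x. g1 x - g2 x)"
proof -
  have "lip \<Phi> F (\<lambda>_. -1) (\<lambda>_. -1)" by (rule lip_same[OF tendsto_const pos])
  from lip_add[OF assms(1) lip_mult[OF this assms(2) pos] pos] show ?thesis by simp
qed

lemma lip_inverse:
  assumes l: "lip \<Phi> F f g" and f: "(f \<longlongrightarrow> c) F" and g: "(g \<longlongrightarrow> c) F" and c: "c \<noteq> 0" and pos: "\<And>x. \<Phi> x \<ge> 0"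
  shows "lip \<Phi> F (\<lambda>x. inverse (f x)) (\<lambda>x. inverse (g x))"
proof -
  obtain C where C: "C \<ge> 0" "\<forall>\<^sub>F x in F. norm (f x) \<le> C \<and> norm (g x) \<le> C \<and> norm (f x - g x) \<le> C * \<bar>\<Phi> x\<bar>"
    by (rule lipE[OF l])
  define e where "e = norm c / 2"
  have e: "e > 0" using c by (simp add: e_def)
  have ev: "\<forall>\<^sub>F x in F. e < norm (f x)" "\<forall>\<^sub>F x in F. e < norm (g x)"
    using order_tendstoD(1)[OF tendsto_norm[OF f], of e] order_tendstoD(1)[OF tendsto_norm[OF g], of e] c
    by (simp_all add: e_def)
  define D where "D = inverse e + C * (inverse e * inverse e)"
  have D: "inverse e \<le> D" "C * (inverse e * inverse e) \<le> D" using e C(1) by (simp_all add: D_def)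
  have "\<forall>\<^sub>F x in F. norm (inverse (f x)) \<le> D \<and> norm (inverse (g x)) \<le> D \<and> norm (inverse (f x) - inverse (g x)) \<le> D * \<Phi> x"
    using C(2) ev
  proof eventually_elim
    case (elim x)
    have nz: "f x \<noteq> 0" "g x \<noteq> 0" using elim e by auto
    have i: "norm (inverse (f x)) \<le> inverse e" "norm (inverse (g x)) \<le> inverse e"
      unfolding norm_inverse using elim e by (simp_all add: le_imp_inverse_le)
    have "inverse (f x) - inverse (g x) = (g x - f x) * (inverse (f x) * inverse (g x))"
      using nz by (simp add: field_simps)
    hence "norm (inverse (f x) - inverse (g x)) = norm (f x - g x) * (norm (inverse (f x)) * norm (inverse (g x)))"
      by (simp add: norm_mult norm_minus_commute)
    also have "\<dots> \<le> (C * \<Phi> x) * (inverse e * inverse e)"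
      using elim i e pos[of x] C(1) by (intro mult_mono) auto
    also have "\<dots> = (C * (inverse e * inverse e)) * \<Phi> x" by simp
    also have "\<dots> \<le> D * \<Phi> x" using D(2) pos[of x] by (rule mult_right_mono)
    finally show ?case using i D(1) by linarith
  qed
  thus ?thesis unfolding lip_def by blast
qed

lemma PVI_rhs_lip:
  assumes y: "lip \<Phi> (nhds x0) y1 y2" and p: "lip \<Phi> (nhds x0) p1 p2" and pos: "\<And>x. \<Phi> x \<ge> 0"
    and ty: "(y1 \<longlongrightarrow> c) (nhds x0)" "(y2 \<longlongrightarrow> c) (nhds x0)"
    and c: "c \<noteq> 0" "c \<noteq> 1" "c \<noteq> x0" and x0: "x0 \<noteq> 0" "x0 \<noteq> 1"
  shows "lip \<Phi> (nhds x0) (\<lambda>x. PVI_rhs \<alpha> \<beta> \<gamma> \<delta> x (y1 x) (p1 x)) (\<lambda>x. PVI_rhs \<alpha> \<beta> \<gamma> \<delta> x (y2 x) (p2 x))"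
proof -
  note add = lip_add[OF _ _ pos] and mult = lip_mult[OF _ _ pos] and diff = lip_diff[OF _ _ pos] and const = lip_same[OF _ pos]
  have tx: "((\<lambda>x. x) \<longlongrightarrow> x0) (nhds x0)" by (rule filterlim_ident)
  have k: "lip \<Phi> (nhds x0) (\<lambda>_. k) (\<lambda>_. k)" for k by (rule const[OF tendsto_const])
  have X: "lip \<Phi> (nhds x0) (\<lambda>x. x) (\<lambda>x. x)" by (rule const[OF tx])
  have iX: "lip \<Phi> (nhds x0) (\<lambda>x. inverse x) (\<lambda>x. inverse x)" by (rule const[OF tendsto_inverse[OF tx x0(1)]])
  have iX1: "lip \<Phi> (nhds x0) (\<lambda>x. inverse (x - 1)) (\<lambda>x. inverse (x - 1))"
    by (rule const[OF tendsto_inverse[OF tendsto_diff[OF tx tendsto_const]]]) (use x0 in simp)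
  have iY: "lip \<Phi> (nhds x0) (\<lambda>x. inverse (y1 x)) (\<lambda>x. inverse (y2 x))"
    by (rule lip_inverse[OF y ty c(1) pos])
  have iY1: "lip \<Phi> (nhds x0) (\<lambda>x. inverse (y1 x - 1)) (\<lambda>x. inverse (y2 x - 1))"
    by (rule lip_inverse[OF diff[OF y k] tendsto_diff[OF ty(1) tendsto_const] tendsto_diff[OF ty(2) tendsto_const] _ pos])
       (use c in simp)
  have iYX: "lip \<Phi> (nhds x0) (\<lambda>x. inverse (y1 x - x)) (\<lambda>x. inverse (y2 x - x))"
    by (rule lip_inverse[OF diff[OF y X] tendsto_diff[OF ty(1) tx] tendsto_diff[OF ty(2) tx] _ pos])
       (use c in simp)
  show ?thesis
    unfolding PVI_rhs_def divide_inverse power2_eq_square inverse_mult_distrib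
    by (intro add mult diff k X iX iX1 iY iY1 iYX y p)
qed

text \<open>Let \<open>d\<close> be the difference of the solutions and \<open>M\<close> the maximum of \<open>|d| + |d'|\<close> on a disc of radius \<open>r\<close>. Since
  \<open>|d''| \<le> C M\<close>, the mean value inequality yields \<open>M \<le> r (1 + C) M\<close>.\<close>

lemma PVI_unique:
  assumes an: "y1 analytic_on {x0}" "y2 analytic_on {x0}"
    and eq0: "y1 x0 = y2 x0" "deriv y1 x0 = deriv y2 x0"
    and c: "y1 x0 \<noteq> 0" "y1 x0 \<noteq> 1" "y1 x0 \<noteq> x0" and x0: "x0 \<noteq> 0" "x0 \<noteq> 1"
    and ode1: "\<forall>\<^sub>F x in nhds x0. deriv (deriv y1) x = PVI_rhs \<alpha> \<beta> \<gamma> \<delta> x (y1 x) (deriv y1 x)"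
    and ode2: "\<forall>\<^sub>F x in nhds x0. deriv (deriv y2) x = PVI_rhs \<alpha> \<beta> \<gamma> \<delta> x (y2 x) (deriv y2 x)"
  shows "\<forall>\<^sub>F x in nhds x0. y1 x = y2 x"
proof -
  define \<Phi> where "\<Phi> = (\<lambda>x. norm (y1 x - y2 x) + norm (deriv y1 x - deriv y2 x))"
  have pos: "\<Phi> x \<ge> 0" for x by (simp add: \<Phi>_def)
  have an': "deriv y1 analytic_on {x0}" "deriv y2 analytic_on {x0}" using an by (auto intro: analytic_deriv)
  have t: "(f \<longlongrightarrow> f x0) (nhds x0)" if "f analytic_on {x0}" for f :: "complex \<Rightarrow> complex"
    using analytic_at_imp_isCont[OF that] by (simp add: isCont_def tendsto_at_iff_tendsto_nhds)
  have bd: "lip \<Phi> (nhds x0) f g"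
    if "f analytic_on {x0}" "g analytic_on {x0}" "\<And>x. norm (f x - g x) \<le> \<Phi> x" for f g
  proof -
    have ev: "\<forall>\<^sub>F x in nhds x0. dist (f x) (f x0) < 1" "\<forall>\<^sub>F x in nhds x0. dist (g x) (g x0) < 1"
      by (rule tendstoD[OF t[OF that(1)]], simp) (rule tendstoD[OF t[OF that(2)]], simp)
    define C where "C = norm (f x0) + norm (g x0) + 1"
    have C: "C \<ge> 1" by (simp add: C_def)
    have "\<forall>\<^sub>F x in nhds x0. norm (f x) \<le> C \<and> norm (g x) \<le> C \<and> norm (f x - g x) \<le> C * \<Phi> x"
      using ev
    proof eventually_elim
      case (elim x)
      have "norm (f x) \<le> norm (f x0) + norm (f x - f x0)" "norm (g x) \<le> norm (g x0) + norm (g x - g x0)"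
        using norm_triangle_ineq[of "f x0" "f x - f x0"] norm_triangle_ineq[of "g x0" "g x - g x0"] by simp_all
      hence "norm (f x) \<le> C" "norm (g x) \<le> C"
        using elim norm_ge_zero[of "f x0"] norm_ge_zero[of "g x0"] unfolding C_def dist_norm by linarith+
      moreover have "1 * \<Phi> x \<le> C * \<Phi> x" using C pos by (intro mult_right_mono) auto
      ultimately show ?case using that(3)[of x] by linarith
    qed
    thus ?thesis unfolding lip_def by blast
  qed
  have l: "lip \<Phi> (nhds x0) y1 y2" "lip \<Phi> (nhds x0) (deriv y1) (deriv y2)"
    by (rule bd[OF an], simp add: \<Phi>_def) (rule bd[OF an'], simp add: \<Phi>_def)
  have ty: "(y1 \<longlongrightarrow> y1 x0) (nhds x0)" "(y2 \<longlongrightarrow> y1 x0) (nhds x0)"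
    using t[OF an(1)] t[OF an(2)] eq0(1) by simp_all
  have "lip \<Phi> (nhds x0) (\<lambda>x. PVI_rhs \<alpha> \<beta> \<gamma> \<delta> x (y1 x) (deriv y1 x)) (\<lambda>x. PVI_rhs \<alpha> \<beta> \<gamma> \<delta> x (y2 x) (deriv y2 x))"
    by (rule PVI_rhs_lip[OF l pos ty c x0])
  then obtain C where C: "C \<ge> 0" "\<forall>\<^sub>F x in nhds x0. norm (PVI_rhs \<alpha> \<beta> \<gamma> \<delta> x (y1 x) (deriv y1 x)) \<le> C \<and>
      norm (PVI_rhs \<alpha> \<beta> \<gamma> \<delta> x (y2 x) (deriv y2 x)) \<le> C \<and>
      norm (PVI_rhs \<alpha> \<beta> \<gamma> \<delta> x (y1 x) (deriv y1 x) - PVI_rhs \<alpha> \<beta> \<gamma> \<delta> x (y2 x) (deriv y2 x)) \<le> C * \<bar>\<Phi> x\<bar>"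
    by (rule lipE)
  have "\<forall>\<^sub>F x in nhds x0. y1 analytic_on {x}" "\<forall>\<^sub>F x in nhds x0. y2 analytic_on {x}"
    using an unfolding analytic_at eventually_nhds by blast+
  with C(2) ode1 ode2 have "\<forall>\<^sub>F x in nhds x0. norm (deriv (deriv y1) x - deriv (deriv y2) x) \<le> C * \<Phi> x \<and>
      y1 analytic_on {x} \<and> y2 analytic_on {x}"
    by eventually_elim (use pos in simp)
  then obtain R where R: "R > 0" "\<And>x. dist x x0 < R \<Longrightarrow> norm (deriv (deriv y1) x - deriv (deriv y2) x) \<le> C * \<Phi> x"
    "\<And>x. dist x x0 < R \<Longrightarrow> y1 analytic_on {x} \<and> y2 analytic_on {x}"
    unfolding eventually_nhds_metric by blast
  \<comment> \<open>Small enough for \<open>r (1 + C) < 1\<close>, so that \<open>\<Phi> w \<le> r (1 + C) \<Phi> w\<close> at a maximum \<open>w\<close> forces \<open>\<Phi> w = 0\<close>.\<close>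
  define r where "r = min (R / 2) (1 / (2 * (1 + C)))"
  have r: "r > 0" "r < R" "r * (1 + C) \<le> 1/2"
  proof -
    show "r > 0" "r < R" using R(1) C(1) by (simp_all add: r_def min_def)
    have "r * (1 + C) \<le> 1 / (2 * (1 + C)) * (1 + C)" using C(1) by (intro mult_right_mono) (simp_all add: r_def)
    also have "\<dots> = 1/2" using C(1) by (simp add: field_simps)
    finally show "r * (1 + C) \<le> 1/2" .
  qed
  define S where "S = cball x0 r"
  have SR: "dist x x0 < R" if "x \<in> S" for x using that r(2) by (simp add: S_def dist_commute)
  have d0: "(y1 has_field_derivative deriv y1 x) (at x)" "(y2 has_field_derivative deriv y2 x) (at x)"
    "(deriv y1 has_field_derivative deriv (deriv y1) x) (at x)" "(deriv y2 has_field_derivative deriv (deriv y2) x) (at x)"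
    if "x \<in> S" for x
    using R(3)[OF SR[OF that]] by (simp_all add: analytic_derivI analytic_deriv)
  have cont: "continuous_on S \<Phi>"
    unfolding \<Phi>_def
    by (intro continuous_on_add continuous_on_norm continuous_on_diff continuous_at_imp_continuous_on ballI
        DERIV_isCont[OF d0(1)] DERIV_isCont[OF d0(2)] DERIV_isCont[OF d0(3)] DERIV_isCont[OF d0(4)])
  have x0S: "x0 \<in> S" using r(1) by (simp add: S_def)
  obtain w where w: "w \<in> S" "\<And>x. x \<in> S \<Longrightarrow> \<Phi> x \<le> \<Phi> w"
    using continuous_attains_sup[OF _ _ cont] compact_cball[of x0 r] x0S unfolding S_def by blast
  have wr: "norm (w - x0) \<le> r" using w(1) by (simp add: S_def dist_norm norm_minus_commute)
  have 1: "norm ((y1 w - y2 w) - (y1 x0 - y2 x0)) \<le> \<Phi> w * norm (w - x0)"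
  proof (rule field_differentiable_bound[where S = S and f' = "\<lambda>x. deriv y1 x - deriv y2 x"])
    show "((\<lambda>x. y1 x - y2 x) has_field_derivative deriv y1 z - deriv y2 z) (at z within S)" if "z \<in> S" for z
      by (rule has_field_derivative_at_within[OF DERIV_diff[OF d0(1,2)[OF that]]])
    show "norm (deriv y1 z - deriv y2 z) \<le> \<Phi> w" if "z \<in> S" for z
      using w(2)[OF that] norm_ge_zero[of "y1 z - y2 z"] unfolding \<Phi>_def by linarith
  qed (use w(1) x0S in \<open>simp_all add: S_def\<close>)
  have 2: "norm ((deriv y1 w - deriv y2 w) - (deriv y1 x0 - deriv y2 x0)) \<le> (C * \<Phi> w) * norm (w - x0)"
  proof (rule field_differentiable_bound[where S = S and f' = "\<lambda>x. deriv (deriv y1) x - deriv (deriv y2) x"])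
    show "((\<lambda>x. deriv y1 x - deriv y2 x) has_field_derivative deriv (deriv y1) z - deriv (deriv y2) z) (at z within S)" if "z \<in> S" for z
      by (rule has_field_derivative_at_within[OF DERIV_diff[OF d0(3,4)[OF that]]])
    show "norm (deriv (deriv y1) z - deriv (deriv y2) z) \<le> C * \<Phi> w" if "z \<in> S" for z
      using R(2)[OF SR[OF that]] mult_left_mono[OF w(2)[OF that] C(1)] by linarith
  qed (use w(1) x0S in \<open>simp_all add: S_def\<close>)
  have "\<Phi> w \<le> \<Phi> w * norm (w - x0) + (C * \<Phi> w) * norm (w - x0)"
    using add_mono[OF 1 2] unfolding eq0 diff_self diff_zero by (simp only: \<Phi>_def)
  also have "\<dots> = ((1 + C) * \<Phi> w) * norm (w - x0)" by (simp add: algebra_simps)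
  also have "\<dots> \<le> ((1 + C) * \<Phi> w) * r" using C(1) pos[of w] by (intro mult_left_mono[OF wr] mult_nonneg_nonneg) linarith+
  also have "\<dots> = (r * (1 + C)) * \<Phi> w" by (simp add: algebra_simps)
  also have "\<dots> \<le> 1/2 * \<Phi> w" using mult_right_mono[OF r(3) pos[of w]] .
  finally have "\<Phi> w = 0" using pos[of w] by linarith
  hence eq: "y1 x = y2 x" if "x \<in> S" for x
  proof -
    have "norm (y1 x - y2 x) \<le> 0"
      using w(2)[OF that] \<open>\<Phi> w = 0\<close> norm_ge_zero[of "deriv y1 x - deriv y2 x"] unfolding \<Phi>_def by linarith
    thus ?thesis by simp
  qed
  have "\<forall>\<^sub>F x in nhds x0. x \<in> ball x0 r" by (rule eventually_nhds_in_open) (use r(1) in simp_all)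
  thus ?thesis by (rule eventually_mono) (use eq in \<open>simp add: S_def\<close>)
qed

section \<open>Every nonsingular solution has Hitchin's form\<close>

text \<open>At a half period \<open>\<theta>\<^sub>1' / \<theta>\<^sub>1\<close> equals \<open>- 2 \<pi> \<i> a\<close> by oddness and quasi-periodicity; constants with
  \<open>\<zeta> \<noteq> 0\<close> at some point are therefore admissible.\<close>

lemma zet_nonzero_imp_admissible:
  assumes \<tau>: "Im \<tau> > 0" and t1: "theta1 (a * \<tau> + b) \<tau> \<noteq> 0" and z: "theta_line.zet a b \<tau> \<noteq> 0"
  shows "\<not> (2 * a \<in> \<int> \<and> 2 * b \<in> \<int>)"
proof
  assume "2 * a \<in> \<int> \<and> 2 * b \<in> \<int>"
  then obtain n m :: int where n: "2 * a = of_int n" and m: "2 * b = of_int m" by (auto elim!: Ints_cases)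
  define L where "L = (\<lambda>z. theta1_deriv 1 z \<tau> / theta1 z \<tau>)"
  have d: "((\<lambda>z. theta1 z \<tau>) has_field_derivative theta1_deriv 1 z \<tau>) (at z)" for z
    using theta_derivs_DERIV_at(1)[OF \<tau>, of 0 z UNIV] by simp
  have per: "theta1 (z + 1) \<tau> \<noteq> 0 \<and> L (z + 1) = L z" if "theta1 z \<tau> \<noteq> 0" for z
  proof -
    have "((\<lambda>z. theta1 (z + 1) \<tau>) has_field_derivative theta1_deriv 1 (z + 1) \<tau>) (at z)"
      using d[of "z + 1"] by (simp add: DERIV_shift)
    moreover have "((\<lambda>z. theta1 (z + 1) \<tau>) has_field_derivative - theta1_deriv 1 z \<tau>) (at z)"
      unfolding theta1_shift_1 by (rule DERIV_minus[OF d])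
    ultimately have "theta1_deriv 1 (z + 1) \<tau> = - theta1_deriv 1 z \<tau>" by (rule DERIV_unique)
    thus ?thesis using that by (simp add: L_def theta1_shift_1)
  qed
  have pert: "theta1 (z + \<tau>) \<tau> \<noteq> 0 \<and> L (z + \<tau>) = L z - 2 * of_real pi * \<i>" if "theta1 z \<tau> \<noteq> 0" for z
  proof -
    define E where "E = (\<lambda>z. - exp (- (of_real pi * \<i> * \<tau>) - 2 * of_real pi * \<i> * z))"
    have dE: "(E has_field_derivative - (2 * of_real pi * \<i>) * E z) (at z)"
      unfolding E_def by (rule derivative_eq_intros refl | simp)+
    have t: "theta1 (z + \<tau>) \<tau> = E z * theta1 z \<tau>" for z by (simp only: theta1_shift_tau E_def)
    have "((\<lambda>z. theta1 (z + \<tau>) \<tau>) has_field_derivative theta1_deriv 1 (z + \<tau>) \<tau>) (at z)"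
      using d[of "z + \<tau>"] by (simp add: DERIV_shift)
    moreover have "((\<lambda>z. theta1 (z + \<tau>) \<tau>) has_field_derivative (- (2 * of_real pi * \<i>) * E z) * theta1 z \<tau> + theta1_deriv 1 z \<tau> * E z) (at z)"
      unfolding t by (rule DERIV_mult[OF dE d])
    ultimately have e: "theta1_deriv 1 (z + \<tau>) \<tau> = (- (2 * of_real pi * \<i>) * E z) * theta1 z \<tau> + theta1_deriv 1 z \<tau> * E z"
      by (rule DERIV_unique)
    have E0: "E z \<noteq> 0" by (simp add: E_def)
    show ?thesis unfolding L_def e t using that E0 by (simp add: field_simps)
  qed
  have shift: "theta1 (z + of_int k * w) \<tau> \<noteq> 0 \<and> L (z + of_int k * w) = L z + of_int k * c"
    if nz: "theta1 z \<tau> \<noteq> 0" and p: "\<And>z. theta1 z \<tau> \<noteq> 0 \<Longrightarrow> theta1 (z + w) \<tau> \<noteq> 0 \<and> L (z + w) = L z + c"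
      and q: "\<And>z. theta1 (z + w) \<tau> \<noteq> 0 \<Longrightarrow> theta1 z \<tau> \<noteq> 0" for z w c k
  proof (induction k rule: int_induct[where k = 0])
    case (step1 i)
    thus ?case using p[of "z + of_int i * w"] by (simp add: algebra_simps)
  next
    case (step2 i)
    have e: "z + of_int i * w = (z + of_int (i - 1) * w) + w" by (simp add: algebra_simps)
    have "theta1 (z + of_int (i - 1) * w) \<tau> \<noteq> 0" by (rule q) (use step2 e in simp)
    thus ?case using p[of "z + of_int (i - 1) * w"] step2 unfolding e by (simp add: algebra_simps)
  qed (use nz in simp)
  have odd: "L (- z) = - L z" for z
  proof -
    have "((\<lambda>z. theta1 (- z) \<tau>) has_field_derivative theta1_deriv 1 (- z) \<tau> * - 1) (at z)"
      by (rule DERIV_chain2[OF d]) (rule derivative_eq_intros refl | simp)+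
    moreover have "((\<lambda>z. theta1 (- z) \<tau>) has_field_derivative - theta1_deriv 1 z \<tau>) (at z)"
      unfolding theta1_minus by (rule DERIV_minus[OF d])
    ultimately have "theta1_deriv 1 (- z) \<tau> * - 1 = - theta1_deriv 1 z \<tau>" by (rule DERIV_unique)
    thus ?thesis by (simp add: L_def theta1_minus)
  qed
  define s where "s = a * \<tau> + b"
  have s: "theta1 s \<tau> \<noteq> 0" "theta1 (- s) \<tau> \<noteq> 0" using t1 by (simp_all only: s_def theta1_minus neg_equal_0_iff_equal not_False_eq_True)
  have 1: "theta1 (- s + of_int m * 1) \<tau> \<noteq> 0 \<and> L (- s + of_int m * 1) = L (- s) + of_int m * 0"
    by (rule shift[OF s(2)]) (use per theta1_shift_1 in auto)
  have 2: "theta1 (- s + of_int m * 1 + of_int n * \<tau>) \<tau> \<noteq> 0 \<and>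
      L (- s + of_int m * 1 + of_int n * \<tau>) = L (- s + of_int m * 1) + of_int n * (- (2 * of_real pi * \<i>))"
    by (rule shift) (use 1 pert theta1_shift_tau in auto)
  have e: "- s + of_int m * 1 + of_int n * \<tau> = s" unfolding n[symmetric] m[symmetric] by (simp add: s_def algebra_simps)
  have "L s = L (- s + of_int m * 1) + of_int n * (- (2 * of_real pi * \<i>))"
    using 2 unfolding e by (rule conjunct2)
  also have "L (- s + of_int m * 1) = - L s" using conjunct2[OF 1] by (simp only: odd mult_zero_right add_0_right)
  finally have "L s = - L s + of_int n * (- (2 * of_real pi * \<i>))" .
  hence "2 * (L s + 2 * of_real pi * \<i> * a) = 0" unfolding n[symmetric] by (simp add: algebra_simps)
  hence "L s + 2 * of_real pi * \<i> * a = 0" by (subst (asm) mult_eq_0_iff) simp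
  thus False using z by (simp add: theta_line.zet_def L_def s_def)
qed

text \<open>The formula for \<open>y'\<close> in terms of \<open>u\<close> can be solved for \<open>u\<close>; the four Riccati equations say that the
  resulting value of \<open>u\<close> is \<open>\<infinity>\<close>, 0, 1 or \<open>x\<close>. For any other value there is a point \<open>z\<^sub>0\<close> with
  \<open>U(z\<^sub>0) = u\<close>, and \<open>A\<close> is then determined by \<open>y - u = V / (2 \<zeta>)\<close>.\<close>

lemma initial_values_attained:
  fixes x y0 p0 :: complex
  assumes x: "x \<in> cut_plane"
    and y0: "y0 \<noteq> 0" "y0 \<noteq> 1" "y0 \<noteq> x"
    and R1: "2 * x * (x - 1) * p0 - (- (y0^2 - 2 * x * y0 + x)) \<noteq> 0"
    and R2: "2 * x * (x - 1) * p0 - (y0^2 - 2 * y0 + x) \<noteq> 0"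
    and R3: "2 * x * (x - 1) * p0 - (y0^2 - x) \<noteq> 0"
    and R4: "2 * x * (x - 1) * p0 - (y0^2 - 2 * (1 - x) * y0 - x) \<noteq> 0"
  obtains A B where "admissible_constants A B" "hitchin_solution.good A B x"
    "hitchin_y A B x = y0" "deriv (hitchin_y A B) x = p0"
proof -
  define \<tau> where "\<tau> = tau_of x"
  have \<tau>: "Im \<tau> > 0" unfolding \<tau>_def by (rule Im_tau_of[OF x])
  have lam: "theta_lambda \<tau> = x" unfolding \<tau>_def by (rule theta_lambda_tau_of[OF x])
  note nz = theta_constants_nonzero[OF \<tau>]
  have x01: "x \<noteq> 0" "x - 1 \<noteq> 0" using theta_lambda_not_0_1[OF \<tau>] lam by auto
  \<comment> \<open>The equation for \<open>y'\<close> reads \<open>E = 2 y (y - 1) (y - x) / (y - u)\<close>; \<open>w\<close> is the resulting value of \<open>y - u\<close>.\<close>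
  define E where "E = 2 * x * (x - 1) * p0 + (y0^2 - 2 * x * y0 + x)"
  have E: "E \<noteq> 0" using R1 by (simp only: E_def diff_minus_eq_add not_False_eq_True)
  define w where "w = 2 * (y0 * (y0 - 1) * (y0 - x)) / E"
  have w: "w \<noteq> 0" using E y0 by (simp add: w_def)
  have wE: "w * E = 2 * (y0 * (y0 - 1) * (y0 - x))" using E by (simp add: w_def)
  define u where "u = y0 - w"
  note u_eq = u_def
  have "u \<noteq> 0"
  proof
    assume "u = 0"
    hence "y0 * E = y0 * (2 * ((y0 - 1) * (y0 - x)))" using wE by (simp add: u_def)
    hence "E = 2 * ((y0 - 1) * (y0 - x))" using y0 by simp
    thus False using R2 by (simp add: E_def algebra_simps power2_eq_square)
  qed
  have "u \<noteq> 1"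
  proof
    assume "u = 1"
    hence "w = y0 - 1" by (simp add: u_def algebra_simps)
    hence "(y0 - 1) * E = (y0 - 1) * (2 * (y0 * (y0 - x)))" using wE by simp
    hence "E = 2 * (y0 * (y0 - x))" using y0 by simp
    thus False using R3 by (simp add: E_def algebra_simps power2_eq_square)
  qed
  have "u \<noteq> x"
  proof
    assume "u = x"
    hence "w = y0 - x" by (simp add: u_def algebra_simps)
    hence "(y0 - x) * E = (y0 - x) * (2 * (y0 * (y0 - 1)))" using wE by simp
    hence "E = 2 * (y0 * (y0 - 1))" using y0 by simp
    thus False using R4 by (simp add: E_def algebra_simps power2_eq_square)
  qed
  obtain z where z: "theta1 z \<tau> \<noteq> 0" "(theta2 z \<tau> / theta1 z \<tau>)^2 = - u / (theta4 0 \<tau> / theta3 0 \<tau>)^2"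
    using theta_quotient_surjective[OF \<tau>] by blast
  have Uz: "ell_U z \<tau> = u" using z(2) nz by (simp add: ell_U_def)
  have th: "theta2 z \<tau> \<noteq> 0" "theta3 z \<tau> \<noteq> 0" "theta4 z \<tau> \<noteq> 0"
    using ell_U_minus[OF \<tau> z(1)] \<open>u \<noteq> 0\<close> \<open>u \<noteq> 1\<close> \<open>u \<noteq> x\<close> Uz lam by (auto simp: ell_U_def)
  have V: "ell_V z \<tau> \<noteq> 0" using z th nz by (simp add: ell_V_def)
  define \<zeta> where "\<zeta> = ell_V z \<tau> / (2 * w)"
  have \<zeta>: "\<zeta> \<noteq> 0" using V w by (simp add: \<zeta>_def)
  define a where "a = (\<zeta> - theta1_deriv 1 z \<tau> / theta1 z \<tau>) / (2 * of_real pi * \<i>)"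
  note a_eq = a_def
  define A B where "A = \<i> * a" "B = z - a * \<tau>"
  note AB = this
  interpret hitchin_solution A B .
  have aa: "hitchin_solution.a A = a" by (simp add: hitchin_solution.a_def AB)
  have zz: "a * \<tau> + B = z" by (simp add: AB)
  have zet: "theta_line.zet a B \<tau> = \<zeta>" 
  proof -
    have "2 * of_real pi * \<i> * a = \<zeta> - theta1_deriv 1 z \<tau> / theta1 z \<tau>" by (simp add: a_eq)
    thus ?thesis unfolding theta_line.zet_def zz by simp
  qed
  have good: "good x"
    unfolding good_def aa \<tau>_def[symmetric] theta_line.regular_def zz zet using x \<tau> z th \<zeta> by simp
  have "\<not> (2 * a \<in> \<int> \<and> 2 * B \<in> \<int>)"
    by (rule zet_nonzero_imp_admissible[OF \<tau>]) (simp_all add: zz z zet \<zeta>)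
  moreover have "2 * \<i> * A = - (2 * a)" by (simp add: AB)
  ultimately have adm: "admissible_constants A B" unfolding admissible_constants_def by (simp only: minus_in_Ints_iff not_False_eq_True)
  have ux: "hitchin_solution.u A B x = u"
    unfolding hitchin_solution.u_def aa \<tau>_def[symmetric] theta_line.u_def zz by (rule Uz)
  have yx: "y x = y0"
  proof -
    have "y x = u + ell_V z \<tau> / (2 * \<zeta>)"
      unfolding y_def aa \<tau>_def[symmetric] theta_line.y_def theta_line.u_def theta_line.v_def zz zet Uz ..
    also have "ell_V z \<tau> / (2 * \<zeta>) = w" using V by (simp add: \<zeta>_def)
    finally show ?thesis by (simp add: u_eq)
  qed
  have "deriv y x = (2 * (y0 * (y0 - 1) * (y0 - x)) * (1 / w) - (y0^2 - 2 * x * y0 + x)) / (2 * (x * (x - 1)))"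
    using DERIV_imp_deriv[OF u_y_DERIV(2)[OF good]] unfolding yx ux by (simp add: u_eq)
  also have "2 * (y0 * (y0 - 1) * (y0 - x)) * (1 / w) = E" using wE w by (simp add: field_simps)
  also have "(E - (y0^2 - 2 * x * y0 + x)) / (2 * (x * (x - 1))) = p0" using x01 by (simp add: E_def)
  finally have "deriv y x = p0" .
  thus ?thesis using that[OF adm good] deriv_hitchin_y[OF good] yx by simp
qed

text \<open>At a point that avoids all exceptional sets, choose \<open>A\<close> and \<open>B\<close> so that the initial values agree. The two solutions coincide
  near that point by uniqueness, and everywhere on the connected set \<open>D\<close> because their difference is meromorphic.\<close>

theorem nonsingular_solution_is_hitchin:
  assumes D: "open D" "connected D" "D \<subseteq> cut_plane"
    and sol: "PVI_solution (1/8) (1/8) (1/8) (1/8) D y" and ns: "\<not> singular_solution D y"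
  shows "\<exists>A B. admissible_constants A B \<and> (\<forall>\<^sub>\<approx>x\<in>D. y x = hitchin_y A B x)"
proof -
  have mer: "y meromorphic_on D" using sol by (simp add: PVI_solution_def)
  note mi = meromorphic_on_diff meromorphic_on_add meromorphic_on_mult meromorphic_on_power meromorphic_on_const
    meromorphic_on_id mer meromorphic_on_deriv[OF mer] meromorphic_on_uminus
  have ric: "\<forall>\<^sub>\<approx>x\<in>D. 2 * x * (x - 1) * deriv y x - q x \<noteq> 0"
    if "q meromorphic_on D" "\<not> (\<forall>\<^sub>\<approx>x\<in>D. 2 * x * (x - 1) * deriv y x = q x)" for q
  proof -
    have "(\<lambda>x. 2 * x * (x - 1) * deriv y x - q x) meromorphic_on D" by (intro mi that(1))
    from meromorphic_imp_constant_or_avoid[OF this D(1,2), of 0] that(2) show ?thesis by simp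
  qed
  have ode: "\<forall>\<^sub>\<approx>x\<in>D. y x \<noteq> 0 \<and> y x \<noteq> 1 \<and> y x \<noteq> x \<and>
        deriv (deriv y) x = PVI_rhs (1/8) (1/8) (1/8) (1/8) x (y x) (deriv y x)"
    using sol by (simp add: PVI_solution_def)
  have r: "\<forall>\<^sub>\<approx>x\<in>D. 2 * x * (x - 1) * deriv y x - (- ((y x)^2 - 2 * x * y x + x)) \<noteq> 0"
    "\<forall>\<^sub>\<approx>x\<in>D. 2 * x * (x - 1) * deriv y x - ((y x)^2 - 2 * y x + x) \<noteq> 0"
    "\<forall>\<^sub>\<approx>x\<in>D. 2 * x * (x - 1) * deriv y x - ((y x)^2 - x) \<noteq> 0"
    "\<forall>\<^sub>\<approx>x\<in>D. 2 * x * (x - 1) * deriv y x - ((y x)^2 - 2 * (1 - x) * y x - x) \<noteq> 0"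
    by (rule ric, intro mi, use ns in \<open>unfold singular_solution_def, blast\<close>)+
  have "D \<noteq> {}"
  proof
    assume "D = {}"
    hence "singular_solution D y" by (simp add: singular_solution_def)
    with ns show False by simp
  qed
  hence nb: "cosparse D \<noteq> bot" by simp
  have "\<forall>\<^sub>\<approx>x\<in>D. x \<in> D" by (rule eventually_in_cosparse[OF subset_refl D(1)])
  with meromorphic_on_imp_analytic_cosparse[OF mer] ode r
  have "\<forall>\<^sub>\<approx>x\<in>D. x \<in> D \<and> y analytic_on {x} \<and> y x \<noteq> 0 \<and> y x \<noteq> 1 \<and> y x \<noteq> x \<and>
      deriv (deriv y) x = PVI_rhs (1/8) (1/8) (1/8) (1/8) x (y x) (deriv y x) \<and>
      2 * x * (x - 1) * deriv y x - (- ((y x)^2 - 2 * x * y x + x)) \<noteq> 0 \<and>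
      2 * x * (x - 1) * deriv y x - ((y x)^2 - 2 * y x + x) \<noteq> 0 \<and>
      2 * x * (x - 1) * deriv y x - ((y x)^2 - x) \<noteq> 0 \<and>
      2 * x * (x - 1) * deriv y x - ((y x)^2 - 2 * (1 - x) * y x - x) \<noteq> 0"
    by eventually_elim blast
  from eventually_happens'[OF nb this] obtain x where x: "x \<in> D" "y analytic_on {x}" "y x \<noteq> 0" "y x \<noteq> 1" "y x \<noteq> x"
      "deriv (deriv y) x = PVI_rhs (1/8) (1/8) (1/8) (1/8) x (y x) (deriv y x)"
    and ne: "2 * x * (x - 1) * deriv y x - (- ((y x)^2 - 2 * x * y x + x)) \<noteq> 0"
      "2 * x * (x - 1) * deriv y x - ((y x)^2 - 2 * y x + x) \<noteq> 0"
      "2 * x * (x - 1) * deriv y x - ((y x)^2 - x) \<noteq> 0"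
      "2 * x * (x - 1) * deriv y x - ((y x)^2 - 2 * (1 - x) * y x - x) \<noteq> 0"
    by blast
  have xc: "x \<in> cut_plane" using x(1) D(3) by blast
  obtain A B where AB: "admissible_constants A B" "hitchin_solution.good A B x"
    "hitchin_y A B x = y x" "deriv (hitchin_y A B) x = deriv y x"
    by (rule initial_values_attained[OF xc x(3-5) ne])
  interpret h: hitchin_solution A B .
  have x01: "x \<noteq> 0" "x \<noteq> 1" using h.good_imp(3,4)[OF AB(2)] by auto
  have hy: "h.y x = y x" using h.deriv_hitchin_y(1)[OF AB(2)] AB(3) by simp
  have an: "hitchin_y A B analytic_on {x}"
  proof -
    obtain S where S: "open S" "x \<in> S" "\<And>w. w \<in> S \<Longrightarrow> h.good w"
      using h.eventually_good[OF AB(2)] unfolding eventually_nhds by blast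
    have "h.y holomorphic_on S"
      by (rule holomorphic_onI) (use S(3) h.u_y_DERIV(2) in \<open>meson has_field_derivative_at_within field_differentiable_def\<close>)
    hence "h.y analytic_on {x}" using S unfolding analytic_at by blast
    thus ?thesis using analytic_at_cong[OF h.hitchin_y_eventually_eq[OF AB(2)] refl] by simp
  qed
  have ode1: "\<forall>\<^sub>F w in nhds x. deriv (deriv y) w = PVI_rhs (1/8) (1/8) (1/8) (1/8) w (y w) (deriv y w)"
    using eventually_cosparse_imp_eventually_at[OF ode x(1), of UNIV] x(6)
    by (auto simp: eventually_nhds_conv_at elim: eventually_mono)
  have ode2: "\<forall>\<^sub>F w in nhds x. deriv (deriv (hitchin_y A B)) w = PVI_rhs (1/8) (1/8) (1/8) (1/8) w (hitchin_y A B w) (deriv (hitchin_y A B) w)"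
  proof -
    have "(\<lambda>w. h.y w * (h.y w - 1) * (h.y w - w)) \<midarrow>x\<rightarrow> h.y x * (h.y x - 1) * (h.y x - x)"
      using DERIV_isCont[OF h.u_y_DERIV(2)[OF AB(2)]] unfolding isCont_def by (intro tendsto_intros)
    hence "((\<lambda>w. h.y w * (h.y w - 1) * (h.y w - w)) \<longlongrightarrow> h.y x * (h.y x - 1) * (h.y x - x)) (nhds x)"
      
      using iffD1[OF tendsto_at_iff_tendsto_nhds[of "\<lambda>w. h.y w * (h.y w - 1) * (h.y w - w)" x]] by simp
    from tendsto_imp_eventually_ne[OF this, of 0] x(3-5)
    have "\<forall>\<^sub>F w in nhds x. h.y w * (h.y w - 1) * (h.y w - w) \<noteq> 0" by (simp add: hy)
    thus ?thesis using h.eventually_good[OF AB(2)]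
    proof eventually_elim
      case (elim w)
      thus ?case unfolding h.deriv_hitchin_y[OF elim(2)] using h.painleve_at_good_point[OF elim(2)] by simp
    qed
  qed
  have "\<forall>\<^sub>F w in nhds x. y w = hitchin_y A B w"
    by (rule PVI_unique[OF x(2) an AB(3)[symmetric] AB(4)[symmetric] x(3-5) x01 ode1 ode2])
  hence loc: "\<forall>\<^sub>F w in at x. y w = hitchin_y A B w" by (simp add: eventually_nhds_conv_at)
  have "\<forall>\<^sub>\<approx>w\<in>D. y w - hitchin_y A B w = 0"
  proof (rule ccontr)
    assume "\<not> ?thesis"
    hence "\<forall>\<^sub>\<approx>w\<in>D. y w - hitchin_y A B w \<noteq> 0"
      using meromorphic_imp_constant_or_avoid[OF meromorphic_on_diff[OF mer meromorphic_on_subset[OF h.hitchin_y_meromorphic D(3)]] D(1,2), of 0]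
      by blast
    from eventually_cosparse_imp_eventually_at[OF this x(1), of UNIV] loc
    have "\<forall>\<^sub>F w in at x. False" by eventually_elim simp
    thus False by simp
  qed
  thus ?thesis using AB(1) by auto
qed

theorem theorem4:
  shows "(\<forall>A B. admissible_constants A B \<longrightarrow>
            PVI_solution (1/8) (1/8) (1/8) (1/8) cut_plane (hitchin_y A B)) \<and>
         (\<forall>D y. open D \<and> connected D \<and> D \<subseteq> cut_plane \<and>
            PVI_solution (1/8) (1/8) (1/8) (1/8) D y \<and> \<not> singular_solution D y \<longrightarrow>
            (\<exists>A B. admissible_constants A B \<and> (\<forall>\<^sub>\<approx>x\<in>D. y x = hitchin_y A B x)))"
  using hitchin_solution.hitchin_y_painleve_VI nonsingular_solution_is_hitchin by blast

end
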